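(* Let $\xi$ be a boundedly exchangeable graph process on $S$ directed by $\nu$. Let $B,C\subseteq S$ be disjoint bounded Borel sets such that $\mathbb{P}(\nu(B)=0)<1$ and $\mathbb{P}(\nu(C)=0)<1$, and let $f_B$ and $f_C$ be sampling functions for $\xi$ on $B$ and $C$, respectively. Then, for some $p\in(0,1)$, $$f_{B\cup C}(x):=\begin{cases} f_B\left(\frac{x}{p}\right), & x\in[0,p),\\ f_C\left(\frac{x-p}{1-p}\right), & x\in[p,1],\end{cases}$$ is a sampling function for $\xi$ on $B\cup C$.
   Context: Let $(S,d)$ be a complete separable metric space; "bounded" means bounded for $d$. A measure is locally finite if finite on bounded Borel sets, and simple if it is a locally finite countable sum of distinct unit point masses. An adjacency measure on $S$ is a simple measure $\xi$ on $S^2\times\{0,1\}$ such that there is a simple measure $\nu$ on $S$ with $\xi(D\times\{0,1\})=\nu^{\otimes2}(D)$ for all Borel $D\subseteq S^2$, and $\xi$ is invariant under $(x,y,a)\mapsto(y,x,a)$; $\xi$ is directed by the (unique) $\nu$. For Borel $B$, $\xi|_B$ is the restriction of $\xi$ to $B\times B\times\{0,1\}$. A graph process connected by a symmetric measurable $W:S^2\to[0,1]$ is a random adjacency measure admitting a representation $\xi\overset{a.s.}{=}\sum_{i,j\le N}\delta_{(S_i,S_j,A_{ij})}$, with $N$ a random variable in $\{0,1,\dots\}\cup\{\infty\}$, $(S_i)$ a.s. distinct random elements of $S$, and, conditionally on $(N,(S_k))$, $A_{ii}=0$, $A_{ij}$ ($i<j$) independent $\mathrm{Bernoulli}(W(S_i,S_j))$,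 $A_{ji}=A_{ij}$. It is an i.i.d. representation if in addition the $(S_k)$ are i.i.d. and $N$ is independent of $(S_k)$. A mixed binomial process is a point process equal in law to $\sum_{i\le N}\delta_{S_i}$ with $N$ an a.s. finite $\{0,1,\dots\}$-valued random variable independent of an i.i.d. sequence $(S_i)$. A mixed Poisson process is, conditionally on a random variable $\delta\ge0$, a Poisson process with intensity measure $\delta\mu$, $\mu$ locally finite. $\xi$ is boundedly exchangeable if it is directed by a mixed Poisson or mixed binomial process $\nu$ and, for every bounded Borel $B$ with $\mathbb{P}(\nu(B)=0)<1$, $\mathbb{P}(\nu(B)=n)>0$ for all $n\in\{1,2,\dots\}$. For such $\xi$ and a bounded Borel $B$ with $\mathbb{P}(\nu(B)=0)<1$, $\xi|_B$ admits an i.i.d. representation; let $\eta_B$ denote the common law of its vertex locations $(S_i)$, a probability measure on $B$ (it does not depend on the representation). A sampling function for $\xi$ on $B$ is a measurable $f_B:[0,1]\to B$ such that $f_B(U)\sim\eta_B$ when $U$ is uniform on $[0,1]$. *)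

theory Defs
  imports "HOL-Probability.Probability"
begin

text \<open>
  The complete separable metric space \<open>S\<close> is a type \<open>'a\<close> of class \<^class>\<open>polish_space\<close>, whose
  metric \<^const>\<open>dist\<close> is complete.
\<close>

section \<open>Simple measures and adjacency measures\<close>

text \<open>
  The push-forward of \<^term>\<open>count_space I\<close> under \<open>x\<close> is the sum of the unit masses at the points
  \<open>x i\<close>, \<open>i \<in> I\<close>.
\<close>

definition sum_of_diracs :: "'b measure \<Rightarrow> 'i set \<Rightarrow> ('i \<Rightarrow> 'b) \<Rightarrow> 'b measure" where
  "sum_of_diracs K I x = distr (count_space I) K x"

text \<open>
  Simplicity, relative to a notion \<open>bdd\<close> of bounded set: the point masses sit at the distinct
  elements of a countable set.
\<close>

definition simple_measure_on :: "'b measure \<Rightarrow> ('b set \<Rightarrow> bool) \<Rightarrow> 'b measure \<Rightarrow> bool" where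
  "simple_measure_on K bdd m \<longleftrightarrow>
     (\<exists>P \<subseteq> space K. countable P \<and> m = sum_of_diracs K P (\<lambda>x. x)) \<and>
     (\<forall>D \<in> sets K. bdd D \<longrightarrow> emeasure m D < \<infinity>)"

definition simple_measure :: "'a::polish_space measure \<Rightarrow> bool" where
  "simple_measure \<nu> \<longleftrightarrow> simple_measure_on borel bounded \<nu>"

text \<open>\<open>S\<^sup>2 \<times> {0,1}\<close>, with \<^const>\<open>False\<close> for 0 and \<^const>\<open>True\<close> for 1\<close>

abbreviation edge_space :: "(('a::polish_space \<times> 'a) \<times> bool) measure" where
  "edge_space \<equiv> borel \<Otimes>\<^sub>M count_space UNIV"

definition directs :: "'a::polish_space measure \<Rightarrow> (('a \<times> 'a) \<times> bool) measure \<Rightarrow> bool" where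
  "directs \<nu> \<xi> \<longleftrightarrow> simple_measure \<nu> \<and>
     (\<forall>D \<in> sets (borel :: ('a \<times> 'a) measure).
        emeasure \<xi> (D \<times> (UNIV :: bool set)) = emeasure (\<nu> \<Otimes>\<^sub>M \<nu>) D)"

text \<open>The factor \<open>{0,1}\<close> is bounded, so a set of edges is bounded iff its projection to \<open>S\<^sup>2\<close> is.\<close>

definition adjacency_measure :: "(('a::polish_space \<times> 'a) \<times> bool) measure \<Rightarrow> bool" where
  "adjacency_measure \<xi> \<longleftrightarrow>
     simple_measure_on edge_space (\<lambda>D. bounded (fst ` D)) \<xi> \<and>
     (\<exists>\<nu>. directs \<nu> \<xi>) \<and>
     distr \<xi> edge_space (\<lambda>((x, y), a). ((y, x), a)) = \<xi>"

definition restrict_adjacency ::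
  "'a::polish_space set \<Rightarrow> (('a \<times> 'a) \<times> bool) measure \<Rightarrow> (('a \<times> 'a) \<times> bool) measure" where
  "restrict_adjacency B \<xi> = density \<xi> (indicator ((B \<times> B) \<times> UNIV))"

section \<open>Random measures\<close>

text \<open>
  The \<open>\<sigma>\<close>-algebra on the measures over \<open>K\<close> generated by the evaluations \<open>m \<mapsto> m D\<close>
  (as \<^const>\<open>subprob_algebra\<close>, without the bound on the total mass).
\<close>

definition measure_algebra :: "'b measure \<Rightarrow> 'b measure measure" where
  "measure_algebra K =
     (SUP D \<in> sets K. vimage_algebra {m. sets m = sets K} (\<lambda>m. emeasure m D) borel)"

definition random_adjacency_measure ::
  "'w measure \<Rightarrow> ('w \<Rightarrow> (('a::polish_space \<times> 'a) \<times> bool) measure) \<Rightarrow> bool" where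
  "random_adjacency_measure M \<xi> \<longleftrightarrow>
     \<xi> \<in> M \<rightarrow>\<^sub>M measure_algebra edge_space \<and> (\<forall>\<omega> \<in> space M. adjacency_measure (\<xi> \<omega>))"

definition point_process :: "'w measure \<Rightarrow> ('w \<Rightarrow> 'a::polish_space measure) \<Rightarrow> bool" where
  "point_process M \<nu> \<longleftrightarrow>
     \<nu> \<in> M \<rightarrow>\<^sub>M measure_algebra borel \<and> (\<forall>\<omega> \<in> space M. simple_measure (\<nu> \<omega>))"

text \<open>
  As usual, the auxiliary random elements (vertex labels, edge variables, the mixing variable) may
  need randomness that the given probability space does not carry, for instance a random labelling
  of the points. They live on the extension of the space by an independent sequence of
  uniform variables; a random object \<open>X\<close> on \<open>M\<close> becomes \<open>X \<circ> fst\<close> there.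
\<close>

definition ext :: "'w measure \<Rightarrow> ('w \<times> (nat \<Rightarrow> real)) measure" where
  "ext M = M \<Otimes>\<^sub>M (\<Pi>\<^sub>M i\<in>UNIV. uniform_measure lborel {0..1})"

section \<open>Graph processes\<close>

definition connection_function :: "('a::polish_space \<Rightarrow> 'a \<Rightarrow> real) \<Rightarrow> bool" where
  "connection_function W \<longleftrightarrow>
     case_prod W \<in> borel_measurable borel \<and>
     (\<forall>x y. W x y = W y x) \<and> (\<forall>x y. W x y \<in> {0..1})"

definition sigma_vertices ::
  "'w measure \<Rightarrow> ('w \<Rightarrow> enat) \<Rightarrow> (nat \<Rightarrow> 'w \<Rightarrow> 'a::polish_space) \<Rightarrow> 'w measure" where
  "sigma_vertices M N S =
     vimage_algebra (space M) (\<lambda>\<omega>. (N \<omega>, \<lambda>k. S k \<omega>)) (count_space UNIV \<Otimes>\<^sub>M (\<Pi>\<^sub>M k\<in>UNIV. borel))"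

text \<open>
  Conditionally on \<open>(N, S)\<close>, the \<open>A i j\<close> with \<open>i < j\<close> are independent Bernoulli: the conditional
  probabilities of the cylinder events factorize.
\<close>

definition conditionally_bernoulli ::
  "'w measure \<Rightarrow> ('a::polish_space \<Rightarrow> 'a \<Rightarrow> real) \<Rightarrow> ('w \<Rightarrow> enat) \<Rightarrow> (nat \<Rightarrow> 'w \<Rightarrow> 'a) \<Rightarrow>
   (nat \<Rightarrow> nat \<Rightarrow> 'w \<Rightarrow> bool) \<Rightarrow> bool" where
  "conditionally_bernoulli M W N S A \<longleftrightarrow>
     (\<forall>F a. finite F \<and> F \<subseteq> {(i, j). i < j} \<longrightarrow>
        (AE \<omega> in M.
           real_cond_exp M (sigma_vertices M N S)
             (indicator {\<omega> \<in> space M. \<forall>(i, j) \<in> F. A i j \<omega> = a i j}) \<omega>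
           = (\<Prod>(i, j) \<in> F. pmf (bernoulli_pmf (W (S i \<omega>) (S j \<omega>))) (a i j))))"

text \<open>
  Vertices are indexed from 0, so the indices of the vertices present are those below \<open>N\<close>.
\<close>

definition representation ::
  "'w measure \<Rightarrow> ('w \<Rightarrow> (('a::polish_space \<times> 'a) \<times> bool) measure) \<Rightarrow>
   ('a \<Rightarrow> 'a \<Rightarrow> real) \<Rightarrow> ('w \<Rightarrow> enat) \<Rightarrow> (nat \<Rightarrow> 'w \<Rightarrow> 'a) \<Rightarrow>
   (nat \<Rightarrow> nat \<Rightarrow> 'w \<Rightarrow> bool) \<Rightarrow> bool" where
  "representation M \<xi> W N S A \<longleftrightarrow>
     N \<in> M \<rightarrow>\<^sub>M count_space UNIV \<and>
     (\<forall>k. S k \<in> M \<rightarrow>\<^sub>M borel) \<and>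
     (\<forall>i j. A i j \<in> M \<rightarrow>\<^sub>M count_space UNIV) \<and>
     (AE \<omega> in M. inj (\<lambda>k. S k \<omega>)) \<and>
     (AE \<omega> in M. \<forall>i. \<not> A i i \<omega>) \<and>
     (AE \<omega> in M. \<forall>i j. A j i \<omega> = A i j \<omega>) \<and>
     conditionally_bernoulli M W N S A \<and>
     (AE \<omega> in M. \<xi> \<omega> =
        sum_of_diracs edge_space {(i, j). enat i < N \<omega> \<and> enat j < N \<omega>}
          (\<lambda>(i, j). ((S i \<omega>, S j \<omega>), A i j \<omega>)))"

definition graph_process_connected_by ::
  "'w measure \<Rightarrow> ('w \<Rightarrow> (('a::polish_space \<times> 'a) \<times> bool) measure) \<Rightarrow> ('a \<Rightarrow> 'a \<Rightarrow> real) \<Rightarrow> bool"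
  where
  "graph_process_connected_by M \<xi> W \<longleftrightarrow>
     connection_function W \<and> random_adjacency_measure M \<xi> \<and>
     (\<exists>N S A. representation (ext M) (\<xi> \<circ> fst) W N S A)"

definition graph_process ::
  "'w measure \<Rightarrow> ('w \<Rightarrow> (('a::polish_space \<times> 'a) \<times> bool) measure) \<Rightarrow> bool" where
  "graph_process M \<xi> \<longleftrightarrow> (\<exists>W. graph_process_connected_by M \<xi> W)"

text \<open>
  An i.i.d. representation in which the vertex locations have law \<open>\<eta>\<close>. (\<^const>\<open>prob_space.indep_var\<close>
  would force \<open>N\<close> and the sequence to have the same value type.)
\<close>

definition iid_representation ::
  "'w measure \<Rightarrow> ('w \<Rightarrow> (('a::polish_space \<times> 'a) \<times> bool) measure) \<Rightarrow>
   ('a \<Rightarrow> 'a \<Rightarrow> real) \<Rightarrow> ('w \<Rightarrow> enat) \<Rightarrow> (nat \<Rightarrow> 'w \<Rightarrow> 'a) \<Rightarrow>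
   (nat \<Rightarrow> nat \<Rightarrow> 'w \<Rightarrow> bool) \<Rightarrow> 'a measure \<Rightarrow> bool" where
  "iid_representation M \<xi> W N S A \<eta> \<longleftrightarrow>
     representation M \<xi> W N S A \<and>
     prob_space.indep_vars M (\<lambda>_. borel) S UNIV \<and>
     (\<forall>k. distr M borel (S k) = \<eta>) \<and>
     prob_space.indep_set M
       (sets (vimage_algebra (space M) N (count_space UNIV)))
       (sets (vimage_algebra (space M) (\<lambda>\<omega> k. S k \<omega>) (\<Pi>\<^sub>M k\<in>UNIV. borel)))"

section \<open>Bounded exchangeability\<close>

text \<open>
  A count \<open>N\<close> with law \<open>p\<close> that is independent of an i.i.d. sequence with marginal law \<open>\<eta>\<close> is the
  same as a pair with joint law \<open>p \<otimes> \<eta>\<^sup>\<infinity>\<close>.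
\<close>

definition mixed_binomial_process ::
  "'w measure \<Rightarrow> ('w \<Rightarrow> 'a::polish_space measure) \<Rightarrow> bool" where
  "mixed_binomial_process M \<nu> \<longleftrightarrow> point_process M \<nu> \<and>
     (\<exists>(p :: nat pmf) (\<eta> :: 'a measure). prob_space \<eta> \<and> sets \<eta> = sets borel \<and>
        distr M (measure_algebra borel) \<nu> =
        distr (measure_pmf p \<Otimes>\<^sub>M (\<Pi>\<^sub>M i\<in>UNIV. \<eta>)) (measure_algebra borel)
          (\<lambda>(n, s :: nat \<Rightarrow> 'a). sum_of_diracs borel {..<n} s))"

text \<open>
  \<^const>\<open>poisson_pmf\<close> is only meaningful for positive rates; here the rate may vanish
  (and \<open>0\<^sup>0 = 1\<close>).
\<close>

definition poisson_weight :: "real \<Rightarrow> nat \<Rightarrow> real" where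
  "poisson_weight r k = r ^ k / fact k * exp (- r)"

text \<open>
  Conditionally on \<open>\<delta>\<close>, the counts of disjoint bounded Borel sets are independent, Poisson
  distributed with means \<open>\<delta> \<mu>(D\<^sub>i)\<close>.
\<close>

definition mixed_poisson_process ::
  "'w measure \<Rightarrow> ('w \<Rightarrow> 'a::polish_space measure) \<Rightarrow> bool" where
  "mixed_poisson_process M \<nu> \<longleftrightarrow> point_process M \<nu> \<and>
     (\<exists>(\<mu> :: 'a measure) \<delta>.
        sets \<mu> = sets borel \<and> (\<forall>D \<in> sets borel. bounded D \<longrightarrow> emeasure \<mu> D < \<infinity>) \<and>
        \<delta> \<in> borel_measurable (ext M) \<and> (\<forall>\<omega> \<in> space (ext M). 0 \<le> \<delta> \<omega>) \<and>
        (\<forall>(m :: nat) D (n :: nat \<Rightarrow> nat).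
           (\<forall>i<m. D i \<in> sets borel \<and> bounded (D i)) \<and> disjoint_family_on D {..<m} \<longrightarrow>
           (AE \<omega> in ext M.
              real_cond_exp (ext M) (vimage_algebra (space (ext M)) \<delta> borel)
                (indicator {\<omega> \<in> space (ext M). \<forall>i<m. emeasure (\<nu> (fst \<omega>)) (D i) = of_nat (n i)}) \<omega>
              = (\<Prod>i<m. poisson_weight (\<delta> \<omega> * measure \<mu> (D i)) (n i)))))"

definition boundedly_exchangeable ::
  "'w measure \<Rightarrow> ('w \<Rightarrow> (('a::polish_space \<times> 'a) \<times> bool) measure) \<Rightarrow>
   ('w \<Rightarrow> 'a measure) \<Rightarrow> bool" where
  "boundedly_exchangeable M \<xi> \<nu> \<longleftrightarrow>
     (\<forall>\<omega> \<in> space M. directs (\<nu> \<omega>) (\<xi> \<omega>)) \<and>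
     (mixed_poisson_process M \<nu> \<or> mixed_binomial_process M \<nu>) \<and>
     (\<forall>B \<in> sets borel. bounded B \<and> measure M {\<omega> \<in> space M. emeasure (\<nu> \<omega>) B = 0} < 1 \<longrightarrow>
        (\<forall>n\<ge>1. measure M {\<omega> \<in> space M. emeasure (\<nu> \<omega>) B = of_nat n} > 0))"

section \<open>Sampling functions\<close>

text \<open>
  The relation ``\<open>\<eta>\<close> is the law \<open>\<eta>\<^sub>B\<close> of the vertex locations in an i.i.d. representation of
  \<open>\<xi>|\<^sub>B\<close>'', with \<open>\<eta>\<^sub>B\<close> regarded as a measure on all of \<open>S\<close> that is concentrated on \<open>B\<close>. For the
  \<open>B\<close> considered there is exactly one such \<open>\<eta>\<close>.
\<close>

definition vertex_law ::
  "'w measure \<Rightarrow> ('w \<Rightarrow> (('a::polish_space \<times> 'a) \<times> bool) measure) \<Rightarrow> 'a set \<Rightarrow> 'a measure \<Rightarrow> bool"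
  where
  "vertex_law M \<xi> B \<eta> \<longleftrightarrow>
     (\<exists>W N S A. connection_function W \<and>
        iid_representation (ext M) ((\<lambda>\<omega>. restrict_adjacency B (\<xi> \<omega>)) \<circ> fst) W N S A \<eta>)"

definition sampling_function ::
  "'w measure \<Rightarrow> ('w \<Rightarrow> (('a::polish_space \<times> 'a) \<times> bool) measure) \<Rightarrow> 'a set \<Rightarrow>
   (real \<Rightarrow> 'a) \<Rightarrow> bool" where
  "sampling_function M \<xi> B f \<longleftrightarrow>
     f \<in> restrict_space borel {0..1} \<rightarrow>\<^sub>M restrict_space borel B \<and>
     (\<exists>\<eta>. vertex_law M \<xi> B \<eta> \<and> distr (restrict_space lborel {0..1}) borel f = \<eta>)"

end

theory Submission
  imports Defs "HOL-Combinatorics.Multiset_Permutations"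
begin

text \<open>
  The proof rests on one property shared by mixed Poisson and mixed binomial processes \<open>\<nu>\<close>
  (\<open>multinomial_counts\<close>). There is a locally finite measure \<open>\<mu>\<close> and, for every bounded Borel set
  \<open>D\<close>, a weight \<open>w\<close> such that for every Borel partition \<open>D\<^sub>0, \<dots>, D\<^sub>m\<close> of \<open>D\<close>
  the event \<open>\<nu> D\<^sub>j = n\<^sub>j\<close> for all \<open>j\<close> has probability
  \<open>w (\<Sum>\<^sub>j n\<^sub>j) \<Prod>\<^sub>j \<mu>(D\<^sub>j) ^ n\<^sub>j / n\<^sub>j!\<close>. In other words, given their number, the
  points of \<open>\<nu>\<close> in \<open>D\<close> are, in uniformly random order, independent with law \<open>\<mu>(\<cdot> | D)\<close>. Bounded
  exchangeability makes the weights used below positive, and this has three consequences.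

  \<^item> On the event of exactly one point in \<open>B\<close>, this point is the first vertex of any i.i.d.
    representation of \<open>\<xi>|\<^sub>B\<close>. So a vertex law on \<open>B\<close> can only be \<open>\<mu>(\<cdot> | B)\<close>
    (\<open>vertex_law_unique\<close>): this is the law of \<open>f\<^sub>B(U)\<close>, and \<open>\<mu>(\<cdot> | C)\<close> that of \<open>f\<^sub>C(U)\<close>.

  \<^item> With \<open>p = \<mu>(B) / (\<mu>(B) + \<mu>(C))\<close>, the glued function has the law
    \<open>p \<mu>(\<cdot> | B) + (1 - p) \<mu>(\<cdot> | C) = \<mu>(\<cdot> | B \<union> C)\<close> (\<open>law_glued\<close>).

  \<^item> With positive probability there are two points in \<open>B \<union> C\<close>; as \<open>\<nu>\<close> is simple, \<open>\<mu>\<close>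
    has no atom there (\<open>multinomial_counts_diffuse\<close>).

  It remains to see that \<open>\<mu>(\<cdot> | D)\<close> with \<open>D = B \<union> C\<close> is a vertex law, that is, to construct an
  i.i.d. representation of \<open>\<xi>|\<^sub>D\<close> on the extension of the probability space
  (\<open>vertex_law_exists\<close>). The graph process \<open>\<xi>\<close> comes with a representation \<open>(N, S, A)\<close> there, whose
  order of the vertices is arbitrary and which may use up all auxiliary randomness. But the sequence
  of uniform variables splits into independent copies of itself (\<open>ext_splitting\<close>), so \<open>(N, S, A)\<close>
  may be moved to one copy while the others stay fresh. The fresh copies provide a uniformly random
  order of the vertices in \<open>D\<close>, further independent locations with law \<open>\<mu>(\<cdot> | D)\<close> that continue the
  finite list to a sequence, and coins for the edges at these additional locations. Random order and
  multinomial counts give that the locations are i.i.d. and independent of their number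
  (\<open>shuffled_law\<close>, \<open>relocated_law\<close>); the edges stay conditionally independent Bernoulli because
  reordering uses only randomness independent of them (\<open>relabelled_edges_law\<close>).
\<close>

section \<open>Counting the points of directing measures\<close>

lemma emeasure_sum_of_diracs:
  assumes "\<And>i. i \<in> I \<Longrightarrow> x i \<in> space K" "X \<in> sets K"
  shows "emeasure (sum_of_diracs K I x) X = emeasure (count_space UNIV) {i \<in> I. x i \<in> X}"
proof -
  have "emeasure (sum_of_diracs K I x) X = emeasure (count_space I) (x -` X \<inter> I)"
    unfolding sum_of_diracs_def using assms by (subst emeasure_distr) auto
  also have "\<dots> = emeasure (count_space UNIV) (x -` X \<inter> I)"
    by (cases "finite (x -` X \<inter> I)") (auto simp: emeasure_count_space)
  also have "x -` X \<inter> I = {i \<in> I. x i \<in> X}" by auto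
  finally show ?thesis .
qed

lemma sum_of_diracs_reindex:
  assumes "bij_betw f I J" "x \<in> J \<rightarrow> space K"
  shows "sum_of_diracs K J x = sum_of_diracs K I (\<lambda>i. x (f i))"
proof -
  have "sum_of_diracs K J x = distr (distr (count_space I) (count_space J) f) K x"
    unfolding sum_of_diracs_def by (simp add: distr_bij_count_space[OF assms(1)])
  also have "\<dots> = distr (count_space I) K (x \<circ> f)"
    using assms by (intro distr_distr) (auto simp: bij_betw_def)
  finally show ?thesis by (simp add: sum_of_diracs_def o_def)
qed

lemma sets_sum_of_diracs [simp]: "sets (sum_of_diracs K I x) = sets K"
  by (simp add: sum_of_diracs_def)

lemma measurable_emeasure_measure_algebra:
  "D \<in> sets K \<Longrightarrow> (\<lambda>m. emeasure m D) \<in> borel_measurable (measure_algebra K)"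
  by (auto intro!: measurable_Sup1 measurable_vimage_algebra1 simp: measure_algebra_def)

lemma measurable_measure_algebra:
  assumes "\<And>a. a \<in> space M \<Longrightarrow> sets (K a) = sets N"
    and "\<And>A. A \<in> sets N \<Longrightarrow> (\<lambda>a. emeasure (K a) A) \<in> borel_measurable M"
  shows "K \<in> measurable M (measure_algebra N)"
  using assms by (auto intro!: measurable_Sup2 measurable_vimage_algebra2 simp: measure_algebra_def)

lemma space_measure_algebra: "space (measure_algebra K) = {m. sets m = sets K}"
proof -
  have "(\<lambda>D. space (vimage_algebra {m. sets m = sets K} (\<lambda>m. emeasure m D) borel)) ` sets K
    = {{m. sets m = sets K}}" by auto
  then show ?thesis unfolding measure_algebra_def by (subst space_Sup_eq_UN) auto
qed

lemma simple_measure_sets: "simple_measure \<nu> \<Longrightarrow> sets \<nu> = sets borel"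
  by (auto simp: simple_measure_def simple_measure_on_def)

lemma simple_measure_finite: "simple_measure \<nu> \<Longrightarrow> D \<in> sets borel \<Longrightarrow> bounded D \<Longrightarrow> emeasure \<nu> D < \<infinity>"
  by (auto simp: simple_measure_def simple_measure_on_def)

lemma simple_measure_singleton_le:
  fixes \<nu> :: "'a::polish_space measure"
  assumes "simple_measure \<nu>" shows "emeasure \<nu> {x} \<le> 1"
proof -
  obtain P where P: "\<nu> = sum_of_diracs borel P (\<lambda>x. x)"
    using assms by (auto simp: simple_measure_def simple_measure_on_def)
  have "emeasure \<nu> {x} = emeasure (count_space UNIV) {i\<in>P. i \<in> {x}}"
    unfolding P by (rule emeasure_sum_of_diracs) auto
  also have "\<dots> \<le> emeasure (count_space UNIV) {x}"
    by (rule emeasure_mono) auto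
  finally show ?thesis by simp
qed

lemma simple_measure_sigma_finite:
  fixes \<nu> :: "'a::polish_space measure"
  assumes "simple_measure \<nu>" shows "sigma_finite_measure \<nu>"
proof
  note [simp] = simple_measure_sets[OF assms]
  have [simp]: "space \<nu> = UNIV" using sets_eq_imp_space_eq[of \<nu> borel] by simp
  show "\<exists>A. countable A \<and> A \<subseteq> sets \<nu> \<and> \<Union> A = space \<nu> \<and> (\<forall>a\<in>A. emeasure \<nu> a \<noteq> \<infinity>)"
  proof (intro exI[of _ "range (\<lambda>n::nat. cball undefined (real n))"] conjI)
    show "\<Union> (range (\<lambda>n::nat. cball undefined (real n))) = space \<nu>"
      by (auto simp: real_arch_simple)
    show "\<forall>a\<in>range (\<lambda>n::nat. cball undefined (real n)). emeasure \<nu> a \<noteq> \<infinity>"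
      using simple_measure_finite[OF assms] by (auto simp: less_top)
  qed auto
qed

lemma ennreal_div_one: "(x :: ennreal) / 1 = x"
  by (metis divide_eq_1_ennreal ennreal_mult_divide_eq ennreal_times_divide ennreal_top_neq_one
      ennreal_zero_divide)

lemma ennreal_square_inj:
  fixes x y :: ennreal assumes "x * x = y * y" shows "x = y"
proof -
  have *: False if "a < b" "a * a = b * b" for a b :: ennreal
  proof (cases "b = \<top>")
    case True then show False using that by (auto simp: ennreal_mult_eq_top_iff less_top)
  next
    case False
    with that obtain p q where "a = ennreal p" "b = ennreal q" "p \<ge> 0" "q \<ge> 0"
      by (metis ennreal_cases top.not_eq_extremum order.asym)
    then show False using that
      by (auto simp: ennreal_mult[symmetric] ennreal_less_iff)
         (metis mult_mono mult_strict_mono order_less_irrefl order.strict_trans1)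
  qed
  show ?thesis using *[of x y] *[of y x] assms by (metis linorder_less_linear)
qed

lemma emeasure_count_space_Times:
  "emeasure (count_space UNIV) (A \<times> B) = emeasure (count_space UNIV) A * emeasure (count_space UNIV) B"
proof -
  consider "A = {}" | "B = {}" | "A \<noteq> {}" "B \<noteq> {}" "infinite A \<or> infinite B" | "finite A" "finite B"
      by blast
  then show ?thesis
  proof cases
    case 3
    then have "infinite (A \<times> B)" by (metis finite_cartesian_productD1 finite_cartesian_productD2)
    moreover have "emeasure (count_space UNIV) A \<noteq> 0" "emeasure (count_space UNIV) B \<noteq> 0"
      using 3 by (auto simp: emeasure_count_space_eq_0)
    ultimately show ?thesis using 3
      by (auto simp: emeasure_count_space ennreal_mult_top ennreal_top_mult)
  qed (auto simp: emeasure_count_space card_cartesian_product)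
qed

lemma restrict_adjacency_UNIV: "restrict_adjacency UNIV \<xi> = \<xi>"
proof -
  have "indicator ((UNIV \<times> UNIV) \<times> UNIV) = (\<lambda>_. 1 :: ennreal)" by auto
  then show ?thesis by (simp add: restrict_adjacency_def density_1)
qed

lemma emeasure_restrict_adjacency:
  assumes "sets \<xi> = sets edge_space" "D \<in> sets borel" "X \<in> sets edge_space"
  shows "emeasure (restrict_adjacency D \<xi>) X = emeasure \<xi> (X \<inter> ((D \<times> D) \<times> UNIV))"
proof -
  have "(D \<times> D) \<times> (UNIV::bool set) \<in> sets edge_space"
    using assms by (intro pair_measureI) (auto simp: borel_prod[symmetric])
  then show ?thesis unfolding restrict_adjacency_def using assms
    by (subst emeasure_density) (auto simp: indicator_inter_arith[symmetric] Int_commute)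
qed

text \<open>
  The directing measure is only known through squares: \<open>\<xi>\<close> gives the square \<open>E \<times> E\<close> the mass
  \<open>\<nu>(E)\<^sup>2\<close>, and squaring is injective on \<open>[0, \<infinity>]\<close>.
\<close>

lemma directs_count:
  fixes \<xi> :: "(('a::polish_space \<times> 'a) \<times> bool) measure"
  assumes \<xi>: "sets \<xi> = sets edge_space" and dir: "directs \<nu> \<xi>" and D: "D \<in> sets borel"
    and rep: "restrict_adjacency D \<xi> =
        sum_of_diracs edge_space {(i, j). i \<in> I \<and> j \<in> I} (\<lambda>(i, j). ((s i, s j), a i j))"
    and E: "E \<in> sets borel"
  shows "emeasure \<nu> (E \<inter> D) = emeasure (count_space UNIV) {i \<in> I. s i \<in> E}"
proof -
  have [measurable]: "E \<in> sets borel" "D \<in> sets borel" by fact+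
  have simple: "simple_measure \<nu>" using dir by (simp add: directs_def)
  have m: "F \<times> F \<in> sets (borel :: ('a \<times> 'a) measure)" if "F \<in> sets borel" for F :: "'a set"
    using that by (auto simp: borel_prod[symmetric])
  have m2: "(F \<times> F) \<times> (UNIV::bool set) \<in> sets edge_space" if "F \<in> sets borel" for F :: "'a set"
    using m[OF that] by (intro pair_measureI) auto
  have "emeasure \<nu> (E \<inter> D) * emeasure \<nu> (E \<inter> D) = emeasure (\<nu> \<Otimes>\<^sub>M \<nu>) ((E \<inter> D) \<times> (E \<inter> D))"
    by (subst sigma_finite_measure.emeasure_pair_measure_Times[OF
        simple_measure_sigma_finite[OF simple]])
       (auto simp: simple_measure_sets[OF simple])
  also have "\<dots> = emeasure \<xi> (((E \<inter> D) \<times> (E \<inter> D)) \<times> UNIV)"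
    using dir m[of "E \<inter> D"] by (auto simp: directs_def)
  also have "((E \<inter> D) \<times> (E \<inter> D)) \<times> UNIV = ((E \<times> E) \<times> UNIV) \<inter> ((D \<times> D) \<times> (UNIV::bool set))" by auto
  also have "emeasure \<xi> \<dots> = emeasure (restrict_adjacency D \<xi>) ((E \<times> E) \<times> UNIV)"
    by (rule emeasure_restrict_adjacency[symmetric]) (use \<xi> m2[of E] in auto)
  also have "\<dots> = emeasure (count_space UNIV)
      {p \<in> {(i, j). i \<in> I \<and> j \<in> I}. (case p of (i, j) \<Rightarrow> ((s i, s j), a i j)) \<in> (E \<times> E) \<times> UNIV}"
    unfolding rep by (rule emeasure_sum_of_diracs) (use m2[of E] in \<open>auto simp: space_pair_measure\<close>)
  also have "{p \<in> {(i, j). i \<in> I \<and> j \<in> I}. (case p of (i, j) \<Rightarrow> ((s i, s j), a i j)) \<in> (E \<times> E) \<times> UNIV}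
     = {i \<in> I. s i \<in> E} \<times> {i \<in> I. s i \<in> E}" by auto
  finally show ?thesis
    unfolding emeasure_count_space_Times by (rule ennreal_square_inj)
qed

section \<open>Multinomial counts of mixed Poisson and mixed binomial processes\<close>

text \<open>
  The total number of points enters only through \<open>w\<close>, the partition only through the multinomial
  weights, up to the normalization of \<open>\<mu>\<close>, which \<open>w\<close> absorbs.
\<close>

definition multinomial_counts where
  "multinomial_counts M \<nu> \<mu> D \<longleftrightarrow> (\<exists>w :: nat \<Rightarrow> real. \<forall>(m::nat) Dj n.
     (\<forall>j<m. Dj j \<in> sets borel) \<and> disjoint_family_on Dj {..<m} \<and> (\<Union>j<m. Dj j) = D \<longrightarrow>
     measure M {\<omega> \<in> space M. \<forall>j<m. emeasure (\<nu> \<omega>) (Dj j) = of_nat (n j)} =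
       w (\<Sum>j<m. n j) * (\<Prod>j<m. measure \<mu> (Dj j) ^ n j / fact (n j)))"

lemma prob_space_uniform: "prob_space (uniform_measure lborel {0..1::real})"
  by (rule prob_space_uniform_measure) auto

lemma (in prob_space) prob_space_ext: "prob_space (ext M)"
  unfolding ext_def by (intro prob_space_pair prob_space_PiM prob_space_uniform prob_space_axioms)

lemma (in prob_space) distr_ext_fst: "distr (ext M) M fst = M"
  unfolding ext_def by (intro prob_space.distr_pair_fst prob_space_PiM prob_space_uniform)

lemma measurable_ext_fst [measurable]: "fst \<in> ext M \<rightarrow>\<^sub>M M"
  unfolding ext_def by simp

lemma (in prob_space) measure_ext_fst:
  assumes [measurable]: "{\<omega> \<in> space M. P \<omega>} \<in> sets M"
  shows "measure (ext M) {z \<in> space (ext M). P (fst z)} = measure M {\<omega> \<in> space M. P \<omega>}"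
proof -
  have "measure M {\<omega> \<in> space M. P \<omega>} = measure (distr (ext M) M fst) {\<omega> \<in> space M. P \<omega>}"
    by (simp add: distr_ext_fst)
  also have "\<dots> = measure (ext M) {z \<in> space (ext M). P (fst z)}"
    by (subst measure_distr)
       (auto intro!: arg_cong[where f="measure _"] measurable_ext_fst dest:
           measurable_space[OF measurable_ext_fst])
  finally show ?thesis by simp
qed

lemma sets_count_events:
  fixes m :: nat and n :: "nat \<Rightarrow> nat"
  assumes "\<nu> \<in> M \<rightarrow>\<^sub>M measure_algebra K" "\<And>j. j < m \<Longrightarrow> D j \<in> sets K"
  shows "{\<omega> \<in> space M. \<forall>j<m. emeasure (\<nu> \<omega>) (D j) = of_nat (n j)} \<in> sets M"
proof -
  have "(\<lambda>\<omega>. emeasure (\<nu> \<omega>) (D j)) \<in> borel_measurable M" if "j < m" for j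
    using measurable_compose[OF assms(1) measurable_emeasure_measure_algebra[OF assms(2)[OF that]]] .
  then have "{\<omega> \<in> space M. emeasure (\<nu> \<omega>) (D j) = of_nat (n j)} \<in> sets M" if "j < m" for j
    using that by measurable
  then have "{\<omega> \<in> space M. \<forall>j\<in>{..<m}. emeasure (\<nu> \<omega>) (D j) = of_nat (n j)} \<in> sets M"
    by (intro sets.sets_Collect_finite_All) auto
  then show ?thesis by (simp only: lessThan_iff Ball_def)
qed

lemma (in finite_measure_subalgebra) integral_real_cond_exp_indicator:
  assumes "A \<in> sets M"
  shows "(\<integral>x. real_cond_exp M F (indicator A) x \<partial>M) = measure M A"
  using real_cond_exp_int(2)[OF integrable_real_indicator[OF assms]] sets.sets_into_space[OF assms]
  by (simp add: emeasure_eq_measure Bochner_Integration.integral_indicator Int_absorb2)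

text \<open>
  In a product of Poisson weights the rate \<open>\<delta>\<close> survives only as \<open>\<delta> ^ k * exp (- \<delta> \<mu>(D))\<close> with \<open>k\<close>
  the total count. Its expectation is the weight \<open>w k\<close>.
\<close>

lemma mixed_poisson_multinomial:
  fixes \<nu> :: "'w \<Rightarrow> 'a::polish_space measure"
  assumes "prob_space M" "mixed_poisson_process M \<nu>"
  shows "\<exists>\<mu>::'a measure. sets \<mu> = sets borel \<and> (\<forall>D\<in>sets borel. bounded D \<longrightarrow> emeasure \<mu> D < \<infinity>) \<and>
     (\<forall>D\<in>sets borel. bounded D \<longrightarrow> multinomial_counts M \<nu> \<mu> D)"
proof -
  obtain \<mu> :: "'a measure" and \<delta> where \<mu>: "sets \<mu> = sets borel"
      "\<forall>D\<in>sets borel. bounded D \<longrightarrow> emeasure \<mu> D < \<infinity>"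
    and \<delta>: "\<delta> \<in> borel_measurable (ext M)"
    and pois: "\<And>(m :: nat) D (n :: nat \<Rightarrow> nat).
           (\<forall>i<m. D i \<in> sets borel \<and> bounded (D i)) \<and> disjoint_family_on D {..<m} \<Longrightarrow>
           (AE \<omega> in ext M.
              real_cond_exp (ext M) (vimage_algebra (space (ext M)) \<delta> borel)
                (indicator {\<omega> \<in> space (ext M). \<forall>i<m. emeasure (\<nu> (fst \<omega>)) (D i) = of_nat (n i)}) \<omega>
              = (\<Prod>i<m. poisson_weight (\<delta> \<omega> * measure \<mu> (D i)) (n i)))"
    using assms(2) unfolding mixed_poisson_process_def by (elim conjE exE) (rule that, blast+)
  have \<nu>: "\<nu> \<in> M \<rightarrow>\<^sub>M measure_algebra borel"
    using assms(2) unfolding mixed_poisson_process_def point_process_def by blast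
  interpret E: prob_space "ext M" by (rule prob_space.prob_space_ext[OF assms(1)])
  let ?F = "vimage_algebra (space (ext M)) \<delta> borel"
  have sub: "subalgebra (ext M) ?F"
    unfolding subalgebra_def using sets_image_in_sets[OF refl \<delta>] by auto
  interpret F: finite_measure_subalgebra "ext M" ?F
    by (rule finite_measure_subalgebra.intro) (unfold_locales, fact sub)
  have "multinomial_counts M \<nu> \<mu> D" if D: "D \<in> sets borel" "bounded D" for D
    unfolding multinomial_counts_def
  proof (intro exI allI impI)
    fix m :: nat and Dj and n :: "nat \<Rightarrow> nat"
    assume A: "(\<forall>j<m. Dj j \<in> sets borel) \<and> disjoint_family_on Dj {..<m} \<and> (\<Union>j<m. Dj j) = D"
    then have bdd: "bounded (Dj i)" if "i < m" for i
      using D that by (auto intro: bounded_subset)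
    let ?X = "{\<omega> \<in> space (ext M). \<forall>i<m. emeasure (\<nu> (fst \<omega>)) (Dj i) = of_nat (n i)}"
    have X[measurable]: "?X \<in> sets (ext M)"
      by (rule sets_count_events[of "\<lambda>\<omega>. \<nu> (fst \<omega>)", OF measurable_compose[OF measurable_ext_fst \<nu>]])
         (use A in auto)
    have sumD: "measure \<mu> D = (\<Sum>i<m. measure \<mu> (Dj i))"
    proof -
      have "measure \<mu> (\<Union>i\<in>{..<m}. Dj i) = (\<Sum>i<m. measure \<mu> (Dj i))"
        using A bdd \<mu> by (intro measure_finite_Union) (auto simp: less_top)
      then show ?thesis using A by simp
    qed
    have "measure M {\<omega> \<in> space M. \<forall>j<m. emeasure (\<nu> \<omega>) (Dj j) = of_nat (n j)} = measure (ext M) ?X"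
      by (rule prob_space.measure_ext_fst[symmetric, OF assms(1) sets_count_events[OF \<nu>]])
          (use A in auto)
    also have "\<dots> = (\<integral>\<omega>. real_cond_exp (ext M) ?F (indicator ?X) \<omega> \<partial>ext M)"
      by (rule F.integral_real_cond_exp_indicator[OF X, symmetric])
    also have "\<dots> = (\<integral>\<omega>. (\<Prod>i<m. poisson_weight (\<delta> \<omega> * measure \<mu> (Dj i)) (n i)) \<partial>ext M)"
    proof (rule integral_cong_AE)
      have [measurable]: "\<delta> \<in> borel_measurable (ext M)" by (rule \<delta>)
      show "(\<lambda>\<omega>. \<Prod>i<m. poisson_weight (\<delta> \<omega> * measure \<mu> (Dj i)) (n i)) \<in> borel_measurable (ext M)"
        unfolding poisson_weight_def by measurable
      show "AE \<omega> in ext M. real_cond_exp (ext M) ?F (indicator ?X) \<omega> =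
          (\<Prod>i<m. poisson_weight (\<delta> \<omega> * measure \<mu> (Dj i)) (n i))"
        by (rule pois) (use A bdd in auto)
    qed measurable
    also have "\<dots> = (\<integral>\<omega>. (\<delta> \<omega> ^ (\<Sum>j<m. n j) * exp (- (\<delta> \<omega> * measure \<mu> D))) *
        (\<Prod>j<m. measure \<mu> (Dj j) ^ n j / fact (n j)) \<partial>ext M)"
    proof (rule Bochner_Integration.integral_cong[OF refl])
      fix \<omega>
      have "(\<Prod>i<m. poisson_weight (\<delta> \<omega> * measure \<mu> (Dj i)) (n i)) =
         (\<Prod>i<m. \<delta> \<omega> ^ n i * exp (- (\<delta> \<omega> * measure \<mu> (Dj i))) * (measure \<mu> (Dj i) ^ n i / fact (n i)))"
        by (rule prod.cong) (auto simp: poisson_weight_def power_mult_distrib)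
      also have "\<dots> = \<delta> \<omega> ^ (\<Sum>j<m. n j) * exp (\<Sum>i<m. - (\<delta> \<omega> * measure \<mu> (Dj i))) *
          (\<Prod>j<m. measure \<mu> (Dj j) ^ n j / fact (n j))"
        by (simp only: prod.distrib power_sum exp_sum[OF finite_lessThan])
      also have "(\<Sum>i<m. - (\<delta> \<omega> * measure \<mu> (Dj i))) = - (\<delta> \<omega> * measure \<mu> D)"
        by (simp add: sumD sum_distrib_left sum_negf)
      finally show "(\<Prod>i<m. poisson_weight (\<delta> \<omega> * measure \<mu> (Dj i)) (n i)) =
         \<delta> \<omega> ^ (\<Sum>j<m. n j) * exp (- (\<delta> \<omega> * measure \<mu> D)) *
             (\<Prod>j<m. measure \<mu> (Dj j) ^ n j / fact (n j))" .
    qed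
    also have "\<dots> = (\<lambda>k. \<integral>\<omega>. \<delta> \<omega> ^ k * exp (- (\<delta> \<omega> * measure \<mu> D)) \<partial>ext M) (\<Sum>j<m. n j) *
        (\<Prod>j<m. measure \<mu> (Dj j) ^ n j / fact (n j))"
      by (rule integral_mult_left_zero)
    finally show "measure M {\<omega> \<in> space M. \<forall>j<m. emeasure (\<nu> \<omega>) (Dj j) = of_nat (n j)} =
       (\<lambda>k. \<integral>\<omega>. \<delta> \<omega> ^ k * exp (- (\<delta> \<omega> * measure \<mu> D)) \<partial>ext M) (\<Sum>j<m. n j) *
           (\<Prod>j<m. measure \<mu> (Dj j) ^ n j / fact (n j))" .
  qed
  with \<mu> show ?thesis by blast
qed

lemma card_permutations_of_multiset_superset:
  assumes "finite A" "set_mset X \<subseteq> A"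
  shows "real (card (permutations_of_multiset X)) * (\<Prod>a\<in>A. fact (count X a)) = fact (size X)"
proof -
  have "(\<Prod>a\<in>A. fact (count X a)) = (\<Prod>a\<in>set_mset X. fact (count X a) :: real)"
    by (rule prod.mono_neutral_right) (use assms in \<open>auto simp: not_in_iff\<close>)
  also have "real (card (permutations_of_multiset X)) * \<dots> =
    real (card (permutations_of_multiset X) * (\<Prod>x\<in>set_mset X. fact (count X x)))" by simp
  also have "\<dots> = fact (size X)" unfolding card_permutations_of_multiset_aux by simp
  finally show ?thesis .
qed

lemma prod_list_eq_prod_count:
  fixes f :: "'a \<Rightarrow> 'b::comm_monoid_mult"
  assumes "finite A" "set c \<subseteq> A"
  shows "prod_list (map f c) = (\<Prod>a\<in>A. f a ^ count (mset c) a)"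
proof -
  have "prod_list (map f c) = prod_mset (image_mset f (mset c))"
    by (metis mset_map prod_mset_prod_list)
  also have "\<dots> = (\<Prod>a\<in>set_mset (mset c). f a ^ count (mset c) a)" by (rule image_prod_mset_multiplicity)
  also have "\<dots> = (\<Prod>a\<in>A. f a ^ count (mset c) a)"
  proof (rule prod.mono_neutral_left)
    show "\<forall>a\<in>A - set_mset (mset c). f a ^ count (mset c) a = 1"
      by (metis DiffD2 not_in_iff power_0)
  qed (use assms in auto)
  finally show ?thesis .
qed

abbreviation iid_seq :: "'b measure \<Rightarrow> (nat \<Rightarrow> 'b) measure" where
  "iid_seq P \<equiv> \<Pi>\<^sub>M i\<in>UNIV. P"

lemma map_upt_eq_iff: "(map f [0..<length c] = c) = (\<forall>i\<in>{..<length c}. f i = c ! i)"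
proof
  show "\<forall>i\<in>{..<length c}. f i = c ! i" if "map f [0..<length c] = c"
  proof
    fix i assume "i \<in> {..<length c}"
    then have "map f [0..<length c] ! i = f i" by simp
    then show "f i = c ! i" unfolding that by simp
  qed
  show "map f [0..<length c] = c" if "\<forall>i\<in>{..<length c}. f i = c ! i"
    using that by (intro nth_equalityI) auto
qed

lemma (in product_prob_space) measure_PiM_Collect:
  assumes "J \<subseteq> I" "finite J" "\<And>i. i \<in> J \<Longrightarrow> X i \<in> sets (M i)"
  shows "measure (\<Pi>\<^sub>M i\<in>I. M i) {x\<in>space (\<Pi>\<^sub>M i\<in>I. M i). \<forall>i\<in>J. x i \<in> X i} = (\<Prod>i\<in>J. measure (M i) (X i))"
  by (rule measure_eq_emeasure_eq_ennreal)
     (simp_all add: emeasure_PiM_Collect assms M.emeasure_eq_measure prod_ennreal prod_nonneg)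

lemma iid_colour_list:
  assumes "prob_space \<eta>" and col: "col \<in> \<eta> \<rightarrow>\<^sub>M count_space UNIV"
  shows "measure (iid_seq \<eta>) {s \<in> space (iid_seq \<eta>). map (\<lambda>i. col (s i)) [0..<length c] = c}
    = prod_list (map (\<lambda>j. measure \<eta> {x\<in>space \<eta>. col x = j}) c)"
proof -
  interpret \<eta>: prob_space \<eta> by fact
  interpret product_prob_space "\<lambda>i::nat. \<eta>" UNIV by unfold_locales
  have [measurable]: "{x\<in>space \<eta>. col x = j} \<in> sets \<eta>" for j
    using measurable_sets[OF col, of "{j}"] by (simp add: vimage_def Int_def conj_commute)
  have "{s \<in> space (iid_seq \<eta>). map (\<lambda>i. col (s i)) [0..<length c] = c} =
     {s \<in> space (iid_seq \<eta>). \<forall>i\<in>{..<length c}. s i \<in> {x\<in>space \<eta>. col x = c ! i}}"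
    unfolding map_upt_eq_iff by (auto simp: space_PiM PiE_iff)
  also have "measure (iid_seq \<eta>) \<dots> = (\<Prod>i<length c. measure \<eta> {x\<in>space \<eta>. col x = c ! i})"
    by (rule measure_PiM_Collect) auto
  also have "(\<Prod>i<length c. measure \<eta> {x\<in>space \<eta>. col x = c ! i}) =
      prod_list (map (\<lambda>j. measure \<eta> {x\<in>space \<eta>. col x = j}) c)"
    by (simp add: prod.list_conv_set_nth atLeast0LessThan)
  finally show ?thesis .
qed

text \<open>
  All rearrangements of a list of colours are equally likely, so the probability of a multiset of
  colours is that of a single list times the number of rearrangements, a multinomial coefficient.
\<close>

lemma iid_colour_multiset:
  fixes X :: "'c multiset"
  assumes "prob_space \<eta>" and col: "col \<in> \<eta> \<rightarrow>\<^sub>M count_space (UNIV::'c set)"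
      and A: "finite A" "set_mset X \<subseteq> A"
  shows "measure (iid_seq \<eta>) {s \<in> space (iid_seq \<eta>). mset (map (\<lambda>i. col (s i)) [0..<size X]) = X}
    = fact (size X) * (\<Prod>a\<in>A. measure \<eta> {x\<in>space \<eta>. col x = a} ^ count X a / fact (count X a))"
proof -
  interpret \<eta>: prob_space \<eta> by fact
  interpret product_prob_space "\<lambda>i::nat. \<eta>" UNIV by unfold_locales
  let ?P = "iid_seq \<eta>"
  have c: "(\<lambda>s. col (s i)) \<in> ?P \<rightarrow>\<^sub>M count_space UNIV" for i
    by (rule measurable_compose[OF _ col]) simp
  have m: "{s \<in> space ?P. map (\<lambda>i. col (s i)) [0..<length c] = c} \<in> sets ?P" for c
  proof -
    have "{s \<in> space ?P. map (\<lambda>i. col (s i)) [0..<length c] = c} =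
        {s \<in> space ?P. \<forall>i\<in>{..<length c}. col (s i) = c ! i}"
      unfolding map_upt_eq_iff by (rule refl)
    also have "\<dots> \<in> sets ?P"
    proof (rule sets.sets_Collect_finite_All)
      show "{s \<in> space ?P. col (s i) = c ! i} \<in> sets ?P" for i
        using measurable_sets[OF c[of i], of "{c ! i}"] by (simp add: vimage_def Int_def conj_commute)
    qed simp
    finally show ?thesis .
  qed
  have "{s \<in> space ?P. mset (map (\<lambda>i. col (s i)) [0..<size X]) = X} =
      (\<Union>c\<in>permutations_of_multiset X. {s \<in> space ?P. map (\<lambda>i. col (s i)) [0..<length c] = c})"
    by (auto simp: permutations_of_multiset_def simp del: mset_map mset_upt)
  also have "measure ?P \<dots> = (\<Sum>c\<in>permutations_of_multiset X. measure ?P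
      {s \<in> space ?P. map (\<lambda>i. col (s i)) [0..<length c] = c})"
  proof (rule P.finite_measure_finite_Union)
    show "disjoint_family_on (\<lambda>c. {s \<in> space ?P. map (\<lambda>i. col (s i)) [0..<length c] = c})
        (permutations_of_multiset X)"
      by (auto simp: disjoint_family_on_def permutations_of_multiset_def dest: mset_eq_length)
  qed (auto intro: m)
  also have "\<dots> = (\<Sum>c\<in>permutations_of_multiset X. (\<Prod>a\<in>A. measure \<eta> {x\<in>space \<eta>. col x = a} ^ count X a))"
    by (intro sum.cong refl, subst iid_colour_list[OF assms(1) col],
        subst prod_list_eq_prod_count[OF A(1)])
       (use A in \<open>auto simp: permutations_of_multiset_def\<close>)
  also have "\<dots> = real (card (permutations_of_multiset X)) *
      (\<Prod>a\<in>A. measure \<eta> {x\<in>space \<eta>. col x = a} ^ count X a)" by simp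
  also have "\<dots> = fact (size X) * (\<Prod>a\<in>A. measure \<eta> {x\<in>space \<eta>. col x = a} ^ count X a / fact
      (count X a))"
  proof -
    have "(\<Prod>a\<in>A. fact (count X a)) \<noteq> (0::real)" using A by simp
    then show ?thesis
      unfolding prod_dividef card_permutations_of_multiset_superset[OF A, symmetric]
          by (simp add: field_simps)
  qed
  finally show ?thesis .
qed


lemma measurable_sum_of_diracs_initial:
  assumes "prob_space \<eta>" "sets \<eta> = sets borel"
  shows "(\<lambda>(n, s :: nat \<Rightarrow> 'a::polish_space). sum_of_diracs borel {..<n} s) \<in>
     measure_pmf (p :: nat pmf) \<Otimes>\<^sub>M (\<Pi>\<^sub>M i\<in>UNIV. \<eta>) \<rightarrow>\<^sub>M measure_algebra borel"
proof (rule measurable_measure_algebra)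
  fix A :: "'a set" assume [measurable]: "A \<in> sets borel"
  have [measurable_cong]: "sets \<eta> = sets borel" by fact
  have "emeasure (sum_of_diracs borel {..<n} s) A = (\<Sum>i\<in>{..<n}. indicator A (s i))" for n
      and s :: "nat \<Rightarrow> 'a"
    by (subst emeasure_sum_of_diracs) (auto simp: sum.If_cases indicator_def Int_def)
  moreover have "(\<lambda>x. \<Sum>i\<in>{..<fst x}. indicator A (snd x i) :: ennreal) \<in>
     borel_measurable (count_space (UNIV::nat set) \<Otimes>\<^sub>M (iid_seq \<eta>))"
    by (rule measurable_pair_measure_countable1) auto
  then have "(\<lambda>x. \<Sum>i\<in>{..<fst x}. indicator A (snd x i) :: ennreal) \<in>
     borel_measurable (measure_pmf (p :: nat pmf) \<Otimes>\<^sub>M (iid_seq \<eta>))"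
    by (subst measurable_cong_sets[OF sets_pair_measure_cong[OF sets_measure_pmf_count_space refl]
        refl])
  ultimately show "(\<lambda>a. emeasure (case a of (n, s) \<Rightarrow> sum_of_diracs borel {..<n} s) A) \<in>
     borel_measurable (measure_pmf p \<Otimes>\<^sub>M (iid_seq \<eta>))"
    by (simp add: case_prod_beta)
qed auto

text \<open>
  The complement of \<open>D\<close> serves as an additional colour \<open>m\<close>, taken by the remaining \<open>N - k\<close> points.
\<close>

lemma iid_counts_partition:
  fixes \<eta> :: "'a::polish_space measure" and Dj :: "nat \<Rightarrow> 'a set" and n :: "nat \<Rightarrow> nat"
  assumes \<eta>: "prob_space \<eta>" "sets \<eta> = sets borel"
    and D: "\<forall>j<m. Dj j \<in> sets borel" "disjoint_family_on Dj {..<m}" "(\<Union>j<m. Dj j) = D"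
  defines "k \<equiv> \<Sum>j<m. n j"
  shows "measure (iid_seq \<eta>) {s \<in> space (iid_seq \<eta>). \<forall>j<m. card {i\<in>{..<N}. s i \<in> Dj j} = n j}
    = (if k \<le> N then fact N * measure \<eta> (- D) ^ (N - k) / fact (N - k) else 0) *
       (\<Prod>j<m. measure \<eta> (Dj j) ^ n j / fact (n j))"
proof -
  have sp: "space \<eta> = UNIV" using sets_eq_imp_space_eq[OF \<eta>(2)] by simp
  let ?P = "iid_seq \<eta>"
  define col where "col x = (if x \<in> D then (THE j. j < m \<and> x \<in> Dj j) else m)" for x
  have col_eq: "col x = j" if "j < m" "x \<in> Dj j" for x j
  proof -
    have "(THE j. j < m \<and> x \<in> Dj j) = j"
      using that D(2) by (intro the_equality) (auto simp: disjoint_family_on_def)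
    moreover have "x \<in> D" using that D(3) by auto
    ultimately show ?thesis by (simp add: col_def)
  qed
  have col_le: "col x \<le> m" for x
    using col_eq[of _ x] D(3) by (cases "x \<in> D") (auto simp: col_def)
  have col_iff: "col x = j \<longleftrightarrow> x \<in> Dj j" if "j < m" for x j
  proof
    assume "col x = j"
    then have "x \<in> D" using that by (auto simp: col_def split: if_splits)
    then obtain i where "i < m" "x \<in> Dj i" using D(3) by auto
    with col_eq[of i x] \<open>col x = j\<close> show "x \<in> Dj j" by auto
  qed (use col_eq that in auto)
  have col_m: "col x = m \<longleftrightarrow> x \<notin> D" for x
  proof
    assume "col x = m"
    then show "x \<notin> D" using col_eq[of _ x] D(3) by force
  qed (simp add: col_def)
  have pre: "{x\<in>space \<eta>. col x = j} = (if j < m then Dj j else if j = m then - D else {})" for j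
    using col_le col_iff[of j] col_m by (auto simp: sp not_less) (metis leD order.order_iff_strict)+
  have Dm: "D \<in> sets borel" using D by auto
  have colm: "col \<in> \<eta> \<rightarrow>\<^sub>M count_space UNIV"
    by (rule measurable_count_space_eq2_countable[THEN iffD2])
       (use pre D Dm in \<open>auto simp: vimage_def Int_def conj_commute \<eta>(2)\<close>)
  show ?thesis
  proof (cases "k \<le> N")
    case False
    have "\<not> (\<forall>j<m. card {i\<in>{..<N}. s i \<in> Dj j} = n j)" for s
    proof
      assume a: "\<forall>j<m. card {i\<in>{..<N}. s i \<in> Dj j} = n j"
      have "k = (\<Sum>j<m. card {i\<in>{..<N}. s i \<in> Dj j})" using a by (simp add: k_def)
      also have "\<dots> = card (\<Union>j<m. {i\<in>{..<N}. s i \<in> Dj j})"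
        using D(2) by (subst card_UN_disjoint) (auto simp: disjoint_family_on_def)
      also have "\<dots> \<le> card {..<N}" by (rule card_mono) auto
      finally show False using False by simp
    qed
    then have "{s \<in> space ?P. \<forall>j<m. card {i\<in>{..<N}. s i \<in> Dj j} = n j} = {}" by blast
    then show ?thesis using False by (simp only:) simp
  next
    case True
    \<comment> \<open>The multiset of colours that the counts prescribe.\<close>
    define n' where "n' = n(m := N - k)"
    define X where "X = (\<Sum>j\<le>m. replicate_mset (n' j) j)"
    have cX: "count X j = (if j \<le> m then n' j else 0)" for j
      by (auto simp: X_def count_sum)
    have sX: "set_mset X \<subseteq> {..m}"
      by (auto simp: X_def set_mset_def count_sum split: if_splits)
    have nk: "(\<Sum>j\<le>m. n' j) = N"
    proof -
      have "(\<Sum>j\<le>m. n' j) = (\<Sum>j<m. n' j) + n' m"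
        by (simp only: lessThan_Suc_atMost[symmetric] sum.lessThan_Suc)
      also have "(\<Sum>j<m. n' j) = k" by (auto simp: n'_def k_def)
      finally show ?thesis using True by (simp add: n'_def)
    qed
    have szX: "size X = N" by (simp add: X_def size_multiset_sum nk[symmetric])
    have eqv: "(\<forall>j<m. card {i\<in>{..<N}. s i \<in> Dj j} = n j) \<longleftrightarrow> mset (map (\<lambda>i. col (s i)) [0..<size X]) = X"
        for s
    proof -
      have cnt: "count (mset (map (\<lambda>i. col (s i)) [0..<N])) j = card {i\<in>{..<N}. col (s i) = j}" for j
        by (simp add: count_image_mset vimage_def Int_def conj_commute atLeast0LessThan)
      have eq1: "card {i\<in>{..<N}. s i \<in> Dj j} = card {i\<in>{..<N}. col (s i) = j}" if "j < m" for j
        using col_iff[OF that] by simp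
      have tot: "(\<Sum>j\<le>m. card {i\<in>{..<N}. col (s i) = j}) = N"
      proof -
        have "(\<Sum>j\<le>m. card {i\<in>{..<N}. col (s i) = j}) = card (\<Union>j\<le>m. {i\<in>{..<N}. col (s i) = j})"
          by (subst card_UN_disjoint) auto
        also have "(\<Union>j\<le>m. {i\<in>{..<N}. col (s i) = j}) = {..<N}" using col_le by auto
        finally show ?thesis by simp
      qed
      show ?thesis unfolding szX
      proof
        assume a: "\<forall>j<m. card {i\<in>{..<N}. s i \<in> Dj j} = n j"
        have lt: "card {i\<in>{..<N}. col (s i) = j} = n j" if "j < m" for j
          using a eq1[OF that] that by auto
        have "(\<Sum>j\<le>m. card {i\<in>{..<N}. col (s i) = j}) = (\<Sum>j<m. card {i\<in>{..<N}. col (s i) = j}) +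
            card {i\<in>{..<N}. col (s i) = m}"
          by (simp only: lessThan_Suc_atMost[symmetric] sum.lessThan_Suc)
        then have m: "card {i\<in>{..<N}. col (s i) = m} = N - k"
          using tot lt by (simp add: k_def)
        have gt: "card {i\<in>{..<N}. col (s i) = j} = 0" if "j > m" for j
          using col_le that by (auto simp: not_le)  (metis leD)
        show "mset (map (\<lambda>i. col (s i)) [0..<N]) = X"
        proof (rule multiset_eqI)
          fix j show "count (mset (map (\<lambda>i. col (s i)) [0..<N])) j = count X j"
            unfolding cnt cX using lt[of j] m gt[of j]
                by (cases j m rule: linorder_cases) (auto simp: n'_def)
        qed
      next
        assume "mset (map (\<lambda>i. col (s i)) [0..<N]) = X"
        then have "card {i\<in>{..<N}. col (s i) = j} = count X j" for j using cnt by metis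
        then show "\<forall>j<m. card {i\<in>{..<N}. s i \<in> Dj j} = n j"
          using eq1 cX by (auto simp: n'_def)
      qed
    qed
    have "measure ?P {s \<in> space ?P. \<forall>j<m. card {i\<in>{..<N}. s i \<in> Dj j} = n j} =
       fact (size X) * (\<Prod>a\<in>{..m}. measure \<eta> {x\<in>space \<eta>. col x = a} ^ count X a / fact (count X a))"
      unfolding eqv by (rule iid_colour_multiset[OF \<eta>(1) colm _ sX]) simp
    also have "\<dots> = fact N *
        ((\<Prod>a\<in>{..<m}. measure \<eta> {x\<in>space \<eta>. col x = a} ^ count X a / fact (count X a)) *
         (measure \<eta> {x\<in>space \<eta>. col x = m} ^ count X m / fact (count X m)))"
      unfolding szX by (simp only: lessThan_Suc_atMost[symmetric] prod.lessThan_Suc)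
    also have "(\<Prod>a\<in>{..<m}. measure \<eta> {x\<in>space \<eta>. col x = a} ^ count X a / fact (count X a)) =
        (\<Prod>j<m. measure \<eta> (Dj j) ^ n j / fact (n j))"
      by (rule prod.cong) (auto simp: pre cX n'_def)
    also have "measure \<eta> {x\<in>space \<eta>. col x = m} ^ count X m / fact (count X m) =
        measure \<eta> (- D) ^ (N - k) / fact (N - k)"
      by (auto simp: pre cX n'_def)
    finally show ?thesis using True by simp
  qed
qed

text \<open>
  Given that the process has \<open>N\<close> points in all, the counts in \<open>D\<close> have a multinomial weight times a
  factor in \<open>N\<close> and \<open>k\<close> only; averaging this factor over \<open>N\<close> gives \<open>w k\<close>.
\<close>

lemma mixed_binomial_multinomial:
  fixes \<nu> :: "'w \<Rightarrow> 'a::polish_space measure"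
  assumes "prob_space M" "mixed_binomial_process M \<nu>"
  shows "\<exists>\<mu>::'a measure. sets \<mu> = sets borel \<and> (\<forall>D\<in>sets borel. bounded D \<longrightarrow> emeasure \<mu> D < \<infinity>) \<and>
     (\<forall>D\<in>sets borel. bounded D \<longrightarrow> multinomial_counts M \<nu> \<mu> D)"
proof -
  obtain p :: "nat pmf" and \<eta> :: "'a measure" where \<eta>: "prob_space \<eta>" "sets \<eta> = sets borel"
    and law: "distr M (measure_algebra borel) \<nu> =
        distr (measure_pmf p \<Otimes>\<^sub>M (\<Pi>\<^sub>M i\<in>UNIV. \<eta>)) (measure_algebra borel)
          (\<lambda>(n, s :: nat \<Rightarrow> 'a). sum_of_diracs borel {..<n} s)"
    using assms(2) unfolding mixed_binomial_process_def by auto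
  have \<nu>: "\<nu> \<in> M \<rightarrow>\<^sub>M measure_algebra borel"
    using assms(2) unfolding mixed_binomial_process_def point_process_def by blast
  interpret \<eta>: prob_space \<eta> by fact
  let ?P = "iid_seq \<eta>"
  interpret P: prob_space ?P by (rule prob_space_PiM) (rule \<eta>)
  have "multinomial_counts M \<nu> \<eta> D" for D
    unfolding multinomial_counts_def
  proof (intro exI allI impI)
    fix m :: nat and Dj and n :: "nat \<Rightarrow> nat"
    assume A: "(\<forall>j<m. Dj j \<in> sets borel) \<and> disjoint_family_on Dj {..<m} \<and> (\<Union>j<m. Dj j) = D"
    define w where "w N k = (if k \<le> N then fact N * measure \<eta> (- D) ^ (N - k) / fact (N - k) else 0)"
        for N k :: nat
    let ?c = "\<Prod>j<m. measure \<eta> (Dj j) ^ n j / fact (n j)"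
    let ?X = "{m' \<in> space (measure_algebra borel). \<forall>j<m. emeasure m' (Dj j) = of_nat (n j)}"
    let ?Y = "{x \<in> space (measure_pmf p \<Otimes>\<^sub>M ?P). \<forall>j<m. card {i\<in>{..<fst x}. snd x i \<in> Dj j} = n j}"
    have X: "?X \<in> sets (measure_algebra borel)"
      by (rule sets_count_events[of "\<lambda>x. x" _ borel]) (use A in auto)
    have meas: "(\<lambda>(n, s :: nat \<Rightarrow> 'a). sum_of_diracs borel {..<n} s) \<in> measure_pmf p \<Otimes>\<^sub>M ?P \<rightarrow>\<^sub>M
        measure_algebra borel"
      by (rule measurable_sum_of_diracs_initial) fact+
    have Y: "(\<lambda>(n, s :: nat \<Rightarrow> 'a). sum_of_diracs borel {..<n} s) -` ?X \<inter> space (measure_pmf p \<Otimes>\<^sub>M ?P) =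
        ?Y"
    proof -
      have "(emeasure (sum_of_diracs borel {..<N} s) (Dj j) = of_nat (n j)) =
          (card {i\<in>{..<N}. s i \<in> Dj j} = n j)"
        if "j < m" for N j and s :: "nat \<Rightarrow> 'a"
        using that A by (subst emeasure_sum_of_diracs) auto
      then show ?thesis by (auto simp: space_measure_algebra)
    qed
    have Ysets: "?Y \<in> sets (measure_pmf p \<Otimes>\<^sub>M ?P)"
      unfolding Y[symmetric] by (rule measurable_sets[OF meas X])
    have "measure M {\<omega> \<in> space M. \<forall>j<m. emeasure (\<nu> \<omega>) (Dj j) = of_nat (n j)} =
        measure (distr M (measure_algebra borel) \<nu>) ?X"
      by (subst measure_distr[OF \<nu> X]) (auto intro!: arg_cong[where f="measure M"] dest:
          measurable_space[OF \<nu>])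
    also have "\<dots> = measure (measure_pmf p \<Otimes>\<^sub>M ?P) ?Y"
      unfolding law by (subst measure_distr[OF meas X]) (simp only: Y)
    also have "\<dots> = (\<integral>N. measure ?P {s\<in>space ?P. \<forall>j<m. card {i\<in>{..<N}. s i \<in> Dj j} = n j} \<partial>measure_pmf
        p)"
    proof (rule measure_eq_emeasure_eq_ennreal)
      have "emeasure (measure_pmf p \<Otimes>\<^sub>M ?P) ?Y = (\<integral>\<^sup>+N. emeasure ?P (Pair N -` ?Y) \<partial>measure_pmf p)"
        by (rule P.emeasure_pair_measure_alt[OF Ysets])
      also have "\<dots> = (\<integral>\<^sup>+N. ennreal (measure ?P {s\<in>space ?P. \<forall>j<m. card {i\<in>{..<N}. s i \<in> Dj j} = n j})
          \<partial>measure_pmf p)"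
        by (intro nn_integral_cong) (auto simp: P.emeasure_eq_measure space_pair_measure vimage_def)
      also have "\<dots> = ennreal (\<integral>N. measure ?P {s\<in>space ?P. \<forall>j<m. card {i\<in>{..<N}. s i \<in> Dj j} =
          n j} \<partial>measure_pmf p)"
        by (intro nn_integral_eq_integral measure_pmf.integrable_const_bound[where B=1]) auto
      finally show "emeasure (measure_pmf p \<Otimes>\<^sub>M ?P) ?Y =
          ennreal (\<integral>N. measure ?P {s\<in>space ?P. \<forall>j<m. card {i\<in>{..<N}. s i \<in> Dj j} = n j} \<partial>measure_pmf
          p)" .
    qed auto
    also have "\<dots> = (\<integral>N. w N (\<Sum>j<m. n j) * ?c \<partial>measure_pmf p)"
      by (intro Bochner_Integration.integral_cong refl, unfold w_def, rule iid_counts_partition[OF \<eta>])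
          (use A in auto)
    also have "\<dots> = (\<lambda>k. \<integral>N. w N k \<partial>measure_pmf p) (\<Sum>j<m. n j) * ?c"
      by (rule integral_mult_left_zero)
    finally show "measure M {\<omega> \<in> space M. \<forall>j<m. emeasure (\<nu> \<omega>) (Dj j) = of_nat (n j)} =
       (\<lambda>k. \<integral>N. (if k \<le> N then fact N * measure \<eta> (- D) ^ (N - k) / fact (N - k) else 0) \<partial>measure_pmf p)
           (\<Sum>j<m. n j) * ?c"
      unfolding w_def .
  qed
  moreover have "emeasure \<eta> D < \<infinity>" for D by (simp add: \<eta>.emeasure_eq_measure)
  ultimately show ?thesis by (intro exI[of _ \<eta>] conjI ballI impI) (auto simp: \<eta>(2))
qed

section \<open>The vertex law is determined by the counts\<close>

lemma AE_directing_counts: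
  fixes \<xi> :: "'w \<Rightarrow> (('a::polish_space \<times> 'a) \<times> bool) measure"
  assumes "random_adjacency_measure M \<xi>" "\<forall>\<omega>\<in>space M. directs (\<nu> \<omega>) (\<xi> \<omega>)" "D \<in> sets borel"
    and "representation (ext M) ((\<lambda>\<omega>. restrict_adjacency D (\<xi> \<omega>)) \<circ> fst) W N S A"
  shows "AE z in ext M. \<forall>E\<in>sets borel. emeasure (\<nu> (fst z)) (E \<inter> D) =
     emeasure (count_space UNIV) {i. enat i < N z \<and> S i z \<in> E}"
proof -
  have "AE z in ext M. ((\<lambda>\<omega>. restrict_adjacency D (\<xi> \<omega>)) \<circ> fst) z =
        sum_of_diracs edge_space {(i, j). enat i < N z \<and> enat j < N z}
          (\<lambda>(i, j). ((S i z, S j z), A i j z))"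
    using assms(4) unfolding representation_def by blast
  then show ?thesis
  proof (rule AE_mp, intro AE_I2 impI ballI)
    fix z E assume z: "z \<in> space (ext M)" and E: "E \<in> sets (borel :: 'a measure)"
      and eq: "((\<lambda>\<omega>. restrict_adjacency D (\<xi> \<omega>)) \<circ> fst) z =
        sum_of_diracs edge_space {(i, j). enat i < N z \<and> enat j < N z}
          (\<lambda>(i, j). ((S i z, S j z), A i j z))"
    have fz: "fst z \<in> space M" by (rule measurable_space[OF measurable_ext_fst z])
    have s: "sets (\<xi> (fst z)) = sets edge_space"
      using assms(1) measurable_space[OF _ fz, of \<xi> "measure_algebra edge_space"]
      by (auto simp: random_adjacency_measure_def space_measure_algebra)
    have "emeasure (\<nu> (fst z)) (E \<inter> D) = emeasure (count_space UNIV) {i\<in>{i. enat i < N z}. S i z \<in> E}"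
      by (rule directs_count[OF s _ assms(3) _ E]) (use assms(2) fz eq in auto)
    then show "emeasure (\<nu> (fst z)) (E \<inter> D) = emeasure (count_space UNIV) {i. enat i < N z \<and> S i z \<in> E}"
      by simp
  qed
qed

text \<open>
  On the event \<open>\<nu>(B) = 1\<close> there is exactly one vertex, \<open>S\<^sub>0\<close>, and by independence of \<open>N\<close> and \<open>S\<close> its
  conditional law is \<open>\<eta>\<close>. The same conditional law is read off the multinomial counts of the
  partition of \<open>B\<close> into \<open>E \<inter> B\<close> and \<open>B - E\<close>.
\<close>

lemma vertex_law_unique:
  fixes \<xi> :: "'w \<Rightarrow> (('a::polish_space \<times> 'a) \<times> bool) measure" and \<mu> :: "'a measure"
  assumes M: "prob_space M" and \<xi>: "random_adjacency_measure M \<xi>" "\<forall>\<omega>\<in>space M. directs (\<nu> \<omega>) (\<xi> \<omega>)"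
    and \<nu>: "\<nu> \<in> M \<rightarrow>\<^sub>M measure_algebra borel"
    and B: "B \<in> sets borel" and mult: "multinomial_counts M \<nu> \<mu> B"
    and pos: "measure M {\<omega>\<in>space M. emeasure (\<nu> \<omega>) B = 1} > 0"
    and law: "vertex_law M \<xi> B \<eta>"
  shows "measure \<mu> B > 0" "prob_space \<eta>" "sets \<eta> = sets borel"
    "\<And>E. E \<in> sets borel \<Longrightarrow> measure \<eta> E = measure \<mu> (E \<inter> B) / measure \<mu> B"
proof -
  obtain W N S A
      where iid: "iid_representation (ext M) ((\<lambda>\<omega>. restrict_adjacency B (\<xi> \<omega>)) \<circ> fst) W N S A \<eta>"
    using law by (auto simp: vertex_law_def)
  then have rep: "representation (ext M) ((\<lambda>\<omega>. restrict_adjacency B (\<xi> \<omega>)) \<circ> fst) W N S A"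
    by (simp add: iid_representation_def)
  then have N: "N \<in> ext M \<rightarrow>\<^sub>M count_space UNIV" and S: "\<And>k. S k \<in> ext M \<rightarrow>\<^sub>M borel"
    by (auto simp: representation_def)
  interpret E: prob_space "ext M" by (rule prob_space.prob_space_ext[OF M])
  have \<eta>: "\<eta> = distr (ext M) borel (S 0)" using iid by (auto simp: iid_representation_def)
  show ps: "prob_space \<eta>" unfolding \<eta> by (rule E.prob_space_distr[OF S])
  show "sets \<eta> = sets borel" by (simp add: \<eta>)
  obtain w :: "nat \<Rightarrow> real" where w: "\<And>(m::nat) Dj n.
     (\<forall>j<m. Dj j \<in> sets borel) \<and> disjoint_family_on Dj {..<m} \<and> (\<Union>j<m. Dj j) = B \<Longrightarrow>
     measure M {\<omega> \<in> space M. \<forall>j<m. emeasure (\<nu> \<omega>) (Dj j) = of_nat (n j)} =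
       w (\<Sum>j<m. n j) * (\<Prod>j<m. measure \<mu> (Dj j) ^ n j / fact (n j))"
    using mult unfolding multinomial_counts_def by blast
  note AE = AE_directing_counts[OF \<xi> B rep]
  have all2: "(\<forall>j<2::nat. P j) \<longleftrightarrow> P 0 \<and> P 1" for P
    by (metis One_nat_def less_2_cases_iff)
  have main: "measure (ext M) {z\<in>space (ext M). N z = 1} * measure \<eta> E = w 1 * measure \<mu> (E \<inter> B)"
    if E: "E \<in> sets borel" for E
  proof -
    define Dj where "Dj = (\<lambda>j::nat. if j = 0 then E \<inter> B else B - E)"
    define n where "n = (\<lambda>j::nat. if j = 0 then 1 else 0 :: nat)"
    have X1: "{z \<in> space (ext M). \<forall>j<2. emeasure (\<nu> (fst z)) (Dj j) = of_nat (n j)} \<in> sets (ext M)"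
      by (rule sets_count_events[of "\<lambda>\<omega>. \<nu> (fst \<omega>)", OF measurable_compose[OF measurable_ext_fst \<nu>]])
         (use B E in \<open>auto simp: Dj_def\<close>)
    have X2: "{z\<in>space (ext M). S 0 z \<in> E} \<in> sets (ext M)"
      using measurable_sets[OF S[of 0] E] by (simp add: vimage_def Int_def conj_commute)
    have X3: "{z\<in>space (ext M). N z = 1} \<in> sets (ext M)"
      using measurable_sets[OF N, of "{1}"] by (simp add: vimage_def Int_def conj_commute)
    have "w 1 * measure \<mu> (E \<inter> B) = w (\<Sum>j<2. n j) * (\<Prod>j<2. measure \<mu> (Dj j) ^ n j / fact (n j))"
      by (simp add: n_def Dj_def numeral_2_eq_2)
    also have "\<dots> = measure M {\<omega> \<in> space M. \<forall>j<2. emeasure (\<nu> \<omega>) (Dj j) = of_nat (n j)}"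
      by (rule w[symmetric]) (use B E in \<open>auto simp: Dj_def disjoint_family_on_def all2
          lessThan_nat_numeral lessThan_Suc\<close>)
    also have "\<dots> = measure (ext M) {z \<in> space (ext M). \<forall>j<2. emeasure (\<nu> (fst z)) (Dj j) =
        of_nat (n j)}"
      by (rule prob_space.measure_ext_fst[symmetric, OF M sets_count_events[OF \<nu>]])
          (use B E in \<open>auto simp: Dj_def\<close>)
    also have "\<dots> = measure (ext M) ({z\<in>space (ext M). N z = 1} \<inter> {z\<in>space (ext M). S 0 z \<in> E})"
    proof (rule E.finite_measure_eq_AE)
      show "AE z in ext M. (z \<in> {z \<in> space (ext M). \<forall>j<2. emeasure (\<nu> (fst z)) (Dj j) = of_nat (n j)}) =
         (z \<in> {z\<in>space (ext M). N z = 1} \<inter> {z\<in>space (ext M). S 0 z \<in> E})"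
        using AE
      proof (rule AE_mp, intro AE_I2 impI)
        fix z assume z: "z \<in> space (ext M)" and c: "\<forall>E\<in>sets borel. emeasure (\<nu> (fst z)) (E \<inter> B) =
          emeasure (count_space UNIV) {i. enat i < N z \<and> S i z \<in> E}"
        have c1: "emeasure (\<nu> (fst z)) (E \<inter> B) =
            emeasure (count_space UNIV) {i. enat i < N z \<and> S i z \<in> E}"
          using c E by blast
        have c2: "emeasure (\<nu> (fst z)) (B - E) =
            emeasure (count_space UNIV) {i. enat i < N z \<and> S i z \<notin> E}"
          using c[rule_format, of "- E"] E by (simp add: Diff_eq Int_commute)
        have "(emeasure (\<nu> (fst z)) (E \<inter> B) = 1 \<and> emeasure (\<nu> (fst z)) (B - E) = 0) \<longleftrightarrow>
            (N z = 1 \<and> S 0 z \<in> E)"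
        proof
          assume a: "N z = 1 \<and> S 0 z \<in> E"
          then have s: "{i. enat i < N z \<and> S i z \<in> E} = {0}" "{i. enat i < N z \<and> S i z \<notin> E} = {}"
            by (auto simp: one_enat_def) (metis gr0I)
          show "emeasure (\<nu> (fst z)) (E \<inter> B) = 1 \<and> emeasure (\<nu> (fst z)) (B - E) = 0"
            unfolding c1 c2 s by simp
        next
          assume "emeasure (\<nu> (fst z)) (E \<inter> B) = 1 \<and> emeasure (\<nu> (fst z)) (B - E) = 0"
          then have 1: "emeasure (count_space UNIV) {i. enat i < N z \<and> S i z \<in> E} = 1"
            and 2: "{i. enat i < N z \<and> S i z \<notin> E} = {}"
            unfolding c1 c2 by (auto simp: emeasure_count_space_eq_0)
          have "finite {i. enat i < N z \<and> S i z \<in> E}"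
            using 1 by (auto simp: emeasure_count_space split: if_splits)
          with 1 have "card {i. enat i < N z \<and> S i z \<in> E} = 1"
            by (auto simp: emeasure_count_space_finite simp del: One_nat_def)
          then obtain i0 where i0: "{i. enat i < N z \<and> S i z \<in> E} = {i0}" by (rule card_1_singletonE)
          with 2 have only: "enat i < N z \<longleftrightarrow> i = i0" for i by blast
          have "enat i0 < N z" using only by simp
          then have "enat 0 < N z" by (rule le_less_trans[rotated]) simp
          then have "i0 = 0" using only[of 0] by simp
          have "\<not> enat 1 < N z" using only[of 1] \<open>i0 = 0\<close> by simp
          then have "N z = 1" using \<open>enat 0 < N z\<close>
            by (cases "N z") (auto simp: one_enat_def)
          moreover have "S 0 z \<in> E" using i0 \<open>i0 = 0\<close> by auto
          ultimately show "N z = 1 \<and> S 0 z \<in> E" by simp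
        qed
        then show "(z \<in> {z \<in> space (ext M). \<forall>j<2. emeasure (\<nu> (fst z)) (Dj j) = of_nat (n j)}) =
         (z \<in> {z\<in>space (ext M). N z = 1} \<inter> {z\<in>space (ext M). S 0 z \<in> E})"
          using z by (simp add: all2 Dj_def n_def)
      qed
    qed (rule X1, rule sets.Int[OF X3 X2])
    also have "\<dots> = measure (ext M) {z\<in>space (ext M). N z = 1} *
        measure (ext M) {z\<in>space (ext M). S 0 z \<in> E}"
    proof (rule E.indep_setD)
      show "E.indep_set (sets (vimage_algebra (space (ext M)) N (count_space UNIV)))
       (sets (vimage_algebra (space (ext M)) (\<lambda>\<omega> k. S k \<omega>) (\<Pi>\<^sub>M k\<in>UNIV. borel)))"
        using iid by (simp add: iid_representation_def)
      have "N -` {1} \<inter> space (ext M) \<in> sets (vimage_algebra (space (ext M)) N (count_space UNIV))"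
        by (rule in_vimage_algebra) simp
      then show "{z\<in>space (ext M). N z =
          1} \<in> sets (vimage_algebra (space (ext M)) N (count_space UNIV))"
        by (simp add: vimage_def Int_def conj_commute)
      have "(\<lambda>\<omega> k. S k \<omega>) -` {s\<in>space (\<Pi>\<^sub>M k\<in>UNIV. borel). s 0 \<in> E} \<inter> space (ext M) \<in> sets
          (vimage_algebra (space (ext M)) (\<lambda>\<omega> k. S k \<omega>) (iid_seq borel))"
      proof (rule in_vimage_algebra)
        have [measurable]: "E \<in> sets borel" by (rule E)
        show "{s\<in>space (\<Pi>\<^sub>M k\<in>UNIV. borel). s 0 \<in> E} \<in> sets (iid_seq borel)" by measurable
      qed
      then show "{z\<in>space (ext M). S 0 z \<in> E} \<in> sets
          (vimage_algebra (space (ext M)) (\<lambda>\<omega> k. S k \<omega>) (iid_seq borel))"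
        by (simp add: vimage_def Int_def conj_commute space_PiM)
    qed
    also have "measure (ext M) {z\<in>space (ext M). S 0 z \<in> E} = measure \<eta> E"
      unfolding \<eta> using measure_distr[OF S E, of 0] by (simp add: vimage_def Int_def conj_commute)
    finally show ?thesis by simp
  qed
  have "measure M {\<omega>\<in>space M. emeasure (\<nu> \<omega>) B = 1} = w 1 * measure \<mu> B"
    using w[of 1 "\<lambda>_. B" "\<lambda>_. 1"] B by (simp add: disjoint_family_on_def lessThan_Suc)
  with pos have wpos: "w 1 * measure \<mu> B > 0" by simp
  then show mpos: "measure \<mu> B > 0"
    by (metis measure_nonneg mult_zero_right order_less_le)
  interpret \<eta>: prob_space \<eta> by fact
  have "measure \<eta> UNIV = 1" using \<eta>.prob_space by (simp add: \<eta>)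
  with main[of UNIV] have N1: "measure (ext M) {z\<in>space (ext M). N z = 1} = w 1 * measure \<mu> B" by simp
  show "measure \<eta> E = measure \<mu> (E \<inter> B) / measure \<mu> B" if "E \<in> sets borel" for E
    using main[OF that] wpos mpos unfolding N1 by (auto simp: field_simps)
qed

section \<open>Splitting the auxiliary randomness\<close>

abbreviation unif :: "real measure" where "unif \<equiv> uniform_measure lborel {0..1}"
abbreviation unifs :: "(nat \<Rightarrow> real) measure" where "unifs \<equiv> iid_seq unif"

definition measure_preserving where
  "measure_preserving M N f \<longleftrightarrow> f \<in> M \<rightarrow>\<^sub>M N \<and> distr M N f = N"

lemma measure_preserving_comp:
  assumes "measure_preserving M N f" "measure_preserving N K g"
  shows "measure_preserving M K (\<lambda>x. g (f x))"
  using assms distr_distr[of g N K f M] unfolding measure_preserving_def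
      by (auto simp: o_def intro: measurable_compose)

lemma measure_preserving_pair:
  assumes "measure_preserving M M' f" "measure_preserving N N' g" "prob_space N'"
  shows "measure_preserving (M \<Otimes>\<^sub>M N) (M' \<Otimes>\<^sub>M N') (\<lambda>(x, y). (f x, g y))"
proof -
  have f[measurable]: "f \<in> M \<rightarrow>\<^sub>M M'" and g[measurable]: "g \<in> N \<rightarrow>\<^sub>M N'"
    using assms by (auto simp: measure_preserving_def)
  have "sigma_finite_measure (distr N N' g)"
    using assms by (simp add: measure_preserving_def prob_space_imp_sigma_finite)
  from pair_measure_distr[OF f g this] show ?thesis
    using assms by (simp add: measure_preserving_def)
qed

lemma measure_preserving_id: "measure_preserving M M (\<lambda>x. x)"
  by (simp add: measure_preserving_def)

lemma measure_preserving_fst: "prob_space N \<Longrightarrow> measure_preserving (M \<Otimes>\<^sub>M N) M fst"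
  by (simp add: measure_preserving_def prob_space.distr_pair_fst)

lemma measure_preserving_assoc:
  assumes M: "prob_space M" and N: "prob_space N" and K: "prob_space K"
  shows "measure_preserving (M \<Otimes>\<^sub>M (N \<Otimes>\<^sub>M K)) ((M \<Otimes>\<^sub>M N) \<Otimes>\<^sub>M K) (\<lambda>(x, y, z). ((x, y), z))"
  unfolding measure_preserving_def
proof
  interpret M: prob_space M by fact
  interpret N: prob_space N by fact
  interpret K: prob_space K by fact
  interpret NK: prob_space "N \<Otimes>\<^sub>M K" by (rule prob_space_pair) fact+
  show m[measurable]: "(\<lambda>(x, y, z). ((x, y), z)) \<in> M \<Otimes>\<^sub>M (N \<Otimes>\<^sub>M K) \<rightarrow>\<^sub>M (M \<Otimes>\<^sub>M N) \<Otimes>\<^sub>M K"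
    by measurable
  show "distr (M \<Otimes>\<^sub>M (N \<Otimes>\<^sub>M K)) ((M \<Otimes>\<^sub>M N) \<Otimes>\<^sub>M K) (\<lambda>(x, y, z). ((x, y), z)) = (M \<Otimes>\<^sub>M N) \<Otimes>\<^sub>M K"
  proof (rule measure_eqI)
    fix X assume "X \<in> sets (distr (M \<Otimes>\<^sub>M (N \<Otimes>\<^sub>M K)) ((M \<Otimes>\<^sub>M N) \<Otimes>\<^sub>M K) (\<lambda>(x, y, z). ((x, y), z)))"
    then have X[measurable]: "X \<in> sets ((M \<Otimes>\<^sub>M N) \<Otimes>\<^sub>M K)" by simp
    have "emeasure (distr (M \<Otimes>\<^sub>M (N \<Otimes>\<^sub>M K)) ((M \<Otimes>\<^sub>M N) \<Otimes>\<^sub>M K) (\<lambda>(x, y, z). ((x, y), z))) X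
      = (\<integral>\<^sup>+w. indicator X (case w of (x, y, z) \<Rightarrow> ((x, y), z)) \<partial>(M \<Otimes>\<^sub>M (N \<Otimes>\<^sub>M K)))"
      by (subst nn_integral_indicator[symmetric], simp, subst nn_integral_distr[OF m]) auto
    also have "\<dots> = (\<integral>\<^sup>+x. \<integral>\<^sup>+y. \<integral>\<^sup>+z. indicator X ((x, y), z) \<partial>K \<partial>N \<partial>M)"
    proof (subst NK.nn_integral_fst[symmetric], measurable, intro nn_integral_cong)
      fix x assume [measurable]: "x \<in> space M"
      show "(\<integral>\<^sup>+w. indicator X (case (x, w) of (x, y, z) \<Rightarrow> ((x, y), z)) \<partial>(N \<Otimes>\<^sub>M K)) =
        (\<integral>\<^sup>+y. \<integral>\<^sup>+z. indicator X ((x, y), z) \<partial>K \<partial>N)"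
        by (subst K.nn_integral_fst[symmetric]) (simp_all, measurable)
    qed
    also have "\<dots> = (\<integral>\<^sup>+w. indicator X w \<partial>((M \<Otimes>\<^sub>M N) \<Otimes>\<^sub>M K))"
    proof -
      have m: "(\<lambda>w. \<integral>\<^sup>+z. indicator X (w, z) \<partial>K) \<in> borel_measurable (M \<Otimes>\<^sub>M N)" by measurable
      show ?thesis
        unfolding K.nn_integral_fst[OF borel_measurable_indicator[OF X], symmetric]
        by (rule N.nn_integral_fst[OF m])
    qed
    finally show "emeasure (distr (M \<Otimes>\<^sub>M (N \<Otimes>\<^sub>M K)) ((M \<Otimes>\<^sub>M N) \<Otimes>\<^sub>M K) (\<lambda>(x, y, z). ((x, y), z))) X =
        emeasure ((M \<Otimes>\<^sub>M N) \<Otimes>\<^sub>M K) X"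
      by simp
  qed simp
qed

lemma seq_box_emeasure:
  assumes "prob_space P" "finite J" "\<And>j. j \<in> J \<Longrightarrow> F j \<in> sets P"
  shows "emeasure (\<Pi>\<^sub>M i\<in>(UNIV::'i set). P) {u\<in>space (\<Pi>\<^sub>M i\<in>(UNIV::'i set). P). \<forall>j\<in>J. u j \<in> F j} =
      (\<Prod>j\<in>J. emeasure P (F j))"
proof -
  interpret prob_space P by fact
  interpret product_prob_space "\<lambda>i::'i. P" UNIV by unfold_locales
  show ?thesis using assms by (intro emeasure_PiM_Collect) auto
qed

lemma seq_eqI:
  fixes P :: "'b measure"
  assumes P: "prob_space P" and sets: "sets M' = sets (\<Pi>\<^sub>M i\<in>(UNIV::'i set). P)"
    and eq: "\<And>J F. finite J \<Longrightarrow> (\<And>j. F j \<in> sets P) \<Longrightarrow>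
      emeasure M' {u\<in>space M'. \<forall>j\<in>J. u j \<in> F j} = (\<Prod>j\<in>J. emeasure P (F j))"
  shows "M' = (\<Pi>\<^sub>M i\<in>(UNIV::'i set). P)"
proof -
  interpret prob_space P by fact
  interpret product_prob_space "\<lambda>i::'i. P" UNIV by unfold_locales
  show ?thesis
  proof (rule PiM_eq[OF sets])
    fix J and F :: "'i \<Rightarrow> 'b set" assume J: "finite J" and F: "\<And>j. j \<in> J \<Longrightarrow> F j \<in> sets P"
    define G where "G j = (if j \<in> J then F j else space P)" for j
    have "prod_emb UNIV (\<lambda>i. P) J (Pi\<^sub>E J F) = {u\<in>space M'. \<forall>j\<in>J. u j \<in> G j}"
      using sets_eq_imp_space_eq[OF sets] by (auto simp: prod_emb_def space_PiM G_def)
    moreover have "(\<Prod>j\<in>J. emeasure P (G j)) = (\<Prod>j\<in>J. emeasure P (F j))"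
      by (rule prod.cong) (auto simp: G_def)
    ultimately show "emeasure M' (prod_emb UNIV (\<lambda>i. P) J (Pi\<^sub>E J F)) = (\<Prod>j\<in>J. emeasure P (F j))"
      using eq[OF J, of G] F by (simp add: G_def)
  qed
qed

lemma measurable_reindex: "(\<lambda>x i. x (f i)) \<in> Pi\<^sub>M UNIV (\<lambda>i. P) \<rightarrow>\<^sub>M Pi\<^sub>M UNIV (\<lambda>i. P)"
  by (rule measurable_PiM_single') (auto simp: space_PiM PiE_def)

text \<open>
  The even and the odd coordinates of an i.i.d. sequence are independent i.i.d. sequences. It is
  easier to see that interleaving two sequences preserves the measure, because a product measure is
  determined by its values on boxes; splitting is the inverse of interleaving.
\<close>

lemma measure_preserving_split:
  fixes P :: "'b measure"
  assumes P: "prob_space P"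
  defines "Q \<equiv> iid_seq P"
  shows "measure_preserving Q (Q \<Otimes>\<^sub>M Q) (\<lambda>u. (\<lambda>i. u (2 * i), \<lambda>i. u (2 * i + 1)))"
proof -
  let ?split = "\<lambda>u. (\<lambda>i. u (2 * i), \<lambda>i. u (2 * i + 1)) :: (nat \<Rightarrow> 'b) \<times> (nat \<Rightarrow> 'b)"
  let ?join = "\<lambda>(a, b). \<lambda>i::nat. (if even i then a (i div 2) else b (i div 2)) :: 'b"
  interpret Q: prob_space Q unfolding Q_def by (rule prob_space_PiM) (rule P)
  have split[measurable]: "?split \<in> Q \<rightarrow>\<^sub>M Q \<Otimes>\<^sub>M Q"
    unfolding Q_def by (intro measurable_Pair measurable_reindex)
  have j: "(\<lambda>x. if even i then fst x (i div 2) else snd x (i div 2)) \<in> Q \<Otimes>\<^sub>M Q \<rightarrow>\<^sub>M P" for i :: nat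
    unfolding Q_def by (cases "even i") auto
  have join[measurable]: "?join \<in> Q \<Otimes>\<^sub>M Q \<rightarrow>\<^sub>M Q"
    unfolding case_prod_beta using j
    by (subst (2) Q_def, intro measurable_PiM_single')
        (auto simp: space_PiM Q_def space_pair_measure PiE_def Pi_def)
  have "distr (Q \<Otimes>\<^sub>M Q) Q ?join = Q"
    unfolding Q_def
  proof (rule seq_eqI[OF P], goal_cases)
    case (2 J F)
    note [measurable] = 2(2)
    let ?D = "distr (Q \<Otimes>\<^sub>M Q) Q ?join"
    let ?J0 = "{i. 2 * i \<in> J}" and ?J1 = "{i. 2 * i + 1 \<in> J}"
    have fin: "finite ?J0" "finite ?J1"
      using finite_vimageI[OF 2(1), of "\<lambda>i. 2 * i"] finite_vimageI[OF 2(1), of "\<lambda>i. 2 * i + 1"]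
      by (auto simp: inj_on_def vimage_def)
    have J: "J = (\<lambda>i. 2 * i) ` ?J0 \<union> (\<lambda>i. 2 * i + 1) ` ?J1"
    proof (intro set_eqI)
      fix j show "j \<in> J \<longleftrightarrow> j \<in> (\<lambda>i. 2 * i) ` ?J0 \<union> (\<lambda>i. 2 * i + 1) ` ?J1"
        by (cases "even j") (auto elim!: evenE oddE)
    qed
    let ?A = "{u\<in>space Q. \<forall>j\<in>?J0. u j \<in> F (2 * j)}" and ?B = "{u\<in>space Q. \<forall>j\<in>?J1. u j \<in> F (2 * j + 1)}"
    have A: "?A \<in> sets Q" using fin unfolding Q_def by measurable
    have B: "?B \<in> sets Q" using fin unfolding Q_def by measurable
    have S: "{u\<in>space Q. \<forall>j\<in>J. u j \<in> F j} \<in> sets Q" using 2(1) unfolding Q_def by measurable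
    have eq: "(\<forall>j\<in>J. ?join (a, b) j \<in> F j) \<longleftrightarrow> (\<forall>j\<in>?J0. a j \<in> F (2 * j)) \<and> (\<forall>j\<in>?J1. b j \<in> F (2 * j + 1))"
        for a b
      by (subst J) (auto simp: ball_Un)
    have "emeasure ?D {u\<in>space ?D. \<forall>j\<in>J. u j \<in> F j} =
        emeasure (Q \<Otimes>\<^sub>M Q) (?join -` {u\<in>space Q. \<forall>j\<in>J. u j \<in> F j} \<inter> space (Q \<Otimes>\<^sub>M Q))"
      using S by (simp add: emeasure_distr[OF join])
    also have "?join -` {u\<in>space Q. \<forall>j\<in>J. u j \<in> F j} \<inter> space (Q \<Otimes>\<^sub>M Q) = ?A \<times> ?B"
    proof (intro set_eqI)
      fix x :: "(nat \<Rightarrow> 'b) \<times> (nat \<Rightarrow> 'b)"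
      obtain a b where x: "x = (a, b)" by (cases x)
      have sp: "?join (a, b) \<in> space Q" if "a \<in> space Q" "b \<in> space Q"
        using measurable_space[OF join, of "(a, b)"] that by (simp add: space_pair_measure)
      show "x \<in> ?join -` {u\<in>space Q. \<forall>j\<in>J. u j \<in> F j} \<inter> space (Q \<Otimes>\<^sub>M Q) \<longleftrightarrow> x \<in> ?A \<times> ?B"
        using eq[of a b] sp unfolding x by (auto simp: space_pair_measure simp del: split_paired_All)
    qed
    also have "emeasure (Q \<Otimes>\<^sub>M Q) (?A \<times> ?B) = emeasure Q ?A * emeasure Q ?B"
      by (rule Q.emeasure_pair_measure_Times[OF A B])
    also have "\<dots> = (\<Prod>j\<in>?J0. emeasure P (F (2 * j))) * (\<Prod>j\<in>?J1. emeasure P (F (2 * j + 1)))"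
      unfolding Q_def by (subst (1 2) seq_box_emeasure[OF P]) (use fin 2 in auto)
    also have "\<dots> = (\<Prod>j\<in>J. emeasure P (F j))"
      by (subst J, subst prod.union_disjoint)
          (use fin in \<open>auto simp: prod.reindex inj_on_def, presburger\<close>)
    finally show ?case unfolding Q_def .
  qed simp
  then have "distr Q (Q \<Otimes>\<^sub>M Q) ?split = distr (distr (Q \<Otimes>\<^sub>M Q) Q ?join) (Q \<Otimes>\<^sub>M Q) ?split" by simp
  also have "\<dots> = distr (Q \<Otimes>\<^sub>M Q) (Q \<Otimes>\<^sub>M Q) (?split \<circ> ?join)" by (rule distr_distr) measurable
  also have "?split \<circ> ?join = (\<lambda>x. x)" by (auto simp: fun_eq_iff)
  also have "distr (Q \<Otimes>\<^sub>M Q) (Q \<Otimes>\<^sub>M Q) (\<lambda>x. x) = Q \<Otimes>\<^sub>M Q" by (rule distr_id)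
  finally show ?thesis unfolding measure_preserving_def using split by blast
qed

lemma measure_preserving_component:
  assumes "prob_space P" shows "measure_preserving (\<Pi>\<^sub>M i\<in>UNIV. P) P (\<lambda>u. u i)"
  unfolding measure_preserving_def using distr_PiM_component[of UNIV "\<lambda>_. P" i] assms by simp

lemma measure_preserving_map:
  fixes R :: "'c measure"
  assumes P: "prob_space P" and g[measurable]: "g \<in> P \<rightarrow>\<^sub>M K" and d: "distr P K g = R"
  shows "measure_preserving (\<Pi>\<^sub>M i\<in>(UNIV::'i set). P) (\<Pi>\<^sub>M i\<in>(UNIV::'i set). R) (\<lambda>u i. g (u i))"
proof -
  interpret P: prob_space P by fact
  have R: "prob_space R" unfolding d[symmetric] by (rule P.prob_space_distr[OF g])
  have sR: "sets R = sets K" "space R = space K" unfolding d[symmetric] by auto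
  let ?P = "\<Pi>\<^sub>M i\<in>(UNIV::'i set). P" and ?R = "\<Pi>\<^sub>M i\<in>(UNIV::'i set). R"
  have m: "(\<lambda>u i. g (u i)) \<in> ?P \<rightarrow>\<^sub>M ?R"
    using measurable_space[OF g] by (intro measurable_PiM_single')
        (auto simp: sR space_PiM PiE_def Pi_def measurable_cong_sets[OF refl sR(1)])
  have "distr ?P ?R (\<lambda>u i. g (u i)) = ?R"
  proof (rule seq_eqI[OF R])
    fix J :: "'i set" and F :: "'i \<Rightarrow> 'c set" assume J: "finite J" and F: "\<And>j. F j \<in> sets R"
    have S: "{u\<in>space ?R. \<forall>j\<in>J. u j \<in> F j} \<in> sets ?R" using J F by measurable
    have "emeasure (distr ?P ?R (\<lambda>u i. g (u i))) {u\<in>space ?R. \<forall>j\<in>J. u j \<in> F j} =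
      emeasure ?P ((\<lambda>u i. g (u i)) -` {u\<in>space ?R. \<forall>j\<in>J. u j \<in> F j} \<inter> space ?P)"
      by (rule emeasure_distr[OF m S])
    also have "(\<lambda>u i. g (u i)) -` {u\<in>space ?R. \<forall>j\<in>J. u j \<in> F j} \<inter> space ?P =
       {u\<in>space ?P. \<forall>j\<in>J. u j \<in> g -` F j \<inter> space P}"
      using measurable_space[OF m] by (auto simp: space_PiM PiE_def Pi_def)
    also have "emeasure ?P \<dots> = (\<Prod>j\<in>J. emeasure P (g -` F j \<inter> space P))"
      by (rule seq_box_emeasure[OF P J]) (use F in \<open>auto simp: sR\<close>)
    also have "\<dots> = (\<Prod>j\<in>J. emeasure R (F j))"
      using F unfolding d[symmetric] by (intro prod.cong) (auto simp: emeasure_distr)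
    finally show "emeasure (distr ?P ?R (\<lambda>u i. g (u i)))
        {u\<in>space (distr ?P ?R (\<lambda>u i. g (u i))). \<forall>j\<in>J. u j \<in> F j} = (\<Prod>j\<in>J. emeasure R (F j))"
      by simp
  qed simp
  with m show ?thesis by (simp add: measure_preserving_def)
qed

text \<open>
  A representation of a graph process already lives on \<^term>\<open>ext M\<close> and may depend on all of it. This
  map reproduces it in the first factor and leaves room for a uniform variable, an independent
  sequence with law \<open>\<eta>\<close> and a sequence of independent coins. It fixes the component in \<open>M\<close>, so
  random objects on \<open>M\<close> are not affected.
\<close>

lemma ext_splitting:
  fixes \<eta> :: "'a::polish_space measure"
  assumes M: "prob_space M" and g: "g \<in> borel_measurable unif" and \<eta>: "distr unif borel g = \<eta>"
  shows "\<exists>\<Phi>. measure_preserving (ext M) ((ext M \<Otimes>\<^sub>M (unif \<Otimes>\<^sub>M (iid_seq \<eta>))) \<Otimes>\<^sub>M unifs) \<Phi>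
     \<and> (\<forall>z. fst (fst (fst (\<Phi> z))) = fst z)"
proof -
  have u: "prob_space unif" by (rule prob_space_uniform)
  interpret u: prob_space unif by fact
  have us: "prob_space unifs" by (rule prob_space_PiM) (rule u)
  have e: "prob_space \<eta>" unfolding \<eta>[symmetric] by (rule u.prob_space_distr[OF g])
  have es: "prob_space (iid_seq \<eta>)" by (rule prob_space_PiM) (rule e)
  note pp = prob_space_pair
  let ?E = "iid_seq \<eta>"
  note split = measure_preserving_split[OF u]
  note id = measure_preserving_id
  have split3: "measure_preserving unifs (unifs \<Otimes>\<^sub>M (unifs \<Otimes>\<^sub>M (unifs \<Otimes>\<^sub>M unifs)))
     (\<lambda>x. case case (\<lambda>i. x (2 * i), \<lambda>i. x (2 * i + 1)) of (a, b) \<Rightarrow> (a, \<lambda>i. b (2 * i), \<lambda>i. b (2 * i + 1))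
         of
      (a, b, c) \<Rightarrow> (a, b, \<lambda>i. c (2 * i), \<lambda>i. c (2 * i + 1)))" (is "measure_preserving _ _ ?s")
    using measure_preserving_comp[OF measure_preserving_comp[OF split
        measure_preserving_pair[OF id split pp[OF us us]]]
      measure_preserving_pair[OF id measure_preserving_pair[OF id split pp[OF us us]]
          pp[OF us pp[OF us us]]]]
    by simp
  have comps: "measure_preserving (unifs \<Otimes>\<^sub>M (unifs \<Otimes>\<^sub>M (unifs \<Otimes>\<^sub>M unifs)))
      (unifs \<Otimes>\<^sub>M (unif \<Otimes>\<^sub>M (?E \<Otimes>\<^sub>M unifs)))
      (\<lambda>(a, w). (a, case w of (b, w') \<Rightarrow> (b 0,
          case w' of (c, d) \<Rightarrow> (\<lambda>i. g (c i), d))))" (is "measure_preserving _ _ ?c")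
    by (intro measure_preserving_pair id measure_preserving_component measure_preserving_map[OF u g \<eta>] u
        us es pp)
  have assoc1: "measure_preserving (unif \<Otimes>\<^sub>M (?E \<Otimes>\<^sub>M unifs)) ((unif \<Otimes>\<^sub>M ?E) \<Otimes>\<^sub>M unifs)
      (\<lambda>(x, y, z). ((x, y), z))"
    by (rule measure_preserving_assoc[OF u es us])
  have assoc2: "measure_preserving (M \<Otimes>\<^sub>M (unifs \<Otimes>\<^sub>M ((unif \<Otimes>\<^sub>M ?E) \<Otimes>\<^sub>M unifs)))
      ((M \<Otimes>\<^sub>M unifs) \<Otimes>\<^sub>M ((unif \<Otimes>\<^sub>M ?E) \<Otimes>\<^sub>M unifs)) (\<lambda>(x, y, z). ((x, y), z))"
    by (rule measure_preserving_assoc) (intro M u us es pp)+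
  have assoc3: "measure_preserving ((M \<Otimes>\<^sub>M unifs) \<Otimes>\<^sub>M ((unif \<Otimes>\<^sub>M ?E) \<Otimes>\<^sub>M unifs))
      (((M \<Otimes>\<^sub>M unifs) \<Otimes>\<^sub>M (unif \<Otimes>\<^sub>M ?E)) \<Otimes>\<^sub>M unifs) (\<lambda>(x, y, z). ((x, y), z))"
    by (rule measure_preserving_assoc) (intro M u us es pp)+
  have 1: "measure_preserving unifs (unifs \<Otimes>\<^sub>M ((unif \<Otimes>\<^sub>M ?E) \<Otimes>\<^sub>M unifs))
      (\<lambda>x. case ?c (?s x) of (a, w) \<Rightarrow> (a, case w of (x, y, z) \<Rightarrow> ((x, y), z)))"
    by (rule measure_preserving_comp[OF measure_preserving_comp[OF split3 comps]
        measure_preserving_pair[OF id assoc1]])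
       (intro M u us es pp)+
  have 2: "measure_preserving (M \<Otimes>\<^sub>M unifs) (M \<Otimes>\<^sub>M (unifs \<Otimes>\<^sub>M ((unif \<Otimes>\<^sub>M ?E) \<Otimes>\<^sub>M unifs)))
     (\<lambda>(m, x). (m, case ?c (?s x) of (a, w) \<Rightarrow> (a, case w of (x, y, z) \<Rightarrow> ((x, y), z))))"
    by (rule measure_preserving_pair[OF id 1]) (intro M u us es pp)+
  show ?thesis
    unfolding ext_def
    by (rule exI, rule conjI, rule measure_preserving_comp[OF measure_preserving_comp[OF 2 assoc2]
        assoc3]) (auto simp: case_prod_beta)
qed

section \<open>Uniformly random permutations\<close>

text \<open>
  Take the element with index \<open>\<lfloor>n x\<rfloor>\<close> in an enumeration of the \<open>n\<close> elements.
\<close>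

lemma uniform_choice:
  assumes A: "finite A" "A \<noteq> {}"
  shows "\<exists>g. g \<in> unif \<rightarrow>\<^sub>M count_space UNIV \<and> (\<forall>x. g x \<in> A) \<and>
      (\<forall>a\<in>A. measure unif {x. g x = a} = 1 / real (card A))"
proof -
  define n where "n = card A"
  have n: "n > 0" using A by (simp add: n_def card_gt_0_iff)
  obtain h where h: "bij_betw h {0..<n} A" using ex_bij_betw_nat_finite[OF A(1)] unfolding n_def
      by blast
  \<comment> \<open>The index would be n at x = 1, a null event that is sent to index 0.\<close>
  define g where "g x = h (if 0 \<le> x \<and> x < 1 then nat \<lfloor>real n * x\<rfloor> else 0)" for x :: real
  have lt: "(if 0 \<le> x \<and> x < 1 then nat \<lfloor>real n * x\<rfloor> else 0) < n" for x :: real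
    using n by (auto simp: floor_less_iff nat_less_iff)
  have [measurable]: "(\<lambda>x. if 0 \<le> x \<and> x < 1 then nat \<lfloor>real n * x\<rfloor> else 0) \<in> borel \<rightarrow>\<^sub>M count_space UNIV"
      by measurable
  have g: "g \<in> unif \<rightarrow>\<^sub>M count_space UNIV"
    unfolding g_def by (rule measurable_compose[of _ _ "count_space UNIV"]) auto
  have gA: "g x \<in> A" for x
    using bij_betwE[OF h] lt unfolding g_def by (metis atLeast0LessThan lessThan_iff)
  have "measure unif {x. g x = a} = 1 / real n" if a: "a \<in> A" for a
  proof -
    obtain i where i: "i < n" "a = h i" using h a by (auto simp: bij_betw_def)
    have inj: "h j = h i \<longleftrightarrow> j = i" if "j < n" for j
      using h i that by (auto simp: bij_betw_def inj_on_def)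
    have meas: "{x. g x = a} \<in> sets borel" using measurable_sets[OF g, of "{a}"]
        by (simp add: vimage_def)
    have pt: "(x \<in> {0..1} \<inter> {x. g x = a}) = (x \<in> {real i / real n..<(real i + 1) / real n})" if "x \<noteq> 1"
        for x :: real
    proof -
      have "(x \<in> {0..1} \<inter> {x. g x = a}) \<longleftrightarrow> (0 \<le> x \<and> x < 1 \<and> nat \<lfloor>real n * x\<rfloor> = i)"
        using inj[OF lt[of x]] that by (auto simp: g_def i(2))
      also have "\<dots> \<longleftrightarrow> (0 \<le> x \<and> x < 1 \<and> real i \<le> real n * x \<and> real n * x < real i + 1)"
        by (auto simp: nat_eq_iff floor_eq_iff)
      also have "\<dots> \<longleftrightarrow> (x \<in> {real i / real n..<(real i + 1) / real n})"
      proof -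
        have "real i + 1 \<le> real n" using i by linarith
        then have 1: "(real i + 1) / real n \<le> 1" using n by (simp add: field_simps)
        have 0: "0 \<le> real i / real n" by simp
        have e: "real i / real n \<le> x \<longleftrightarrow> real i \<le> real n * x"
            "x < (real i + 1) / real n \<longleftrightarrow> real n * x < real i + 1"
          using n by (auto simp: field_simps)
        show ?thesis unfolding atLeastLessThan_iff e[symmetric] using 0 1 by (safe; linarith)
      qed
      finally show ?thesis .
    qed
    have "emeasure unif {x. g x = a} = emeasure lborel ({0..1} \<inter> {x. g x = a})"
      using meas by (simp add: emeasure_uniform_measure ennreal_div_one)
    also have "\<dots> = emeasure lborel {real i / real n..<(real i + 1) / real n}"
      by (rule emeasure_eq_AE, rule AE_mp[OF AE_lborel_singleton[of 1]], rule AE_I2)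
          (use pt meas in auto)
    also have "\<dots> = ennreal (1 / real n)" using n
        by (simp add: divide_right_mono diff_divide_distrib[symmetric])
    finally show ?thesis by (simp add: measure_def)
  qed
  with g gA show ?thesis unfolding n_def by blast
qed

text \<open>
  Composition with a permutation that turns the list \<open>c1\<close> into \<open>c2\<close> is a bijection between the
  permutations that turn \<open>b\<close> into \<open>c1\<close> and those that turn \<open>b\<close> into \<open>c2\<close>. So all rearrangements of
  \<open>b\<close> are equally likely.
\<close>

lemma random_permutation_list:
  assumes g: "g \<in> unif \<rightarrow>\<^sub>M count_space UNIV" "\<And>x. g x \<in> {p. p permutes {..<k}}"
    "\<And>p. p permutes {..<k} \<Longrightarrow> measure unif {x. g x = p} = 1 / fact k" and b: "length b = k"
  shows "measure unif {x. permute_list (g x) b = c} =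
    (if mset b = mset c then 1 / real (card (permutations_of_multiset (mset c))) else 0)"
proof -
  interpret u: prob_space unif by (rule prob_space_uniform)
  let ?A = "{p. p permutes {..<k}}"
  have fA: "finite ?A" by (rule finite_permutations) simp
  have cA: "card ?A = fact k" by (rule card_permutations) auto
  define Nc where "Nc c = card {p\<in>?A. permute_list p b = c}" for c
  have perm_mset: "mset (permute_list p b) = mset b" if "p \<in> ?A" for p
    using that b by (intro mset_permute_list) simp
  have meas: "{x. g x = p} \<in> sets unif" for p using measurable_sets[OF g(1), of "{p}"]
      by (simp add: vimage_def)
  have "{x. permute_list (g x) b = c} = (\<Union>p\<in>{p\<in>?A. permute_list p b = c}. {x. g x = p})"
    using g(2) by auto
  also have "measure unif \<dots> = (\<Sum>p\<in>{p\<in>?A. permute_list p b = c}. measure unif {x. g x = p})"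
    by (rule u.finite_measure_finite_Union) (use fA meas in \<open>auto simp: disjoint_family_on_def\<close>)
  also have "\<dots> = real (Nc c) / fact k" by (simp add: g(3) Nc_def)
  finally have main: "measure unif {x. permute_list (g x) b = c} = real (Nc c) / fact k" .
  have le: "Nc c1 \<le> Nc c2" if "mset c1 = mset b" "mset c2 = mset b" for c1 c2
  proof -
    have "mset c2 = mset c1" using that by simp
    from mset_eq_permutation[OF this] obtain q
        where q: "q permutes {..<length c1}" "permute_list q c1 = c2"
      by blast
    have lk: "length c1 = k" using that b by (metis mset_eq_length)
    show ?thesis unfolding Nc_def
    proof (rule card_inj_on_le[of "\<lambda>p. p \<circ> q"])
      show "inj_on (\<lambda>p. p \<circ> q) {p \<in> ?A. permute_list p b = c1}"
        by (rule inj_onI) (metis comp_assoc comp_id permutes_inv_o(1)[OF q(1)])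
      show "(\<lambda>p. p \<circ> q) ` {p \<in> ?A. permute_list p b = c1} \<subseteq> {p \<in> ?A. permute_list p b = c2}"
      proof (rule image_subsetI)
        fix p assume p: "p \<in> {p \<in> ?A. permute_list p b = c1}"
        have "permute_list (p \<circ> q) b = permute_list q (permute_list p b)"
          by (rule permute_list_compose) (use q lk b in simp)
        moreover have "p \<circ> q permutes {..<k}" using p q lk by (intro permutes_compose) simp_all
        ultimately show "p \<circ> q \<in> {p \<in> ?A. permute_list p b = c2}" using p q by simp
      qed
    qed (use fA in auto)
  qed
  show ?thesis
  proof (cases "mset b = mset c")
    case False
    then have "{p\<in>?A. permute_list p b = c} = {}" using perm_mset by auto
    then have "Nc c = 0" unfolding Nc_def by (simp only: card.empty)
    then show ?thesis using False main by simp
  next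
    case True
    let ?P = "permutations_of_multiset (mset b)"
    have "(\<Sum>c'\<in>?P. Nc c') = card (\<Union>c'\<in>?P. {p\<in>?A. permute_list p b = c'})"
      unfolding Nc_def
    proof (rule card_UN_disjoint[symmetric])
      show "\<forall>c'\<in>?P. finite {p\<in>?A. permute_list p b = c'}" using finite_subset[OF _ fA] by simp
      show "\<forall>c1\<in>?P. \<forall>c2\<in>?P. c1 \<noteq> c2 \<longrightarrow> {p\<in>?A. permute_list p b = c1} \<inter> {p\<in>?A. permute_list p b = c2} =
          {}" by blast
    qed simp
    also have "(\<Union>c'\<in>?P. {p\<in>?A. permute_list p b = c'}) = ?A"
      using perm_mset by (auto simp: permutations_of_multiset_def)
    also have "(\<Sum>c'\<in>?P. Nc c') = (\<Sum>c'\<in>?P. Nc c)"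
      using le True by (intro sum.cong refl antisym) (auto simp: permutations_of_multiset_def)
    finally have "card ?P * Nc c = fact k" using cA by simp
    then have "real (card ?P) * real (Nc c) = fact k" by (metis of_nat_fact of_nat_mult)
    moreover have "real (card ?P) \<noteq> 0" using calculation by (metis fact_nonzero mult_zero_left)
    ultimately have "real (Nc c) / fact k = 1 / real (card ?P)" by (simp add: field_simps)
    then show ?thesis using True main by simp
  qed
qed

text \<open>
  One random permutation is fixed for every size, all driven by the same uniform variable: whatever
  the number of vertices is, exactly one of them is applied.
\<close>

definition random_permutation :: "nat \<Rightarrow> real \<Rightarrow> nat \<Rightarrow> nat" where
  "random_permutation k = (SOME g. g \<in> unif \<rightarrow>\<^sub>M count_space UNIV \<and> (\<forall>x. g x \<in> {p. p permutes {..<k}}) \<and>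
     (\<forall>p\<in>{p. p permutes {..<k}}. measure unif {x. g x = p} = 1 / real (card {p. p permutes {..<k}})))"

lemma random_permutation:
  shows measurable_random_permutation: "random_permutation k \<in> unif \<rightarrow>\<^sub>M count_space UNIV"
    and random_permutation_permutes: "random_permutation k u permutes {..<k}"
    and random_permutation_uniform: "p permutes {..<k} \<Longrightarrow> measure unif {x. random_permutation k x = p} =
        1 / fact k"
proof -
  have "finite {p. p permutes {..<k}}" by (rule finite_permutations) simp
  moreover have "{p. p permutes {..<k}} \<noteq> {}" using permutes_id by blast
  ultimately have ex: "\<exists>g. g \<in> unif \<rightarrow>\<^sub>M count_space UNIV \<and> (\<forall>x. g x \<in> {p. p permutes {..<k}}) \<and>
     (\<forall>p\<in>{p. p permutes {..<k}}. measure unif {x. g x = p} = 1 / real (card {p. p permutes {..<k}}))"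
    by (rule uniform_choice)
  have card: "card {p. p permutes {..<k}} = fact k" by (rule card_permutations) auto
  note p = someI_ex[OF ex, folded random_permutation_def]
  show "random_permutation k \<in> unif \<rightarrow>\<^sub>M count_space UNIV" using p by blast
  show "random_permutation k u permutes {..<k}" using p by blast
  show "p permutes {..<k} \<Longrightarrow> measure unif {x. random_permutation k x = p} = 1 / fact k"
    using p unfolding card by simp
qed

section \<open>Conditionally Bernoulli edges and i.i.d. representations\<close>

abbreviation labelled_points :: "(enat \<times> (nat \<Rightarrow> 'a::polish_space)) measure" where
  "labelled_points \<equiv> count_space UNIV \<Otimes>\<^sub>M (\<Pi>\<^sub>M k\<in>UNIV. borel)"

text \<open>
  The conditional probability of the edge pattern \<open>a\<close> on the index pairs \<open>F\<close> when the vertices are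
  at \<open>s\<close>, with the Bernoulli probabilities written out.
\<close>

definition edge_weight :: "('a \<Rightarrow> 'a \<Rightarrow> real) \<Rightarrow> (nat \<times> nat) set \<Rightarrow> (nat \<Rightarrow> nat \<Rightarrow> bool) \<Rightarrow> (nat \<Rightarrow> 'a) \<Rightarrow> real"
    where
  "edge_weight W F a s = (\<Prod>(i, j)\<in>F. if a i j then W (s i) (s j) else 1 - W (s i) (s j))"

lemma connection_function_values:
  assumes "connection_function W" shows "0 \<le> W x y" "W x y \<le> 1" "W x y = W y x"
  using assms by (auto simp: connection_function_def)

lemma edge_weight_bernoulli:
  assumes "connection_function W"
  shows "(\<Prod>(i, j) \<in> F. pmf (bernoulli_pmf (W (s i) (s j))) (a i j)) = edge_weight W F a s"
  unfolding edge_weight_def using connection_function_values[OF assms] by (intro prod.cong) auto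

lemma edge_weight_nonneg: "connection_function W \<Longrightarrow> 0 \<le> edge_weight W F a s"
  unfolding edge_weight_def using connection_function_values[of W] by (intro prod_nonneg) auto

lemma edge_weight_le_1: "connection_function W \<Longrightarrow> edge_weight W F a s \<le> 1"
  unfolding edge_weight_def using connection_function_values[of W] by (intro prod_le_1) auto

lemma measurable_connection_function:
  assumes W: "connection_function W" and [measurable]: "f \<in> M \<rightarrow>\<^sub>M borel" "g \<in> M \<rightarrow>\<^sub>M borel"
  shows "(\<lambda>x. W (f x) (g x)) \<in> borel_measurable M"
proof -
  have "case_prod W \<in> borel_measurable (borel \<Otimes>\<^sub>M borel)" using W
      by (simp add: connection_function_def borel_prod)
  from measurable_compose[OF measurable_Pair this, of f M g] assms show ?thesis by simp
qed

lemma measurable_edge_weight: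
  fixes W :: "'a::polish_space \<Rightarrow> 'a \<Rightarrow> real"
  assumes W: "connection_function W"
  shows "edge_weight W F a \<in> borel_measurable (\<Pi>\<^sub>M k\<in>UNIV. borel)"
proof -
  have "(\<lambda>s. if a (fst p) (snd p) then W (s (fst p)) (s (snd p)) else 1 - W (s (fst p)) (s (snd p))) \<in>
      borel_measurable (iid_seq borel)" for p
    using measurable_connection_function[OF W, of "\<lambda>s. s (fst p)" "iid_seq borel" "\<lambda>s. s (snd p)"]
        by simp
  then show ?thesis unfolding edge_weight_def case_prod_beta by (intro borel_measurable_prod)
qed

lemma measurable_labelled_points:
  assumes "N \<in> M \<rightarrow>\<^sub>M count_space UNIV" "\<And>k. S k \<in> M \<rightarrow>\<^sub>M borel"
  shows "(\<lambda>\<omega>. (N \<omega>, \<lambda>k. S k \<omega>)) \<in> M \<rightarrow>\<^sub>M labelled_points"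
  using assms by (intro measurable_Pair measurable_PiM_single') auto

lemma sets_edge_event:
  fixes A :: "nat \<Rightarrow> nat \<Rightarrow> 'w \<Rightarrow> bool"
  assumes A: "\<And>i j. A i j \<in> M \<rightarrow>\<^sub>M count_space UNIV" and F: "finite F"
  shows "{\<omega>\<in>space M. \<forall>(i, j)\<in>F. A i j \<omega> = a i j} \<in> sets M"
proof -
  have "{\<omega>\<in>space M. \<forall>p\<in>F. A (fst p) (snd p) \<omega> = a (fst p) (snd p)} \<in> sets M"
  proof (rule sets.sets_Collect_finite_All[OF _ F])
    fix p show "{\<omega>\<in>space M. A (fst p) (snd p) \<omega> = a (fst p) (snd p)} \<in> sets M"
      using measurable_sets[OF A, of "{a (fst p) (snd p)}" "fst p" "snd p"]
          by (simp add: vimage_def Int_def conj_commute)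
  qed
  then show ?thesis by (simp only: case_prod_beta')
qed

lemma subalgebra_sigma_vertices:
  assumes "N \<in> M \<rightarrow>\<^sub>M count_space UNIV" "\<And>k. S k \<in> M \<rightarrow>\<^sub>M borel"
  shows "subalgebra M (sigma_vertices M N S)"
  unfolding subalgebra_def sigma_vertices_def
  using sets_image_in_sets[OF refl measurable_labelled_points[of N M S, OF assms]] by auto

text \<open>
  This and the next lemma characterize the conditional Bernoulli property without conditional
  expectations. The integral form passes to product spaces by Fubini and to other probability spaces
  along measure preserving maps.
\<close>

lemma conditionally_bernoulliD:
  fixes W :: "'a::polish_space \<Rightarrow> 'a \<Rightarrow> real"
  assumes M: "prob_space M" and W: "connection_function W"
    and N: "N \<in> M \<rightarrow>\<^sub>M count_space UNIV" and S: "\<And>k. S k \<in> M \<rightarrow>\<^sub>M borel"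
        and A: "\<And>i j. A i j \<in> M \<rightarrow>\<^sub>M count_space UNIV"
    and cb: "conditionally_bernoulli M W N S A" and F: "finite F" "F \<subseteq> {(i, j). i < j}"
    and h: "h \<in> borel_measurable labelled_points"
  shows "(\<integral>\<^sup>+\<omega>. h (N \<omega>, \<lambda>k. S k \<omega>) * indicator {\<omega>\<in>space M. \<forall>(i, j)\<in>F. A i j \<omega> = a i j} \<omega> \<partial>M) =
    (\<integral>\<^sup>+\<omega>. h (N \<omega>, \<lambda>k. S k \<omega>) * ennreal (edge_weight W F a (\<lambda>k. S k \<omega>)) \<partial>M)"
proof -
  interpret prob_space M by fact
  interpret finite_measure_subalgebra M "sigma_vertices M N S"
    by (rule finite_measure_subalgebra.intro) (unfold_locales, rule subalgebra_sigma_vertices[OF N S])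
  let ?X = "\<lambda>\<omega>. (N \<omega>, \<lambda>k. S k \<omega>)" and ?P = "labelled_points :: (enat \<times> (nat \<Rightarrow> 'a)) measure"
  let ?A = "{\<omega>\<in>space M. \<forall>(i, j)\<in>F. A i j \<omega> = a i j}"
  let ?w = "\<lambda>\<omega>. edge_weight W F a (\<lambda>k. S k \<omega>)"
  have X[measurable]: "?X \<in> M \<rightarrow>\<^sub>M ?P" by (rule measurable_labelled_points[OF N S])
  have Am[measurable]: "?A \<in> sets M" by (rule sets_edge_event[OF A F(1)])
  have "(\<lambda>\<omega>. edge_weight W F a (snd (?X \<omega>))) \<in> borel_measurable M"
    using measurable_compose[OF X measurable_compose[OF measurable_snd measurable_edge_weight[OF W]]] .
  then have w[measurable]: "?w \<in> borel_measurable M" by simp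
  have w01: "0 \<le> ?w \<omega>" "?w \<omega> \<le> 1" for \<omega>
    using edge_weight_nonneg[OF W] edge_weight_le_1[OF W] by auto
  have iA: "integrable M (indicator ?A :: _ \<Rightarrow> real)"
    by (rule integrable_real_indicator[OF Am]) (simp add: emeasure_eq_measure)
  have ae: "AE \<omega> in M. real_cond_exp M (sigma_vertices M N S) (indicator ?A) \<omega> = ?w \<omega>"
    using cb F unfolding conditionally_bernoulli_def edge_weight_bernoulli[OF W] by blast
  let ?m1 = "distr (density M (indicator ?A)) ?P ?X" and ?m2 =
      "distr (density M (\<lambda>\<omega>. ennreal (?w \<omega>))) ?P ?X"
  have "?m1 = ?m2"
  proof (rule measure_eqI)
    fix H assume "H \<in> sets ?m1"
    then have H[measurable]: "H \<in> sets ?P" by simp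
    define G where "G = ?X -` H \<inter> space M"
    have G: "G \<in> sets (sigma_vertices M N S)"
      unfolding G_def sigma_vertices_def by (rule in_vimage_algebra[OF H])
    have Gm[measurable]: "G \<in> sets M" unfolding G_def using measurable_sets[OF X H] .
    have "emeasure ?m1 H = emeasure (density M (indicator ?A)) G"
      by (simp add: emeasure_distr G_def)
    also have "\<dots> = emeasure M (?A \<inter> G)"
      by (subst emeasure_density) (simp_all flip: indicator_inter_arith)
    also have "\<dots> = ennreal (\<integral>x\<in>G. indicator ?A x \<partial>M)"
    proof -
      have "(\<integral>x\<in>G. indicator ?A x \<partial>M) = (\<integral>x. indicator (?A \<inter> G) x \<partial>M)"
        unfolding set_lebesgue_integral_def
            by (rule Bochner_Integration.integral_cong) (auto simp: indicator_def)
      also have "\<dots> = measure M (?A \<inter> G)"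
        using sets.sets_into_space[OF Gm]
            by (simp add: Bochner_Integration.integral_indicator Int_absorb2 le_infI2)
      finally show ?thesis by (simp add: emeasure_eq_measure)
    qed
    also have "(\<integral>x\<in>G. indicator ?A x \<partial>M) =
        (\<integral>x\<in>G. real_cond_exp M (sigma_vertices M N S) (indicator ?A) x \<partial>M)"
      by (rule real_cond_exp_intA[OF iA G])
    also have "\<dots> = (\<integral>x\<in>G. ?w x \<partial>M)"
      unfolding set_lebesgue_integral_def
      by (intro integral_cong_AE) (use ae in \<open>auto intro!: borel_measurable_scaleR
          borel_measurable_indicator\<close>)
    also have "ennreal \<dots> = (\<integral>\<^sup>+x. ennreal (indicator G x * ?w x) \<partial>M)"
      unfolding set_lebesgue_integral_def
      by (subst nn_integral_eq_integral)
          (use w01 in \<open>auto intro!: integrable_const_bound[where B=1] simp: indicator_def\<close>)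
    also have "\<dots> = (\<integral>\<^sup>+x. ennreal (?w x) * indicator G x \<partial>M)"
      by (intro nn_integral_cong) (auto simp: indicator_def)
    also have "\<dots> = emeasure (density M (\<lambda>\<omega>. ennreal (?w \<omega>))) G"
      by (subst emeasure_density) auto
    also have "\<dots> = emeasure ?m2 H" by (simp add: emeasure_distr G_def)
    finally show "emeasure ?m1 H = emeasure ?m2 H" .
  qed simp
  then have "(\<integral>\<^sup>+x. h x \<partial>?m1) = (\<integral>\<^sup>+x. h x \<partial>?m2)" by simp
  moreover have "(\<integral>\<^sup>+x. h x \<partial>?m1) = (\<integral>\<^sup>+\<omega>. h (?X \<omega>) * indicator ?A \<omega> \<partial>M)"
    using h measurable_compose[OF X h] by (simp add: nn_integral_distr nn_integral_density mult.commute)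
  moreover have "(\<integral>\<^sup>+x. h x \<partial>?m2) = (\<integral>\<^sup>+\<omega>. h (?X \<omega>) * ennreal (?w \<omega>) \<partial>M)"
    using h measurable_compose[OF X h] by (simp add: nn_integral_distr nn_integral_density mult.commute)
  ultimately show ?thesis by simp
qed

lemma conditionally_bernoulliI:
  fixes W :: "'a::polish_space \<Rightarrow> 'a \<Rightarrow> real"
  assumes M: "prob_space M" and W: "connection_function W"
    and N: "N \<in> M \<rightarrow>\<^sub>M count_space UNIV" and S: "\<And>k. S k \<in> M \<rightarrow>\<^sub>M borel"
        and A: "\<And>i j. A i j \<in> M \<rightarrow>\<^sub>M count_space UNIV"
    and eq: "\<And>F a H. finite F \<Longrightarrow> F \<subseteq> {(i, j). i < j} \<Longrightarrow> H \<in> sets labelled_points \<Longrightarrow>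
      (\<integral>\<^sup>+\<omega>. indicator H (N \<omega>, \<lambda>k. S k \<omega>) * indicator {\<omega>\<in>space M. \<forall>(i, j)\<in>F. A i j \<omega> = a i j} \<omega> \<partial>M) =
      (\<integral>\<^sup>+\<omega>. indicator H (N \<omega>, \<lambda>k. S k \<omega>) * ennreal (edge_weight W F a (\<lambda>k. S k \<omega>)) \<partial>M)"
  shows "conditionally_bernoulli M W N S A"
  unfolding conditionally_bernoulli_def edge_weight_bernoulli[OF W]
proof (intro allI impI, elim conjE)
  fix F a assume F: "finite F" "F \<subseteq> {(i::nat, j). i < j}"
  interpret prob_space M by fact
  interpret finite_measure_subalgebra M "sigma_vertices M N S"
    by (rule finite_measure_subalgebra.intro) (unfold_locales, rule subalgebra_sigma_vertices[OF N S])
  let ?X = "\<lambda>\<omega>. (N \<omega>, \<lambda>k. S k \<omega>)" and ?P = "labelled_points :: (enat \<times> (nat \<Rightarrow> 'a)) measure"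
  let ?A = "{\<omega>\<in>space M. \<forall>(i, j)\<in>F. A i j \<omega> = a i j}"
  let ?w = "\<lambda>\<omega>. edge_weight W F a (\<lambda>k. S k \<omega>)"
  have X[measurable]: "?X \<in> M \<rightarrow>\<^sub>M ?P" by (rule measurable_labelled_points[OF N S])
  have Am[measurable]: "?A \<in> sets M" by (rule sets_edge_event[OF A F(1)])
  note ws = measurable_compose[OF measurable_snd measurable_edge_weight[OF W]]
  have "(\<lambda>\<omega>. edge_weight W F a (snd (?X \<omega>))) \<in> borel_measurable M"
    using measurable_compose[OF X ws] .
  then have w[measurable]: "?w \<in> borel_measurable M" by simp
  have X': "?X \<in> sigma_vertices M N S \<rightarrow>\<^sub>M ?P"
    unfolding sigma_vertices_def by (rule measurable_vimage_algebra1)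
        (auto simp: space_pair_measure space_PiM)
  have "(\<lambda>\<omega>. edge_weight W F a (snd (?X \<omega>))) \<in> borel_measurable (sigma_vertices M N S)"
    using measurable_compose[OF X' ws] .
  then have w'[measurable]: "?w \<in> borel_measurable (sigma_vertices M N S)" by simp
  have w01: "0 \<le> ?w \<omega>" "?w \<omega> \<le> 1" for \<omega>
    using edge_weight_nonneg[OF W] edge_weight_le_1[OF W] by auto
  have iw: "integrable M ?w" by (rule integrable_const_bound[where B=1]) (use w01 in auto)
  have iA: "integrable M (indicator ?A :: _ \<Rightarrow> real)"
    by (rule integrable_real_indicator[OF Am]) (simp add: emeasure_eq_measure)
  show "AE \<omega> in M. real_cond_exp M (sigma_vertices M N S) (indicator ?A) \<omega> = ?w \<omega>"
  proof (rule real_cond_exp_charact[OF _ iA iw w'])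
    fix G assume "G \<in> sets (sigma_vertices M N S)"
    then obtain H where H: "H \<in> sets ?P" "G = ?X -` H \<inter> space M"
      unfolding sigma_vertices_def by (subst (asm) sets_vimage_algebra2)
          (auto simp: space_pair_measure space_PiM)
    have Gm[measurable]: "G \<in> sets M" unfolding H(2) using measurable_sets[OF X H(1)] .
    have ind: "indicator H (?X \<omega>) = (indicator G \<omega> :: ennreal)" if "\<omega> \<in> space M" for \<omega>
      using that by (auto simp: H(2) indicator_def)
    have "ennreal (\<integral>x\<in>G. indicator ?A x \<partial>M) = (\<integral>\<^sup>+x. indicator G x * indicator ?A x \<partial>M)"
      unfolding set_lebesgue_integral_def
      by (subst nn_integral_eq_integral[symmetric])
         (auto intro!: integrable_const_bound[where B=1] nn_integral_cong simp: indicator_def)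
    also have "\<dots> = (\<integral>\<^sup>+x. indicator H (?X x) * indicator ?A x \<partial>M)"
      by (rule nn_integral_cong) (simp add: ind)
    also have "\<dots> = (\<integral>\<^sup>+x. indicator H (?X x) * ennreal (?w x) \<partial>M)" by (rule eq[OF F H(1)])
    also have "\<dots> = (\<integral>\<^sup>+x. indicator G x * ennreal (?w x) \<partial>M)"
      by (rule nn_integral_cong) (simp add: ind)
    also have "\<dots> = ennreal (\<integral>x\<in>G. ?w x \<partial>M)"
      unfolding set_lebesgue_integral_def
      by (subst nn_integral_eq_integral[symmetric])
         (use w01 in \<open>auto intro!: integrable_const_bound[where B=1] nn_integral_cong simp:
             indicator_def\<close>)
    finally show "(\<integral>x\<in>G. indicator ?A x \<partial>M) = (\<integral>x\<in>G. ?w x \<partial>M)"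
      unfolding set_lebesgue_integral_def by (subst (asm) ennreal_inj)
          (use w01 in \<open>auto intro!: Bochner_Integration.integral_nonneg\<close>)
  qed
qed

lemma nn_integral_eq_by_cases:
  fixes Z :: "'w \<Rightarrow> 'c::countable"
  assumes Z: "Z \<in> M \<rightarrow>\<^sub>M count_space UNIV" and f: "f \<in> borel_measurable M" and g: "g \<in> borel_measurable M"
    and eq: "\<And>c. (\<integral>\<^sup>+x. f x * indicator {c} (Z x) \<partial>M) = (\<integral>\<^sup>+x. g x * indicator {c} (Z x) \<partial>M)"
  shows "(\<integral>\<^sup>+x. f x \<partial>M) = (\<integral>\<^sup>+x. g x \<partial>M)"
proof -
  have *: "(\<integral>\<^sup>+x. f x \<partial>M) = (\<Sum>n. \<integral>\<^sup>+x. f x * indicator {n} (to_nat (Z x)) \<partial>M)"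
    if f: "f \<in> borel_measurable M" for f :: "'w \<Rightarrow> ennreal"
  proof -
    have t: "(\<lambda>x. to_nat (Z x)) \<in> M \<rightarrow>\<^sub>M count_space UNIV" by (rule measurable_compose[OF Z]) simp
    have "(\<integral>\<^sup>+x. f x \<partial>M) = (\<integral>\<^sup>+x. (\<Sum>n. f x * indicator {n} (to_nat (Z x))) \<partial>M)"
    proof (rule nn_integral_cong)
      fix x
      have "(\<Sum>n. f x * indicator {n} (to_nat (Z x))) =
          (\<Sum>n\<in>{to_nat (Z x)}. f x * indicator {n} (to_nat (Z x)))"
        by (rule suminf_finite) (auto simp: indicator_def)
      then show "f x = (\<Sum>n. f x * indicator {n} (to_nat (Z x)))" by simp
    qed
    also have "\<dots> = (\<Sum>n. \<integral>\<^sup>+x. f x * indicator {n} (to_nat (Z x)) \<partial>M)"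
      using f measurable_compose[OF t, of "indicator {_}" borel]
      by (intro nn_integral_suminf borel_measurable_times_ennreal) simp_all
    finally show ?thesis .
  qed
  have "(\<integral>\<^sup>+x. f x * indicator {n} (to_nat (Z x)) \<partial>M) = (\<integral>\<^sup>+x. g x * indicator {n} (to_nat (Z x)) \<partial>M)" for
      n
  proof (cases "n \<in> range (to_nat :: 'c \<Rightarrow> nat)")
    case True
    then obtain c :: 'c where "n = to_nat c" by auto
    then have "indicator {n} (to_nat (Z x)) = (indicator {c} (Z x) :: ennreal)" for x
        by (auto simp: indicator_def)
    then show ?thesis using eq by simp
  next
    case False
    then have "indicator {n} (to_nat (Z x)) = (0 :: ennreal)" for x by (auto simp: indicator_def)
    then show ?thesis by simp
  qed
  then show ?thesis using *[OF f] *[OF g] by simp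
qed

text \<open>
  For a diffuse law \<open>\<eta>\<close> the diagonal is a null set of \<open>\<eta> \<Otimes>\<^sub>M \<eta>\<close>.
\<close>

lemma AE_distinct_iid:
  fixes S :: "nat \<Rightarrow> 'w \<Rightarrow> 'a::polish_space"
  assumes "prob_space M" and S: "\<And>k. S k \<in> M \<rightarrow>\<^sub>M borel"
      and indep: "prob_space.indep_vars M (\<lambda>_. borel) S UNIV"
    and law: "\<And>k. distr M borel (S k) = \<eta>" and diffuse: "\<And>x. measure \<eta> {x} = 0"
  shows "AE \<omega> in M. inj (\<lambda>k. S k \<omega>)"
proof -
  interpret prob_space M by fact
  have \<eta>: "prob_space \<eta>" unfolding law[of 0, symmetric] by (rule prob_space_distr[OF S])
  interpret \<eta>: prob_space \<eta> by fact
  have s\<eta>: "sets \<eta> = sets borel" unfolding law[of 0, symmetric] by simp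
  have "AE \<omega> in M. S i \<omega> \<noteq> S j \<omega>" if "i \<noteq> j" for i j
  proof -
    let ?\<Delta> = "{p :: 'a \<times> 'a. fst p = snd p}"
    have "{p \<in> space (borel \<Otimes>\<^sub>M borel). fst p = snd p} \<in> sets (borel \<Otimes>\<^sub>M borel :: ('a \<times> 'a) measure)"
      by measurable
    then have \<Delta>: "?\<Delta> \<in> sets (borel \<Otimes>\<^sub>M borel)" by (simp add: space_pair_measure)
    have SS: "(\<lambda>\<omega>. (S i \<omega>, S j \<omega>)) \<in> M \<rightarrow>\<^sub>M borel \<Otimes>\<^sub>M borel"
      by (rule measurable_Pair[OF S S])
    have d: "\<eta> \<Otimes>\<^sub>M \<eta> = distr M (borel \<Otimes>\<^sub>M borel) (\<lambda>\<omega>. (S i \<omega>, S j \<omega>))"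
    proof (rule pair_measure_eqI)
      fix X Y assume X: "X \<in> sets \<eta>" and Y: "Y \<in> sets \<eta>"
      define G where "G k = (if k = i then X else Y)" for k
      have "prob (\<Inter>k\<in>{i, j}. S k -` G k \<inter> space M) = (\<Prod>k\<in>{i, j}. prob (S k -` G k \<inter> space M))"
        by (rule indep_varsD[OF indep]) (use X Y s\<eta> in \<open>auto simp: G_def\<close>)
      also have "\<dots> = measure \<eta> X * measure \<eta> Y"
      proof -
        have "prob (S k -` Z \<inter> space M) = measure \<eta> Z" if "Z \<in> sets \<eta>" for k Z
          using measure_distr[OF S, of Z k] that unfolding law s\<eta> by simp
        then show ?thesis using X Y that by (simp add: G_def)
      qed
      also have "(\<Inter>k\<in>{i, j}. S k -` G k \<inter> space M) = (\<lambda>\<omega>. (S i \<omega>, S j \<omega>)) -` (X \<times> Y) \<inter> space M"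
        using that by (auto simp: G_def)
      finally show "emeasure \<eta> X * emeasure \<eta> Y =
          emeasure (distr M (borel \<Otimes>\<^sub>M borel) (\<lambda>\<omega>. (S i \<omega>, S j \<omega>))) (X \<times> Y)"
        using X Y SS s\<eta> by (subst emeasure_distr)
            (auto simp: emeasure_eq_measure \<eta>.emeasure_eq_measure ennreal_mult)
    qed (use \<eta> s\<eta> in \<open>auto simp: prob_space_imp_sigma_finite intro!: sets_pair_measure_cong\<close>)
    have "emeasure M ((\<lambda>\<omega>. (S i \<omega>, S j \<omega>)) -` ?\<Delta> \<inter> space M) = emeasure (\<eta> \<Otimes>\<^sub>M \<eta>) ?\<Delta>"
      unfolding d by (rule emeasure_distr[OF SS \<Delta>, symmetric])
    also have "\<dots> = (\<integral>\<^sup>+x. emeasure \<eta> (Pair x -` ?\<Delta>) \<partial>\<eta>)"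
      by (rule \<eta>.emeasure_pair_measure_alt) (use \<Delta> in \<open>simp only: sets_pair_measure_cong[OF s\<eta> s\<eta>]\<close>)
    also have "\<dots> = (\<integral>\<^sup>+x. 0 \<partial>\<eta>)"
    proof (rule nn_integral_cong)
      fix x :: 'a
      have "Pair x -` ?\<Delta> = {x}" by auto
      then show "emeasure \<eta> (Pair x -` ?\<Delta>) = 0" using diffuse by (simp add: \<eta>.emeasure_eq_measure)
    qed
    finally have 0: "emeasure M ((\<lambda>\<omega>. (S i \<omega>, S j \<omega>)) -` ?\<Delta> \<inter> space M) = 0" by simp
    show ?thesis
      by (rule AE_I[OF _ 0]) (use measurable_sets[OF SS \<Delta>] in auto)
  qed
  then have "AE \<omega> in M. \<forall>i j. i \<noteq> j \<longrightarrow> S i \<omega> \<noteq> S j \<omega>"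
    by (auto simp: AE_all_countable)
  then show ?thesis by eventually_elim (auto simp: inj_def)
qed

text \<open>
  The identities \<open>law\<close> and \<open>edges\<close> concern only the joint law of \<open>N\<close>, \<open>S\<close> and \<open>A\<close>. They can thus be
  verified on a product space and then transported.
\<close>

lemma iid_representationI:
  fixes \<xi> :: "'w \<Rightarrow> (('a::polish_space \<times> 'a) \<times> bool) measure"
  assumes M: "prob_space M" and W: "connection_function W"
    and N: "N \<in> M \<rightarrow>\<^sub>M count_space UNIV" and S: "\<And>k. S k \<in> M \<rightarrow>\<^sub>M borel"
        and A: "\<And>i j. A i j \<in> M \<rightarrow>\<^sub>M count_space UNIV"
    and \<eta>: "prob_space \<eta>" "sets \<eta> = sets borel" "\<And>x. measure \<eta> {x} = 0"
    and law: "\<And>n H. H \<in> sets (iid_seq \<eta>) \<Longrightarrow>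
       emeasure M {\<omega>\<in>space M. N \<omega> = n \<and> (\<lambda>k. S k \<omega>) \<in> H} = emeasure M {\<omega>\<in>space M. N \<omega> = n} *
           emeasure (iid_seq \<eta>) H"
    and irrefl: "\<And>i \<omega>. \<not> A i i \<omega>" and sym: "\<And>i j \<omega>. A j i \<omega> = A i j \<omega>"
    and edges: "\<And>F a H. finite F \<Longrightarrow> F \<subseteq> {(i, j). i < j} \<Longrightarrow> H \<in> sets labelled_points \<Longrightarrow>
      (\<integral>\<^sup>+\<omega>. indicator H (N \<omega>, \<lambda>k. S k \<omega>) * indicator {\<omega>\<in>space M. \<forall>(i, j)\<in>F. A i j \<omega> = a i j} \<omega> \<partial>M) =
      (\<integral>\<^sup>+\<omega>. indicator H (N \<omega>, \<lambda>k. S k \<omega>) * ennreal (edge_weight W F a (\<lambda>k. S k \<omega>)) \<partial>M)"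
    and \<xi>: "AE \<omega> in M. \<xi> \<omega> =
        sum_of_diracs edge_space {(i, j). enat i < N \<omega> \<and> enat j < N \<omega>}
          (\<lambda>(i, j). ((S i \<omega>, S j \<omega>), A i j \<omega>))"
  shows "iid_representation M \<xi> W N S A \<eta>"
proof -
  interpret prob_space M by fact
  let ?Q = "iid_seq \<eta>" and ?B = "iid_seq (borel :: 'a measure)"
  interpret \<eta>: prob_space \<eta> by fact
  interpret Q: prob_space ?Q by (rule prob_space_PiM) (rule \<eta>)
  have QB: "sets ?Q = sets ?B" by (rule sets_PiM_cong[OF refl]) (rule \<eta>)
  have Ss: "(\<lambda>\<omega> k. S k \<omega>) \<in> M \<rightarrow>\<^sub>M ?B" using S by (intro measurable_PiM_single') auto
  have Ns: "{\<omega>\<in>space M. N \<omega> \<in> K} \<in> sets M" for K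
    using measurable_sets[OF N, of K] by (simp add: vimage_def Int_def conj_commute)
  have Hs: "{\<omega>\<in>space M. (\<lambda>k. S k \<omega>) \<in> H} \<in> sets M" if "H \<in> sets ?B" for H
    using measurable_sets[OF Ss that] by (simp add: vimage_def Int_def conj_commute)
  have joint: "emeasure M ({\<omega>\<in>space M. N \<omega> \<in> K} \<inter> {\<omega>\<in>space M. (\<lambda>k. S k \<omega>) \<in> H}) =
      emeasure M {\<omega>\<in>space M. N \<omega> \<in> K} * emeasure ?Q H"
    if H: "H \<in> sets ?B" for K H
  proof -
    let ?U = "{\<omega>\<in>space M. N \<omega> \<in> K}" and ?V = "{\<omega>\<in>space M. (\<lambda>k. S k \<omega>) \<in> H}"
    have "emeasure M (?U \<inter> ?V) = (\<integral>\<^sup>+\<omega>. indicator (?U \<inter> ?V) \<omega> \<partial>M)"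
      using Ns[of K] Hs[OF H] by (intro nn_integral_indicator[symmetric] sets.Int)
    also have "\<dots> = (\<integral>\<^sup>+\<omega>. emeasure ?Q H * indicator ?U \<omega> \<partial>M)"
    proof (rule nn_integral_eq_by_cases[OF N])
      fix n
      have "(\<integral>\<^sup>+\<omega>. indicator (?U \<inter> ?V) \<omega> * indicator {n} (N \<omega>) \<partial>M) =
         (\<integral>\<^sup>+\<omega>. indicator K n * indicator {\<omega>\<in>space M. N \<omega> = n \<and> (\<lambda>k. S k \<omega>) \<in> H} \<omega> \<partial>M)"
        by (rule nn_integral_cong) (auto simp: indicator_def)
      also have "\<dots> = indicator K n * emeasure M {\<omega>\<in>space M. N \<omega> = n \<and> (\<lambda>k. S k \<omega>) \<in> H}"
      proof (rule nn_integral_cmult_indicator)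
        have "{\<omega>\<in>space M. N \<omega> = n \<and> (\<lambda>k. S k \<omega>) \<in> H} = {\<omega>\<in>space M. N \<omega> \<in> {n}} \<inter> ?V" by auto
        then show "{\<omega>\<in>space M. N \<omega> = n \<and> (\<lambda>k. S k \<omega>) \<in> H} \<in> sets M" using Ns[of "{n}"] Hs[OF H] by simp
      qed
      also have "\<dots> = (indicator K n * emeasure ?Q H) * emeasure M {\<omega>\<in>space M. N \<omega> = n}"
        using H by (subst law) (auto simp: QB mult_ac)
      also have "\<dots> = (\<integral>\<^sup>+\<omega>. (indicator K n * emeasure ?Q H) * indicator {\<omega>\<in>space M. N \<omega> = n} \<omega> \<partial>M)"
        using Ns[of "{n}"] by (intro nn_integral_cmult_indicator[symmetric]) simp
      also have "\<dots> = (\<integral>\<^sup>+\<omega>. emeasure ?Q H * indicator ?U \<omega> * indicator {n} (N \<omega>) \<partial>M)"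
        by (rule nn_integral_cong) (auto simp: indicator_def)
      finally show "(\<integral>\<^sup>+\<omega>. indicator (?U \<inter> ?V) \<omega> * indicator {n} (N \<omega>) \<partial>M) =
          (\<integral>\<^sup>+\<omega>. emeasure ?Q H * indicator ?U \<omega> * indicator {n} (N \<omega>) \<partial>M)" .
    qed (use Ns[of K] Hs[OF H] in \<open>auto intro!: borel_measurable_indicator
        borel_measurable_times_ennreal\<close>)
    also have "\<dots> = emeasure M ?U * emeasure ?Q H"
      using Ns[of K] by (subst nn_integral_cmult_indicator) (auto simp: mult.commute)
    finally show ?thesis .
  qed
  have lawS: "distr M ?B (\<lambda>\<omega> k. S k \<omega>) = ?Q"
  proof (rule measure_eqI)
    fix H assume "H \<in> sets (distr M ?B (\<lambda>\<omega> k. S k \<omega>))"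
    then have H: "H \<in> sets ?B" by simp
    have U: "{\<omega>\<in>space M. N \<omega> \<in> UNIV} = space M" by auto
    have "emeasure (distr M ?B (\<lambda>\<omega> k. S k \<omega>)) H = emeasure M {\<omega>\<in>space M. (\<lambda>k. S k \<omega>) \<in> H}"
      by (subst emeasure_distr[OF Ss H]) (simp add: vimage_def Int_def conj_commute)
    also have "\<dots> = emeasure ?Q H"
      using joint[OF H, of UNIV] unfolding U by (simp add: emeasure_space_1 Int_absorb1)
    finally show "emeasure (distr M ?B (\<lambda>\<omega> k. S k \<omega>)) H = emeasure ?Q H" .
  qed (simp add: QB)
  have lawk: "distr M borel (S k) = \<eta>" for k
  proof -
    have "distr M borel (S k) = distr (distr M ?B (\<lambda>\<omega> k. S k \<omega>)) borel (\<lambda>s. s k)"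
      by (subst distr_distr[OF _ Ss]) (auto simp: o_def)
    also have "\<dots> = distr ?Q \<eta> (\<lambda>s. s k)" unfolding lawS by (rule distr_cong) (auto simp: \<eta>)
    also have "\<dots> = \<eta>" by (rule distr_PiM_component) (auto intro: \<eta>)
    finally show ?thesis .
  qed
  have indep: "indep_vars (\<lambda>_. borel) S UNIV"
  proof (subst indep_vars_iff_distr_eq_PiM)
    have "(\<lambda>\<omega>. \<lambda>i\<in>UNIV. S i \<omega>) = (\<lambda>\<omega> k. S k \<omega>)" by (auto simp: fun_eq_iff)
    then show "distr M ?B (\<lambda>\<omega>. \<lambda>i\<in>UNIV. S i \<omega>) = (\<Pi>\<^sub>M i\<in>UNIV. distr M borel (S i))"
      by (simp only: lawS lawk)
  qed (use S in auto)
  have "indep_set (sets (vimage_algebra (space M) N (count_space UNIV)))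
       (sets (vimage_algebra (space M) (\<lambda>\<omega> k. S k \<omega>) ?B))"
  proof (rule indep_setI)
    fix a b assume a: "a \<in> sets (vimage_algebra (space M) N (count_space UNIV))"
      and b: "b \<in> sets (vimage_algebra (space M) (\<lambda>\<omega> k. S k \<omega>) ?B)"
    obtain K where K: "a = {\<omega>\<in>space M. N \<omega> \<in> K}"
      using a by (subst (asm) sets_vimage_algebra2) auto
    obtain H where H: "H \<in> sets ?B" "b = {\<omega>\<in>space M. (\<lambda>k. S k \<omega>) \<in> H}"
      using b by (subst (asm) sets_vimage_algebra2) (auto simp: space_PiM)
    have U: "{\<omega>\<in>space M. N \<omega> \<in> UNIV} = space M" by auto
    have "emeasure M b = emeasure ?Q H"
      using joint[OF H(1), of UNIV] unfolding U H(2) by (simp add: emeasure_space_1 Int_absorb1)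
    then have "emeasure M (a \<inter> b) = emeasure M a * emeasure M b"
      using joint[OF H(1), of K] unfolding K H(2) by simp
    then show "prob (a \<inter> b) = prob a * prob b"
      by (simp add: emeasure_eq_measure ennreal_mult[symmetric])
  qed (use sets_image_in_sets[OF refl N] sets_image_in_sets[OF refl Ss] in auto)
  moreover have "conditionally_bernoulli M W N S A"
    by (rule conditionally_bernoulliI[OF M W N S A edges])
  moreover have "AE \<omega> in M. inj (\<lambda>k. S k \<omega>)"
    by (rule AE_distinct_iid[OF M S indep lawk \<eta>(3)])
  ultimately show ?thesis
    unfolding iid_representation_def representation_def
    using N S A irrefl sym indep lawk \<xi> by blast
qed

section \<open>Shuffling the vertices in a set\<close>

definition visible :: "'a set \<Rightarrow> enat \<times> (nat \<Rightarrow> 'a) \<Rightarrow> nat set" where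
  "visible D x = {i. enat i < fst x \<and> snd x i \<in> D}"

text \<open>
  The increasing enumeration is an arbitrary measurable choice; the random permutation removes its
  influence. On the null event that infinitely many vertices lie in \<open>D\<close>, the list is empty.
\<close>

definition shuffled :: "'a set \<Rightarrow> enat \<times> (nat \<Rightarrow> 'a) \<Rightarrow> real \<Rightarrow> nat list" where
  "shuffled D x u = (let l = sorted_list_of_set (visible D x) in permute_list
      (random_permutation (length l) u) l)"

lemma length_shuffled: "length (shuffled D x u) = length (sorted_list_of_set (visible D x))"
  by (simp add: shuffled_def Let_def)

lemma distinct_shuffled: "distinct (shuffled D x u)"
  unfolding shuffled_def Let_def by (subst distinct_permute_list)
      (simp_all add: random_permutation_permutes)

lemma set_shuffled: "finite (visible D x) \<Longrightarrow> set (shuffled D x u) = visible D x"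
  unfolding shuffled_def Let_def by (subst set_permute_list) (simp_all add: random_permutation_permutes)

lemma measurable_visible_list:
  fixes D :: "'a::polish_space set"
  assumes D: "D \<in> sets borel"
  shows "(\<lambda>x. sorted_list_of_set (visible D x)) \<in> labelled_points \<rightarrow>\<^sub>M count_space UNIV"
proof -
  let ?P = "labelled_points :: (enat \<times> (nat \<Rightarrow> 'a)) measure"
  have vis: "{x\<in>space ?P. i \<in> visible D x} \<in> sets ?P" for i
  proof -
    have [measurable]: "D \<in> sets borel" by fact
    have "{x\<in>space ?P. enat i < fst x \<and> snd x i \<in> D} \<in> sets ?P" by measurable
    then show ?thesis by (simp add: visible_def)
  qed
  have fin: "{x\<in>space ?P. finite (visible D x)} \<in> sets ?P"
  proof -
    have "{x\<in>space ?P. \<exists>m. \<forall>i. m < i \<longrightarrow> i \<notin> visible D x} \<in> sets ?P"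
      using vis by (intro sets.sets_Collect_countable_Ex sets.sets_Collect_countable_All
          sets.sets_Collect_imp sets.sets_Collect_neg sets.sets_Collect_const)
    moreover have "(\<exists>m. \<forall>i. m < i \<longrightarrow> i \<notin> visible D x) \<longleftrightarrow> finite (visible D x)" for x
      by (auto simp: finite_nat_set_iff_bounded_le) (meson not_le)+
    ultimately show ?thesis by simp
  qed
  have "{x\<in>space ?P. sorted_list_of_set (visible D x) = l} \<in> sets ?P" for l
  proof -
    \<comment> \<open>The enumeration of an infinite set is the empty list, which needs a case of its own.\<close>
    have eq: "sorted_list_of_set (visible D x) = l \<longleftrightarrow>
       (finite (visible D x) \<and> sorted l \<and> distinct l \<and>
           (\<forall>i. (i \<in> visible D x \<longrightarrow> i \<in> set l) \<and> (i \<in> set l \<longrightarrow> i \<in> visible D x))) \<or>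
           (\<not> finite (visible D x) \<and> l = [])" for x
    proof (cases "finite (visible D x)")
      case True
      then show ?thesis
        using sorted_list_of_set.idem_if_sorted_distinct[of l]
            sorted_list_of_set.set_sorted_key_list_of_set[of "visible D x"]
        by (auto simp: set_eq_iff) (metis set_eq_iff subsetI subset_antisym)+
    qed auto
    show ?thesis unfolding eq
      using vis fin by (intro sets.sets_Collect_disj sets.sets_Collect_conj
          sets.sets_Collect_countable_All sets.sets_Collect_imp sets.sets_Collect_neg
          sets.sets_Collect_const)
  qed
  then show ?thesis
    by (subst measurable_count_space_eq2_countable) (auto simp: vimage_def Int_def conj_commute)
qed

lemma measurable_shuffled:
  fixes D :: "'a::polish_space set"
  assumes D: "D \<in> sets borel"
  shows "(\<lambda>p. shuffled D (fst p) (snd p)) \<in> labelled_points \<Otimes>\<^sub>M unif \<rightarrow>\<^sub>M count_space UNIV"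
  unfolding shuffled_def Let_def
proof (rule measurable_compose_countable[where
    f="\<lambda>l p. permute_list (random_permutation (length l) (snd p)) l"])
  show "(\<lambda>p. permute_list (random_permutation (length l) (snd p)) l) \<in> labelled_points \<Otimes>\<^sub>M unif \<rightarrow>\<^sub>M
      count_space UNIV" for l :: "nat list"
    by (rule measurable_compose[OF measurable_compose[OF measurable_snd measurable_random_permutation]])
        simp
  show "(\<lambda>p. sorted_list_of_set (visible D (fst p))) \<in> labelled_points \<Otimes>\<^sub>M unif \<rightarrow>\<^sub>M count_space UNIV"
    by (rule measurable_compose[OF measurable_fst measurable_visible_list[OF D]])
qed

lemma sets_visible_counts:
  fixes D :: "'a::polish_space set" and m :: nat and n :: "nat \<Rightarrow> nat"
  assumes N: "N \<in> M \<rightarrow>\<^sub>M count_space UNIV" and S: "\<And>k. S k \<in> M \<rightarrow>\<^sub>M borel" and D: "D \<in> sets borel"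
    and E: "\<And>j. j < m \<Longrightarrow> E j \<in> sets borel"
  shows "{\<omega>\<in>space M. \<forall>j<m. emeasure (count_space UNIV) {i\<in>visible D (N \<omega>, \<lambda>k. S k \<omega>). S i \<omega> \<in> E j} =
      of_nat (n j)} \<in> sets M"
proof -
  have m: "(\<lambda>\<omega>. emeasure (count_space UNIV) {i\<in>visible D (N \<omega>, \<lambda>k. S k \<omega>). S i \<omega> \<in> E j}) \<in>
      borel_measurable M" if "j < m" for j
  proof -
    have "emeasure (count_space UNIV) {i\<in>visible D (N \<omega>, \<lambda>k. S k \<omega>). S i \<omega> \<in> E j} =
       (\<Sum>i. indicator {n. enat i < n} (N \<omega>) * indicator (D \<inter> E j) (S i \<omega>))" for \<omega>
    proof -
      have "emeasure (count_space UNIV) {i\<in>visible D (N \<omega>, \<lambda>k. S k \<omega>). S i \<omega> \<in> E j} =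
        (\<Sum>i. indicator {i\<in>visible D (N \<omega>, \<lambda>k. S k \<omega>). S i \<omega> \<in> E j} i)"
        by (simp flip: nn_integral_count_space_nat)
      also have "\<dots> = (\<Sum>i. indicator {n. enat i < n} (N \<omega>) * indicator (D \<inter> E j) (S i \<omega>))"
        by (rule suminf_cong) (auto simp: indicator_def visible_def)
      finally show ?thesis .
    qed
    moreover have "(\<lambda>\<omega>. \<Sum>i. indicator {n. enat i < n} (N \<omega>) * indicator (D \<inter> E j) (S i \<omega>) :: ennreal) \<in>
        borel_measurable M"
    proof -
      have [measurable]: "(\<lambda>\<omega>. indicator {n. enat i < n} (N \<omega>) :: ennreal) \<in> borel_measurable M" for i
        by (rule measurable_compose[OF N]) simp
      have [measurable]: "(\<lambda>\<omega>. indicator (D \<inter> E j) (S i \<omega>) :: ennreal) \<in> borel_measurable M" for i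
        by (rule measurable_compose[OF S borel_measurable_indicator]) (use D E[OF that] in auto)
      show ?thesis by measurable
    qed
    ultimately show ?thesis by simp
  qed
  have "{\<omega>\<in>space M. \<forall>j\<in>{..<m}. emeasure (count_space UNIV) {i\<in>visible D (N \<omega>, \<lambda>k. S k \<omega>). S i \<omega> \<in> E j} =
      of_nat (n j)} \<in> sets M"
  proof (rule sets.sets_Collect_finite_All)
    fix j assume "j \<in> {..<m}"
    then have "(\<lambda>\<omega>. emeasure (count_space UNIV) {i\<in>visible D (N \<omega>, \<lambda>k. S k \<omega>). S i \<omega> \<in> E j}) \<in>
        borel_measurable M"
      using m by simp
    then show "{\<omega>\<in>space M. emeasure (count_space UNIV) {i\<in>visible D (N \<omega>, \<lambda>k. S k \<omega>). S i \<omega> \<in> E j} =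
        of_nat (n j)} \<in> sets M"
      by measurable
  qed simp
  then show ?thesis by (simp only: Ball_def lessThan_iff)
qed

lemma measurable_map_list:
  fixes f :: "'i \<Rightarrow> 'w \<Rightarrow> 'c::countable"
  assumes "\<And>i. f i \<in> M \<rightarrow>\<^sub>M count_space UNIV"
  shows "(\<lambda>x. map (\<lambda>i. f i x) l) \<in> M \<rightarrow>\<^sub>M count_space UNIV"
proof (induction l)
  case (Cons a l)
  have "(\<lambda>x. f a x # map (\<lambda>i. f i x) l) \<in> M \<rightarrow>\<^sub>M count_space UNIV"
    by (rule measurable_compose_countable[where f="\<lambda>h x. h # map (\<lambda>i. f i x) l", OF _ assms])
       (rule measurable_compose[OF Cons], simp)
  then show ?case by simp
qed simp

lemma sum_count_superset:
  assumes "finite A" "set_mset X \<subseteq> A" shows "(\<Sum>a\<in>A. count X a) = size X"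
  unfolding size_multiset_overloaded_eq
  by (rule sum.mono_neutral_right) (use assms in \<open>auto simp: not_in_iff\<close>)

lemma sets_shuffled_event:
  fixes S :: "nat \<Rightarrow> 'w \<Rightarrow> 'a::polish_space"
  assumes N: "N \<in> M \<rightarrow>\<^sub>M count_space UNIV" and S: "\<And>k. S k \<in> M \<rightarrow>\<^sub>M borel"
    and D: "D \<in> sets borel" and E: "\<And>i. E i \<in> sets borel"
  shows "{p\<in>space (M \<Otimes>\<^sub>M unif).
       length (shuffled D (N (fst p), \<lambda>k. S k (fst p)) (snd p)) = k \<and>
       (\<forall>i<k. S (shuffled D (N (fst p), \<lambda>k. S k (fst p)) (snd p) ! i) (fst p) \<in> E i)} \<in> sets
           (M \<Otimes>\<^sub>M unif)"
proof -
  define X where "X \<omega> = (N \<omega>, \<lambda>k. S k \<omega>)" for \<omega>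
  have X: "X \<in> M \<rightarrow>\<^sub>M labelled_points" unfolding X_def[abs_def]
      by (rule measurable_labelled_points[OF N S])
  have shm: "(\<lambda>p. shuffled D (X (fst p)) (snd p)) \<in> M \<Otimes>\<^sub>M unif \<rightarrow>\<^sub>M count_space UNIV"
    using measurable_compose[OF measurable_Pair[OF measurable_compose[OF measurable_fst X]
        measurable_snd] measurable_shuffled[OF D]] by simp
  have "(\<lambda>p. (\<lambda>l p. length l = k \<and> (\<forall>i\<in>{..<k}. S (l ! i) (fst p) \<in> E i))
      (shuffled D (X (fst p)) (snd p)) p) \<in> M \<Otimes>\<^sub>M unif \<rightarrow>\<^sub>M count_space UNIV"
  proof (rule measurable_compose_countable[OF _ shm])
    fix l
    have "{p\<in>space (M \<Otimes>\<^sub>M unif). length l = k \<and> (\<forall>i\<in>{..<k}. S (l ! i) (fst p) \<in> E i)} \<in> sets (M \<Otimes>\<^sub>M unif)"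
    proof (intro sets.sets_Collect_conj sets.sets_Collect_finite_All sets.sets_Collect_const)
      fix i show "{p\<in>space (M \<Otimes>\<^sub>M unif). S (l ! i) (fst p) \<in> E i} \<in> sets (M \<Otimes>\<^sub>M unif)"
        using measurable_sets[OF measurable_compose[OF measurable_fst S[of "l ! i"]] E[of i], of unif]
        by (simp add: vimage_def Int_def conj_commute)
    qed auto
    then show "(\<lambda>p. length l = k \<and> (\<forall>i\<in>{..<k}. S (l ! i) (fst p) \<in> E i)) \<in> M \<Otimes>\<^sub>M unif \<rightarrow>\<^sub>M count_space
        UNIV"
      unfolding pred_def .
  qed
  then show ?thesis unfolding pred_def Ball_def lessThan_iff X_def .
qed

text \<open>
  The key step: in random order, the vertices in \<open>D\<close> are independent with law \<open>\<eta>\<close>, independently of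
  their number. Colour the points of \<open>D\<close> by the sets \<open>E i\<close> to which they belong. The unordered
  colours are the counts of a partition of \<open>D\<close>, whose probability contains a multinomial coefficient
  by \<open>counts\<close>; given the unordered colours, every ordered list of colours is equally likely by
  \<open>random_permutation_list\<close>, which cancels this coefficient. What remains is a product over the
  positions.
\<close>

lemma shuffled_law:
  fixes \<eta> :: "'a::polish_space measure" and S :: "nat \<Rightarrow> 'w \<Rightarrow> 'a"
  assumes M: "prob_space M" and N: "N \<in> M \<rightarrow>\<^sub>M count_space UNIV" and S: "\<And>k. S k \<in> M \<rightarrow>\<^sub>M borel"
    and D: "D \<in> sets borel" and fin: "AE \<omega> in M. finite (visible D (N \<omega>, \<lambda>k. S k \<omega>))"
    and \<eta>: "prob_space \<eta>" "sets \<eta> = sets borel" "measure \<eta> D = 1"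
    and counts: "\<And>(m::nat) Dj n. (\<forall>j<m. Dj j \<in> sets borel) \<Longrightarrow> disjoint_family_on Dj {..<m} \<Longrightarrow>
        (\<Union>j<m. Dj j) = D \<Longrightarrow>
      measure M {\<omega>\<in>space M. \<forall>j<m. emeasure (count_space UNIV)
          {i\<in>visible D (N \<omega>, \<lambda>k. S k \<omega>). S i \<omega> \<in> Dj j} = of_nat (n j)} =
      w (\<Sum>j<m. n j) * (\<Prod>j<m. measure \<eta> (Dj j) ^ n j / fact (n j))"
    and E: "\<And>i. E i \<in> sets borel"
  shows "measure (M \<Otimes>\<^sub>M unif) {p\<in>space (M \<Otimes>\<^sub>M unif).
       length (shuffled D (N (fst p), \<lambda>k. S k (fst p)) (snd p)) = k \<and>
       (\<forall>i<k. S (shuffled D (N (fst p), \<lambda>k. S k (fst p)) (snd p) ! i) (fst p) \<in> E i)}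
    = w k / fact k * (\<Prod>i<k. measure \<eta> (E i))"
proof -
  interpret prob_space M by fact
  interpret U: prob_space unif by (rule prob_space_uniform)
  interpret \<eta>: prob_space \<eta> by fact
  define X where "X \<omega> = (N \<omega>, \<lambda>k. S k \<omega>)" for \<omega>
  have X: "X \<in> M \<rightarrow>\<^sub>M labelled_points" unfolding X_def[abs_def]
      by (rule measurable_labelled_points[OF N S])
  \<comment> \<open>The colour of x encodes the set of all i < k with x in E i as a natural number below m.\<close>
  define m where "m = Suc (set_encode {..<k})"
  define col where "col x = set_encode {i. i < k \<and> x \<in> E i}" for x
  have col_lt: "col x < m" for x
    unfolding col_def m_def set_encode_def by (rule le_imp_less_Suc, rule sum_mono2) auto
  have col_dec: "i \<in> set_decode (col x) \<longleftrightarrow> x \<in> E i" if "i < k" for i x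
    using that by (simp add: col_def)
  have colm: "col \<in> borel \<rightarrow>\<^sub>M count_space UNIV"
  proof (rule measurable_count_space_eq2_countable[THEN iffD2], safe)
    fix j
    have "col x = j \<longleftrightarrow> set_decode j \<subseteq> {..<k} \<and> (\<forall>i<k. (x \<in> E i) = (i \<in> set_decode j))" for x
    proof
      assume "col x = j"
      then show "set_decode j \<subseteq> {..<k} \<and> (\<forall>i<k. (x \<in> E i) = (i \<in> set_decode j))"
        by (auto simp: col_def)
    next
      assume "set_decode j \<subseteq> {..<k} \<and> (\<forall>i<k. (x \<in> E i) = (i \<in> set_decode j))"
      then have "{i. i < k \<and> x \<in> E i} = set_decode j" by auto
      then show "col x = j" by (simp add: col_def)
    qed
    then have "col -` {j} \<inter> space borel =
        {x\<in>space borel. set_decode j \<subseteq> {..<k} \<and> (\<forall>i\<in>{..<k}. (x \<in> E i) = (i \<in> set_decode j))}"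
      by auto
    also have "\<dots> \<in> sets borel"
    proof (intro sets.sets_Collect_conj sets.sets_Collect_finite_All sets.sets_Collect_const)
      fix i show "{x\<in>space borel. (x \<in> E i) = (i \<in> set_decode j)} \<in> sets borel"
        using E[of i] by (cases "i \<in> set_decode j") (auto simp: Compl_eq[symmetric])
    qed auto
    finally show "col -` {j} \<inter> space borel \<in> sets borel" .
  qed auto
  define Dj where "Dj j = {x\<in>D. col x = j}" for j
  have Djm: "Dj j \<in> sets borel" for j
  proof -
    have "Dj j = D \<inter> (col -` {j} \<inter> space borel)" by (auto simp: Dj_def)
    then show ?thesis using D measurable_sets[OF colm, of "{j}"] by auto
  qed
  have Djpart: "disjoint_family_on Dj {..<m}" "(\<Union>j<m. Dj j) = D"
    using col_lt by (auto simp: Dj_def disjoint_family_on_def)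
  define vl where "vl \<omega> = sorted_list_of_set (visible D (X \<omega>))" for \<omega>
  define b where "b \<omega> = map (\<lambda>i. col (S i \<omega>)) (vl \<omega>)" for \<omega>
  have bm: "b \<in> M \<rightarrow>\<^sub>M count_space UNIV"
    unfolding b_def[abs_def]
  proof (rule measurable_compose_countable[where f="\<lambda>l \<omega>. map (\<lambda>i. col (S i \<omega>)) l"])
    show "(\<lambda>\<omega>. map (\<lambda>i. col (S i \<omega>)) l) \<in> M \<rightarrow>\<^sub>M count_space UNIV" for l
      by (rule measurable_map_list[where f="\<lambda>i \<omega>. col (S i \<omega>)", OF measurable_compose[OF S colm]])
    show "vl \<in> M \<rightarrow>\<^sub>M count_space UNIV"
      unfolding vl_def[abs_def] by (rule measurable_compose[OF X measurable_visible_list[OF D]])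
  qed
  have bsets: "{\<omega>\<in>space M. mset (b \<omega>) = Y} \<in> sets M" for Y
    using measurable_sets[OF bm, of "{l. mset l = Y}"] by (simp add: vimage_def Int_def conj_commute)
  \<comment> \<open>The assignments of colours to positions for which the event occurs.\<close>
  define Good where "Good = PiE {..<k} (\<lambda>i. {j\<in>{..<m}. i \<in> set_decode j})"
  have Gfin: "finite Good" unfolding Good_def by (intro finite_PiE) auto
  define L where "L c = map c [0..<k]" for c :: "nat \<Rightarrow> nat"
  define R where "R c = 1 / real (card (permutations_of_multiset (mset (L c))))" for c
  let ?A = "{p\<in>space (M \<Otimes>\<^sub>M unif). length (shuffled D (X (fst p)) (snd p)) = k \<and>
       (\<forall>i<k. S (shuffled D (X (fst p)) (snd p) ! i) (fst p) \<in> E i)}"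
  have Am: "?A \<in> sets (M \<Otimes>\<^sub>M unif)"
    unfolding X_def by (rule sets_shuffled_event[OF N S D E])
  let ?Ev = "\<lambda>c. {\<omega>\<in>space M. mset (b \<omega>) = mset (L c)}"
  have slice: "emeasure unif (Pair \<omega> -` ?A) = (\<Sum>c\<in>Good. ennreal (R c) * indicator (?Ev c) \<omega>)"
    if \<omega>: "\<omega> \<in> space M" for \<omega>
  proof (cases "length (vl \<omega>) = k")
    case False
    have 1: "Pair \<omega> -` ?A = {}" using False by (auto simp: length_shuffled vl_def)
    have 2: "mset (b \<omega>) \<noteq> mset (L c)" for c
    proof
      assume "mset (b \<omega>) = mset (L c)"
      then have "length (b \<omega>) = length (L c)" by (rule mset_eq_length)
      then show False using False by (simp add: b_def L_def)
    qed
    show ?thesis unfolding 1 by (simp add: 2)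
  next
    case True
    let ?g = "random_permutation k"
    have sh: "shuffled D (X \<omega>) u = permute_list (?g u) (vl \<omega>)" for u
      using True by (simp add: shuffled_def Let_def vl_def)
    have colsh: "map (\<lambda>i. col (S i \<omega>)) (shuffled D (X \<omega>) u) = permute_list (?g u) (b \<omega>)" for u
      unfolding sh b_def by (rule permute_list_map[symmetric])
          (simp add: True random_permutation_permutes)
    have len: "length (shuffled D (X \<omega>) u) = k" for u unfolding sh by (simp add: True)
    have set_eq: "Pair \<omega> -` ?A = (\<Union>c\<in>Good. {u. permute_list (?g u) (b \<omega>) = L c})"
    proof (intro set_eqI iffI)
      fix u assume "u \<in> Pair \<omega> -` ?A"
      then have a: "\<forall>i<k. S (shuffled D (X \<omega>) u ! i) \<omega> \<in> E i" by simp
      define c where "c = (\<lambda>i\<in>{..<k}. col (S (shuffled D (X \<omega>) u ! i) \<omega>))"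
      have "c \<in> Good" unfolding Good_def c_def using a col_dec col_lt by auto
      moreover have "permute_list (?g u) (b \<omega>) = L c"
        unfolding colsh[symmetric] L_def by (rule nth_equalityI) (auto simp: len c_def)
      ultimately show "u \<in> (\<Union>c\<in>Good. {u. permute_list (?g u) (b \<omega>) = L c})" by blast
    next
      fix u assume "u \<in> (\<Union>c\<in>Good. {u. permute_list (?g u) (b \<omega>) = L c})"
      then obtain c where c: "c \<in> Good" "map (\<lambda>i. col (S i \<omega>)) (shuffled D (X \<omega>) u) = L c"
          unfolding colsh by blast
      have "S (shuffled D (X \<omega>) u ! i) \<omega> \<in> E i" if "i < k" for i
      proof -
        have "col (S (shuffled D (X \<omega>) u ! i) \<omega>) = map (\<lambda>i. col (S i \<omega>)) (shuffled D (X \<omega>) u) ! i"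
          using that len by simp
        also have "\<dots> = c i" unfolding c(2) using that by (simp add: L_def)
        finally have "i \<in> set_decode (col (S (shuffled D (X \<omega>) u ! i) \<omega>))" using c(1) that
            by (auto simp: Good_def PiE_iff)
        then show ?thesis using col_dec[OF that] by simp
      qed
      then show "u \<in> Pair \<omega> -` ?A" using \<omega> len by (simp add: space_pair_measure)
    qed
    have pm: "{u. permute_list (?g u) (b \<omega>) = L c} \<in> sets unif" for c
      using measurable_sets[OF measurable_random_permutation[of k],
          of "{p. permute_list p (b \<omega>) = L c}"] by (simp add: vimage_def)
    have inj: "c = c'" if "c \<in> Good" "c' \<in> Good" "L c = L c'" for c c'
    proof (rule PiE_ext)
      show "c \<in> PiE {..<k} (\<lambda>i. {j\<in>{..<m}. i \<in> set_decode j})"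
          "c' \<in> PiE {..<k} (\<lambda>i. {j\<in>{..<m}. i \<in> set_decode j})"
        using that by (auto simp: Good_def)
      show "c i = c' i" if "i \<in> {..<k}" for i
      proof -
        have "L c ! i = L c' ! i" using \<open>L c = L c'\<close> by simp
        then show ?thesis using that by (simp add: L_def)
      qed
    qed
    have "emeasure unif (Pair \<omega> -` ?A) = (\<Sum>c\<in>Good. emeasure unif {u. permute_list (?g u) (b \<omega>) = L c})"
      unfolding set_eq
    proof (rule sum_emeasure[symmetric])
      show "disjoint_family_on (\<lambda>c. {u. permute_list (?g u) (b \<omega>) = L c}) Good"
        unfolding disjoint_family_on_def using inj by fastforce
    qed (use pm Gfin in auto)
    also have "\<dots> = (\<Sum>c\<in>Good. ennreal (R c) * indicator (?Ev c) \<omega>)"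
    proof (rule sum.cong[OF refl])
      fix c
      have "measure unif {u. permute_list (?g u) (b \<omega>) = L c} =
          (if mset (b \<omega>) = mset (L c) then R c else 0)"
        unfolding R_def
        by (rule random_permutation_list)
            (auto simp: b_def True measurable_random_permutation random_permutation_permutes
            random_permutation_uniform)
      then show "emeasure unif {u. permute_list (?g u) (b \<omega>) = L c} = ennreal (R c) *
          indicator (?Ev c) \<omega>"
        using \<omega> by (auto simp: U.emeasure_eq_measure indicator_def)
    qed
    finally show ?thesis .
  qed
  have Rnn: "0 \<le> R c" for c by (simp add: R_def)
  have cnt: "measure M (?Ev c) = w k *
      (\<Prod>j<m. measure \<eta> (Dj j) ^ count (mset (L c)) j / fact (count (mset (L c)) j))"
    if c: "c \<in> Good" for c
  proof -
    have Lm: "set_mset (mset (L c)) \<subseteq> {..<m}" using c by (auto simp: L_def Good_def PiE_iff)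
    have sumk: "(\<Sum>j<m. count (mset (L c)) j) = k"
      using sum_count_superset[OF _ Lm] by (simp add: L_def)
    let ?Ct = "{\<omega>\<in>space M. \<forall>j<m. emeasure (count_space UNIV) {i\<in>visible D (X \<omega>). S i \<omega> \<in> Dj j} =
        of_nat (count (mset (L c)) j)}"
    have "measure M (?Ev c) =
       measure M ?Ct"
    proof (rule measure_eq_AE)
      show "AE \<omega> in M. (\<omega> \<in> (?Ev c)) = (\<omega> \<in> ?Ct)"
        using fin
      proof (rule AE_mp, intro AE_I2 impI)
        fix \<omega> assume \<omega>: "\<omega> \<in> space M" and "finite (visible D (N \<omega>, \<lambda>k. S k \<omega>))"
        then have f: "finite (visible D (X \<omega>))" by (simp add: X_def)
        have cb: "count (mset (b \<omega>)) j = card {i\<in>visible D (X \<omega>). S i \<omega> \<in> Dj j}" for j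
        proof -
          have "mset (b \<omega>) = image_mset (\<lambda>i. col (S i \<omega>)) (mset_set (visible D (X \<omega>)))"
            using mset_set_set[of "vl \<omega>"] f by (simp add: b_def vl_def)
          then have "count (mset (b \<omega>)) j = card {i\<in>visible D (X \<omega>). col (S i \<omega>) = j}"
            using f by (simp add: count_image_mset vimage_def Int_def conj_commute)
          also have "{i\<in>visible D (X \<omega>). col (S i \<omega>) = j} = {i\<in>visible D (X \<omega>). S i \<omega> \<in> Dj j}"
            by (auto simp: visible_def X_def Dj_def)
          finally show ?thesis .
        qed
        have bm: "set_mset (mset (b \<omega>)) \<subseteq> {..<m}" using col_lt by (auto simp: b_def)
        have "mset (b \<omega>) = mset (L c) \<longleftrightarrow> (\<forall>j<m. count (mset (b \<omega>)) j = count (mset (L c)) j)"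
        proof
          assume a: "\<forall>j<m. count (mset (b \<omega>)) j = count (mset (L c)) j"
          show "mset (b \<omega>) = mset (L c)"
          proof (rule multiset_eqI)
            fix j show "count (mset (b \<omega>)) j = count (mset (L c)) j"
            proof (cases "j < m")
              case False
              then have "j \<notin># mset (b \<omega>)" "j \<notin># mset (L c)" using bm Lm by auto
              then show ?thesis by (simp only: not_in_iff)
            qed (use a in simp)
          qed
        qed simp
        then show "(\<omega> \<in> (?Ev c)) = (\<omega> \<in> ?Ct)"
          using \<omega> f unfolding cb by (simp add: emeasure_count_space_finite)
      qed
      show "?Ct \<in> sets M"
        unfolding X_def by (rule sets_visible_counts[OF N S D]) (rule Djm)
    qed (rule bsets)
    also have "\<dots> = w (\<Sum>j<m. count (mset (L c)) j) *
        (\<Prod>j<m. measure \<eta> (Dj j) ^ count (mset (L c)) j / fact (count (mset (L c)) j))"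
      unfolding X_def by (rule counts) (use Djm Djpart in auto)
    finally show ?thesis unfolding sumk .
  qed
  have trm: "R c * measure M (?Ev c) = w k / fact k * (\<Prod>i<k. measure \<eta> (Dj (c i)))"
    if c: "c \<in> Good" for c
  proof -
    have Lm: "set_mset (mset (L c)) \<subseteq> {..<m}" using c by (auto simp: L_def Good_def PiE_iff)
    have perm: "real (card (permutations_of_multiset (mset (L c)))) *
        (\<Prod>a<m. fact (count (mset (L c)) a)) = fact k"
      using card_permutations_of_multiset_superset[OF _ Lm] by (simp add: L_def)
    have "(\<Prod>j<m. measure \<eta> (Dj j) ^ count (mset (L c)) j) =
        prod_list (map (\<lambda>j. measure \<eta> (Dj j)) (L c))"
      using prod_list_eq_prod_count[of "{..<m}" "L c" "\<lambda>j. measure \<eta> (Dj j)"] Lm by simp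
    also have "\<dots> = (\<Prod>i<k. measure \<eta> (Dj (c i)))"
      by (simp add: L_def prod.list_conv_set_nth atLeast0LessThan)
    finally have p: "(\<Prod>j<m. measure \<eta> (Dj j) ^ count (mset (L c)) j) = (\<Prod>i<k. measure \<eta> (Dj (c i)))" .
    have "R c * measure M (?Ev c) =
       w k * (\<Prod>i<k. measure \<eta> (Dj (c i))) / (real (card (permutations_of_multiset (mset (L c)))) *
           (\<Prod>a<m. fact (count (mset (L c)) a)))"
      unfolding cnt[OF c] R_def prod_dividef p by simp
    then show ?thesis unfolding perm by simp
  qed
  have "emeasure (M \<Otimes>\<^sub>M unif) ?A = (\<integral>\<^sup>+\<omega>. emeasure unif (Pair \<omega> -` ?A) \<partial>M)"
    by (rule U.emeasure_pair_measure_alt[OF Am])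
  also have "\<dots> = (\<integral>\<^sup>+\<omega>. (\<Sum>c\<in>Good. ennreal (R c) * indicator (?Ev c) \<omega>) \<partial>M)"
    by (rule nn_integral_cong) (rule slice)
  also have "\<dots> = (\<Sum>c\<in>Good. ennreal (R c) * emeasure M (?Ev c))"
    by (subst nn_integral_sum) (auto intro!: borel_measurable_times_ennreal borel_measurable_indicator
        bsets nn_integral_cmult_indicator sum.cong)
  also have "\<dots> = (\<Sum>c\<in>Good. ennreal (R c * measure M (?Ev c)))"
    by (intro sum.cong refl) (simp add: emeasure_eq_measure ennreal_mult Rnn)
  also have "\<dots> = ennreal (\<Sum>c\<in>Good. R c * measure M (?Ev c))"
    by (rule sum_ennreal) (simp add: Rnn)
  finally have "measure (M \<Otimes>\<^sub>M unif) ?A = (\<Sum>c\<in>Good. R c * measure M (?Ev c))"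
    by (rule measure_eq_emeasure_eq_ennreal[rotated]) (auto intro!: sum_nonneg simp: Rnn)
  also have "\<dots> = (\<Sum>c\<in>Good. w k / fact k * (\<Prod>i<k. measure \<eta> (Dj (c i))))"
    by (rule sum.cong[OF refl trm])
  also have "\<dots> = w k / fact k * (\<Prod>i<k. \<Sum>j\<in>{j\<in>{..<m}. i \<in> set_decode j}. measure \<eta> (Dj j))"
    unfolding sum_distrib_left[symmetric] Good_def by (subst prod_sum_PiE) auto
  also have "(\<Prod>i<k. \<Sum>j\<in>{j\<in>{..<m}. i \<in> set_decode j}. measure \<eta> (Dj j)) = (\<Prod>i<k. measure \<eta> (E i))"
  proof (rule prod.cong[OF refl])
    fix i assume i: "i \<in> {..<k}"
    have "(\<Sum>j\<in>{j\<in>{..<m}. i \<in> set_decode j}. measure \<eta> (Dj j)) =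
        measure \<eta> (\<Union>j\<in>{j\<in>{..<m}. i \<in> set_decode j}. Dj j)"
      by (rule \<eta>.finite_measure_finite_Union[symmetric])
          (use Djm \<eta>(2) in \<open>auto simp: Dj_def disjoint_family_on_def\<close>)
    also have "(\<Union>j\<in>{j\<in>{..<m}. i \<in> set_decode j}. Dj j) = E i \<inter> D"
      using i col_dec col_lt by (auto simp: Dj_def)
    also have "measure \<eta> (E i \<inter> D) = measure \<eta> (E i)"
    proof (rule measure_eq_AE)
      have "AE x in \<eta>. x \<in> D" using \<eta>.prob_eq_1[of D] \<eta>(2,3) D by simp
      then show "AE x in \<eta>. (x \<in> E i \<inter> D) = (x \<in> E i)" by eventually_elim auto
    qed (use E D \<eta>(2) in auto)
    finally show "(\<Sum>j\<in>{j\<in>{..<m}. i \<in> set_decode j}. measure \<eta> (Dj j)) = measure \<eta> (E i)" .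
  qed
  finally show ?thesis unfolding X_def .
qed

text \<open>
  The vertices listed in \<open>l\<close> come first; the fresh locations \<open>t\<close> then continue them to an infinite
  sequence.
\<close>

definition relocated :: "nat list \<Rightarrow> (nat \<Rightarrow> 'a) \<Rightarrow> (nat \<Rightarrow> 'a) \<Rightarrow> nat \<Rightarrow> 'a" where
  "relocated l s t i = (if i < length l then s (l ! i) else t i)"

lemma measurable_relocated:
  fixes S :: "nat \<Rightarrow> 'w \<Rightarrow> 'a::polish_space"
  assumes l: "l \<in> M \<rightarrow>\<^sub>M count_space UNIV" and S: "\<And>k. S k \<in> M \<rightarrow>\<^sub>M borel" and T: "\<And>k. T k \<in> M \<rightarrow>\<^sub>M borel"
  shows "(\<lambda>\<omega>. relocated (l \<omega>) (\<lambda>k. S k \<omega>) (\<lambda>k. T k \<omega>) i) \<in> M \<rightarrow>\<^sub>M borel"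
proof (rule measurable_compose_countable[OF _ l])
  fix l' show "(\<lambda>\<omega>. relocated l' (\<lambda>k. S k \<omega>) (\<lambda>k. T k \<omega>) i) \<in> M \<rightarrow>\<^sub>M borel"
    unfolding relocated_def using S T by (cases "i < length l'") auto
qed

text \<open>
  On boxes the law of the sequence factorizes at position \<open>k\<close>: \<open>shuffled_law\<close> covers the positions
  below \<open>k\<close>, the others carry fresh locations. Boxes determine the conditional law given the number
  \<open>k\<close> of vertices.
\<close>

lemma relocated_law:
  fixes \<eta> :: "'a::polish_space measure" and S :: "nat \<Rightarrow> 'w \<Rightarrow> 'a"
  assumes M: "prob_space M" and N: "N \<in> M \<rightarrow>\<^sub>M count_space UNIV" and S: "\<And>k. S k \<in> M \<rightarrow>\<^sub>M borel"
    and D: "D \<in> sets borel" and fin: "AE \<omega> in M. finite (visible D (N \<omega>, \<lambda>k. S k \<omega>))"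
    and \<eta>: "prob_space \<eta>" "sets \<eta> = sets borel" "measure \<eta> D = 1"
    and counts: "\<And>(m::nat) Dj n. (\<forall>j<m. Dj j \<in> sets borel) \<Longrightarrow> disjoint_family_on Dj {..<m} \<Longrightarrow>
        (\<Union>j<m. Dj j) = D \<Longrightarrow>
      measure M {\<omega>\<in>space M. \<forall>j<m. emeasure (count_space UNIV)
          {i\<in>visible D (N \<omega>, \<lambda>k. S k \<omega>). S i \<omega> \<in> Dj j} = of_nat (n j)} =
      w (\<Sum>j<m. n j) * (\<Prod>j<m. measure \<eta> (Dj j) ^ n j / fact (n j))"
  defines "Q \<equiv> iid_seq \<eta>"
  defines "Y \<equiv> M \<Otimes>\<^sub>M (unif \<Otimes>\<^sub>M Q)"
  defines "sh \<equiv> \<lambda>y :: 'w \<times> real \<times> (nat \<Rightarrow> 'a). shuffled D (N (fst y), \<lambda>k. S k (fst y)) (fst (snd y))"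
  assumes H: "H \<in> sets Q"
  shows "emeasure Y {y\<in>space Y. length (sh y) = k \<and>
      (\<lambda>i. relocated (sh y) (\<lambda>k. S k (fst y)) (snd (snd y)) i) \<in> H} =
    emeasure Y {y\<in>space Y. length (sh y) = k} * emeasure Q H"
proof -
  interpret prob_space M by fact
  interpret U: prob_space unif by (rule prob_space_uniform)
  interpret \<eta>: prob_space \<eta> by fact
  interpret Q: prob_space Q unfolding Q_def by (rule prob_space_PiM) (rule \<eta>)
  interpret MU: prob_space "M \<Otimes>\<^sub>M unif" by (rule prob_space_pair) unfold_locales
  have Yp: "prob_space Y" unfolding Y_def by (intro prob_space_pair) unfold_locales
  interpret Y: prob_space Y by (rule Yp)
  have shm: "sh \<in> Y \<rightarrow>\<^sub>M count_space UNIV"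
  proof -
    have "(\<lambda>y. (\<lambda>p. shuffled D (fst p) (snd p)) ((N (fst y), \<lambda>k. S k (fst y)), fst (snd y))) \<in> Y \<rightarrow>\<^sub>M
        count_space UNIV"
      unfolding Y_def
      by (rule measurable_compose[OF measurable_Pair[OF
          measurable_compose[OF measurable_fst measurable_labelled_points[OF N S]]
          measurable_compose[OF measurable_snd measurable_fst]] measurable_shuffled[OF D]])
    then show ?thesis by (simp add: sh_def[abs_def])
  qed
  have Q\<eta>: "(\<lambda>s. s i) \<in> Q \<rightarrow>\<^sub>M borel" for i
    using measurable_component_singleton[of i UNIV "\<lambda>_. \<eta>"] measurable_cong_sets[OF refl \<eta>(2), of Q]
        unfolding Q_def by simp
  let ?T = "\<lambda>i y. relocated (sh y) (\<lambda>k. S k (fst y)) (\<lambda>k. snd (snd y) k) i"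
  have Tm: "?T i \<in> Y \<rightarrow>\<^sub>M borel" for i
  proof (rule measurable_relocated[OF shm])
    show "(\<lambda>y. S k (fst y)) \<in> Y \<rightarrow>\<^sub>M borel" for k unfolding Y_def
        by (rule measurable_compose[OF measurable_fst S])
    show "(\<lambda>y. snd (snd y) k) \<in> Y \<rightarrow>\<^sub>M borel" for k
      unfolding Y_def
          by (rule measurable_compose[OF measurable_snd measurable_compose[OF measurable_snd Q\<eta>]])
  qed
  have TQ: "(\<lambda>y i. ?T i y) \<in> Y \<rightarrow>\<^sub>M Q"
    unfolding Q_def by (rule measurable_PiM_single')
        (use Tm \<eta>(2) sets_eq_imp_space_eq[OF \<eta>(2)] in \<open>auto simp: measurable_cong_sets[OF refl \<eta>(2)]\<close>)
  let ?A0 = "{y\<in>space Y. length (sh y) = k}"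
  have A0: "?A0 \<in> sets Y"
    using measurable_sets[OF shm, of "{l. length l = k}"] by (simp add: vimage_def Int_def conj_commute)
  have box: "emeasure Y {y\<in>space Y. length (sh y) = k \<and> (\<forall>j\<in>J. ?T j y \<in> F j)} = ennreal (w k / fact k) *
      (\<Prod>j\<in>J. emeasure \<eta> (F j))"
    if J: "finite J" and F: "\<And>j. F j \<in> sets \<eta>" and nn: "w k / fact k \<ge> 0" for J F
  proof -
    define G where "G i = (if i \<in> J then F i else UNIV)" for i
    have G: "G i \<in> sets borel" for i using F \<eta>(2) by (auto simp: G_def)
    let ?A = "{p\<in>space (M \<Otimes>\<^sub>M unif).
       length (shuffled D (N (fst p), \<lambda>k. S k (fst p)) (snd p)) = k \<and>
       (\<forall>i<k. S (shuffled D (N (fst p), \<lambda>k. S k (fst p)) (snd p) ! i) (fst p) \<in> G i)}"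
    let ?B = "{s\<in>space Q. \<forall>j\<in>J - {..<k}. s j \<in> F j}"
    have A: "?A \<in> sets (M \<Otimes>\<^sub>M unif)" by (rule sets_shuffled_event[OF N S D G])
    have B: "?B \<in> sets Q"
    proof (rule sets.sets_Collect_finite_All)
      fix i show "{s\<in>space Q. s i \<in> F i} \<in> sets Q"
        using measurable_sets[OF Q\<eta>, of "F i" i] F[of i] \<eta>(2)
            by (simp add: vimage_def Int_def conj_commute)
    qed (use J in auto)
    have mp: "measure_preserving Y ((M \<Otimes>\<^sub>M unif) \<Otimes>\<^sub>M Q) (\<lambda>(x, y, z). ((x, y), z))"
      unfolding Y_def by (rule measure_preserving_assoc) unfold_locales
    have eq: "{y\<in>space Y. length (sh y) = k \<and> (\<forall>j\<in>J. ?T j y \<in> F j)} =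
        (\<lambda>(x, y, z). ((x, y), z)) -` (?A \<times> ?B) \<inter> space Y"
    proof -
      have "(\<forall>j\<in>J. ?T j y \<in> F j) \<longleftrightarrow> (\<forall>i<k. S (sh y ! i) (fst y) \<in> G i) \<and>
          (\<forall>j\<in>J - {..<k}. snd (snd y) j \<in> F j)"
        if "length (sh y) = k" for y using that by (auto simp: relocated_def G_def)
      note iff = this
      show ?thesis
      proof (intro set_eqI)
        fix y
        have "y \<in> (\<lambda>(x, y, z). ((x, y), z)) -` (?A \<times> ?B) \<inter> space Y \<longleftrightarrow>
          y \<in> space Y \<and> length (sh y) = k \<and> (\<forall>i<k. S (sh y ! i) (fst y) \<in> G i) \<and>
              (\<forall>j\<in>J - {..<k}. snd (snd y) j \<in> F j)"
          unfolding sh_def by (cases y) (simp add: Y_def space_pair_measure, blast)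
        then show "y \<in> {y\<in>space Y. length (sh y) = k \<and> (\<forall>j\<in>J. ?T j y \<in> F j)} \<longleftrightarrow>
           y \<in> (\<lambda>(x, y, z). ((x, y), z)) -` (?A \<times> ?B) \<inter> space Y"
          using iff[of y] by blast
      qed
    qed
    have "emeasure Y {y\<in>space Y. length (sh y) = k \<and> (\<forall>j\<in>J. ?T j y \<in> F j)} =
        emeasure ((M \<Otimes>\<^sub>M unif) \<Otimes>\<^sub>M Q) (?A \<times> ?B)"
    proof -
      have 1: "(\<lambda>(x, y, z). ((x, y), z)) \<in> Y \<rightarrow>\<^sub>M (M \<Otimes>\<^sub>M unif) \<Otimes>\<^sub>M Q"
        and 2: "distr Y ((M \<Otimes>\<^sub>M unif) \<Otimes>\<^sub>M Q) (\<lambda>(x, y, z). ((x, y), z)) = (M \<Otimes>\<^sub>M unif) \<Otimes>\<^sub>M Q"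
        using mp by (auto simp: measure_preserving_def)
      show ?thesis using emeasure_distr[OF 1 pair_measureI[OF A B]] unfolding 2 eq by (rule sym)
    qed
    also have "\<dots> = emeasure (M \<Otimes>\<^sub>M unif) ?A * emeasure Q ?B"
        by (rule Q.emeasure_pair_measure_Times[OF A B])
    also have "emeasure (M \<Otimes>\<^sub>M unif) ?A = ennreal (w k / fact k * (\<Prod>i<k. measure \<eta> (G i)))"
      unfolding MU.emeasure_eq_measure by (subst shuffled_law[OF M N S D fin \<eta> counts G]) auto
    also have "(\<Prod>i<k. measure \<eta> (G i)) = (\<Prod>j\<in>J \<inter> {..<k}. measure \<eta> (F j))"
    proof -
      have "(\<Prod>j\<in>J \<inter> {..<k}. measure \<eta> (F j)) = (\<Prod>j\<in>J \<inter> {..<k}. measure \<eta> (G j))"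
          by (rule prod.cong) (auto simp: G_def)
      also have "\<dots> = (\<Prod>i<k. measure \<eta> (G i))"
        by (rule prod.mono_neutral_left)
            (use \<eta>.prob_space sets_eq_imp_space_eq[OF \<eta>(2)] in \<open>auto simp: G_def\<close>)
      finally show ?thesis by simp
    qed
    also have "ennreal (w k / fact k * (\<Prod>j\<in>J \<inter> {..<k}. measure \<eta> (F j))) = ennreal (w k / fact k) *
        (\<Prod>j\<in>J \<inter> {..<k}. emeasure \<eta> (F j))"
    proof -
      have "ennreal (w k / fact k * (\<Prod>j\<in>J \<inter> {..<k}. measure \<eta> (F j))) = ennreal (w k / fact k) *
          ennreal (\<Prod>j\<in>J \<inter> {..<k}. measure \<eta> (F j))"
        by (rule ennreal_mult[OF nn]) (simp add: prod_nonneg)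
      then show ?thesis by (simp add: \<eta>.emeasure_eq_measure prod_ennreal)
    qed
    also have "emeasure Q ?B = (\<Prod>j\<in>J - {..<k}. emeasure \<eta> (F j))"
      unfolding Q_def by (rule seq_box_emeasure[OF \<eta>(1)]) (use J F in auto)
    also have "ennreal (w k / fact k) * (\<Prod>j\<in>J \<inter> {..<k}. emeasure \<eta> (F j)) *
        (\<Prod>j\<in>J - {..<k}. emeasure \<eta> (F j)) =
      ennreal (w k / fact k) * (\<Prod>j\<in>J. emeasure \<eta> (F j))"
      using prod.Int_Diff[OF J, of "\<lambda>j. emeasure \<eta> (F j)" "{..<k}"] by (simp add: mult.assoc)
    finally show ?thesis .
  qed
  have nn: "w k / fact k \<ge> 0"
  proof -
    have "measure \<eta> UNIV = 1" using \<eta>.prob_space sets_eq_imp_space_eq[OF \<eta>(2)] by simp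
    then have 1: "w k / fact k = w k / fact k * (\<Prod>i<k. measure \<eta> UNIV)" by simp
    show ?thesis by (subst 1, subst shuffled_law[OF M N S D fin \<eta> counts, symmetric]) auto
  qed
  have eA0: "emeasure Y ?A0 = ennreal (w k / fact k)"
    using box[of "{}" "\<lambda>_. UNIV"] nn \<eta>(2) by simp
  show ?thesis
  proof (cases "w k / fact k = 0")
    case True
    have "emeasure Y {y\<in>space Y. length (sh y) = k \<and>
        (\<lambda>i. relocated (sh y) (\<lambda>k. S k (fst y)) (snd (snd y)) i) \<in> H} \<le> emeasure Y ?A0"
      using A0 by (intro emeasure_mono) auto
    then show ?thesis unfolding eA0 True by simp
  next
    case False
    define c where "c = emeasure Y ?A0"
    have c: "c \<noteq> 0" "c \<noteq> \<top>" using False nn eA0 by (auto simp: c_def ennreal_eq_0_iff)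
    let ?M' = "distr (uniform_measure Y ?A0) Q (\<lambda>y i. ?T i y)"
    have TQ': "(\<lambda>y i. ?T i y) \<in> uniform_measure Y ?A0 \<rightarrow>\<^sub>M Q" using TQ by (simp add: measurable_def)
    have em: "emeasure ?M' G = emeasure Y {y\<in>space Y. length (sh y) = k \<and> (\<lambda>i. ?T i y) \<in> G} / c" if G:
        "G \<in> sets Q" for G
    proof -
      have "emeasure ?M' G = emeasure (uniform_measure Y ?A0) ((\<lambda>y i. ?T i y) -` G \<inter> space Y)"
        using emeasure_distr[OF TQ' G] by simp
      also have "\<dots> = emeasure Y (?A0 \<inter> ((\<lambda>y i. ?T i y) -` G \<inter> space Y)) / c"
        unfolding c_def by (rule emeasure_uniform_measure[OF A0 measurable_sets[OF TQ G]])
      also have "?A0 \<inter> ((\<lambda>y i. ?T i y) -` G \<inter> space Y) =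
          {y\<in>space Y. length (sh y) = k \<and> (\<lambda>i. ?T i y) \<in> G}" by auto
      finally show ?thesis .
    qed
    have "?M' = Q"
      unfolding Q_def
    proof (rule seq_eqI[OF \<eta>(1)], goal_cases)
      case (2 J F)
      have GQ: "{u\<in>space Q. \<forall>j\<in>J. u j \<in> F j} \<in> sets Q"
      proof (rule sets.sets_Collect_finite_All[OF _ 2(1)])
        fix i show "{s\<in>space Q. s i \<in> F i} \<in> sets Q"
          using measurable_sets[OF Q\<eta>, of "F i" i] 2(2)[of i] \<eta>(2)
              by (simp add: vimage_def Int_def conj_commute)
      qed
      have sp: "(\<lambda>i. ?T i y) \<in> space Q" if "y \<in> space Y" for y using measurable_space[OF TQ that] .
      have "emeasure ?M' {u\<in>space ?M'. \<forall>j\<in>J. u j \<in> F j} = emeasure ?M' {u\<in>space Q. \<forall>j\<in>J. u j \<in> F j}"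
          by simp
      also have "\<dots> = emeasure Y {y\<in>space Y. length (sh y) = k \<and>
          (\<lambda>i. ?T i y) \<in> {u\<in>space Q. \<forall>j\<in>J. u j \<in> F j}} / c"
        by (rule em[OF GQ])
      also have "{y\<in>space Y. length (sh y) = k \<and> (\<lambda>i. ?T i y) \<in> {u\<in>space Q. \<forall>j\<in>J. u j \<in> F j}} =
          {y\<in>space Y. length (sh y) = k \<and> (\<forall>j\<in>J. ?T j y \<in> F j)}"
        using sp by auto
      also have "emeasure Y \<dots> / c = (c * (\<Prod>j\<in>J. emeasure \<eta> (F j))) / c"
        unfolding c_def eA0 by (subst box[OF 2 nn]) simp
      also have "\<dots> = (\<Prod>j\<in>J. emeasure \<eta> (F j))"
        using c by (simp add: mult.commute[of c] ennreal_mult_divide_eq)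
      finally show ?case unfolding Q_def .
    qed (simp add: Q_def)
    then have "emeasure Q H = emeasure Y {y\<in>space Y. length (sh y) = k \<and> (\<lambda>i. ?T i y) \<in> H} / c"
      using em[OF H] by simp
    then have "c * emeasure Q H = emeasure Y {y\<in>space Y. length (sh y) = k \<and> (\<lambda>i. ?T i y) \<in> H}"
      using c by (simp add: ennreal_times_divide mult.commute[of c] ennreal_mult_divide_eq)
    then show ?thesis unfolding c_def by simp
  qed
qed

section \<open>Edges between shuffled vertices\<close>

text \<open>
  The conditional Bernoulli property only speaks of pairs \<open>i < j\<close>. Reading every edge at the
  increasing pair makes the relabelled edges symmetric and irreflexive everywhere, even where the
  given ones are not.
\<close>

definition relabelled_edge ::
  "('a \<Rightarrow> 'a \<Rightarrow> real) \<Rightarrow> (nat \<Rightarrow> nat \<Rightarrow> bool) \<Rightarrow> nat list \<Rightarrow> (nat \<Rightarrow> 'a) \<Rightarrow> (nat \<Rightarrow> real) \<Rightarrow> nat \<Rightarrow> nat \<Rightarrow> bool"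
      where
  "relabelled_edge W a l t v i j \<longleftrightarrow> i \<noteq> j \<and>
     (if max i j < length l then a (min (l ! i) (l ! j)) (max (l ! i) (l ! j))
      else v (prod_encode (min i j, max i j)) < W (t (min i j)) (t (max i j)))"

lemma emeasure_unif_lessThan:
  assumes "0 \<le> t" "t \<le> 1" shows "emeasure unif {v. (v < t) = b} = ennreal (if b then t else 1 - t)"
proof -
  have "emeasure unif {v. (v < t) = b} = emeasure lborel ({0..1} \<inter> {v. (v < t) = b})"
    by (subst emeasure_uniform_measure) (simp_all add: ennreal_div_one)
  also have "{0..1} \<inter> {v. (v < t) = b} = (if b then {0..<t} else {t..1})" using assms by auto
  also have "emeasure lborel \<dots> = ennreal (if b then t else 1 - t)" using assms by simp
  finally show ?thesis .
qed

text \<open>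
  Integrate the coins first: they are independent uniform variables, and the thresholds are fixed by
  the other factor.
\<close>

lemma fresh_coins:
  assumes Y: "prob_space Y" and F: "finite F" and \<psi>: "\<psi> \<in> borel_measurable Y"
    and t: "\<And>e. t e \<in> borel_measurable Y" "\<And>e y. 0 \<le> t e y" "\<And>e y. t e y \<le> 1"
  shows "(\<integral>\<^sup>+z. \<psi> (fst z) * indicator {z\<in>space (Y \<Otimes>\<^sub>M unifs). \<forall>e\<in>F. (snd z (prod_encode e) < t e (fst z))
      = b e} z \<partial>(Y \<Otimes>\<^sub>M unifs)) =
    (\<integral>\<^sup>+y. \<psi> y * ennreal (\<Prod>e\<in>F. if b e then t e y else 1 - t e y) \<partial>Y)"
proof -
  have u: "prob_space unif" by (rule prob_space_uniform)
  interpret Us: prob_space unifs by (rule prob_space_PiM) (rule u)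
  let ?B = "{z\<in>space (Y \<Otimes>\<^sub>M unifs). \<forall>e\<in>F. (snd z (prod_encode e) < t e (fst z)) = b e}"
  have B: "?B \<in> sets (Y \<Otimes>\<^sub>M unifs)"
  proof (rule sets.sets_Collect_finite_All[OF _ F])
    fix e
    have [measurable]: "t e \<in> borel_measurable Y" by (rule t)
    have [measurable]: "(\<lambda>z. snd z (prod_encode e)) \<in> Y \<Otimes>\<^sub>M unifs \<rightarrow>\<^sub>M borel"
      using measurable_compose[OF measurable_snd measurable_component_singleton[of "prod_encode e" UNIV
          "\<lambda>_. unif"], of Y] by simp
    have "{z\<in>space (Y \<Otimes>\<^sub>M unifs). snd z (prod_encode e) < t e (fst z)} \<in> sets (Y \<Otimes>\<^sub>M unifs)" by measurable
    from sets.sets_Collect_neg[OF this] this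
    show "{z\<in>space (Y \<Otimes>\<^sub>M unifs). (snd z (prod_encode e) < t e (fst z)) = b e} \<in> sets (Y \<Otimes>\<^sub>M unifs)"
      by (cases "b e") simp_all
  qed
  have m: "(\<lambda>z. \<psi> (fst z) * indicator ?B z) \<in> borel_measurable (Y \<Otimes>\<^sub>M unifs)"
    by (rule borel_measurable_times_ennreal[OF measurable_compose[OF measurable_fst \<psi>]
        borel_measurable_indicator[OF B]])
  have "(\<integral>\<^sup>+z. \<psi> (fst z) * indicator ?B z \<partial>(Y \<Otimes>\<^sub>M unifs)) =
      (\<integral>\<^sup>+y. \<integral>\<^sup>+v. \<psi> y * indicator ?B (y, v) \<partial>unifs \<partial>Y)"
    using Us.nn_integral_fst[OF m] by simp
  also have "\<dots> = (\<integral>\<^sup>+y. \<psi> y * ennreal (\<Prod>e\<in>F. if b e then t e y else 1 - t e y) \<partial>Y)"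
  proof (rule nn_integral_cong)
    fix y assume y: "y \<in> space Y"
    let ?C = "{v\<in>space unifs. \<forall>n\<in>prod_encode ` F. v n \<in> {x. (x < t (prod_decode n) y) =
        b (prod_decode n)}}"
    have C: "?C \<in> sets unifs"
    proof -
      have "Pair y -` ?B = ?C" using y by (auto simp: space_pair_measure)
      then show ?thesis using sets_Pair1[OF B, of y] by simp
    qed
    have sm: "{x. (x < c) = d} \<in> sets borel" for c :: real and d
      by (cases d) (simp_all add: not_less flip: lessThan_def atLeast_def)
    have "(\<integral>\<^sup>+v. \<psi> y * indicator ?B (y, v) \<partial>unifs) = (\<integral>\<^sup>+v. \<psi> y * indicator ?C v \<partial>unifs)"
      by (rule nn_integral_cong) (use y in \<open>auto simp: indicator_def space_pair_measure\<close>)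
    also have "\<dots> = \<psi> y * emeasure unifs ?C" by (rule nn_integral_cmult_indicator[OF C])
    also have "emeasure unifs ?C = (\<Prod>n\<in>prod_encode ` F. emeasure unif {x. (x < t (prod_decode n) y) =
        b (prod_decode n)})"
      by (rule seq_box_emeasure[OF u]) (use F sm in auto)
    also have "\<dots> = (\<Prod>e\<in>F. emeasure unif {x. (x < t e y) = b e})"
      by (subst prod.reindex) (auto intro: inj_prod_encode)
    also have "\<dots> = (\<Prod>e\<in>F. ennreal (if b e then t e y else 1 - t e y))"
      using t by (intro prod.cong refl emeasure_unif_lessThan)
    also have "\<dots> = ennreal (\<Prod>e\<in>F. if b e then t e y else 1 - t e y)"
      using t by (intro prod_ennreal) auto
    finally show "(\<integral>\<^sup>+v. \<psi> y * indicator ?B (y, v) \<partial>unifs) = \<psi> y *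
        ennreal (\<Prod>e\<in>F. if b e then t e y else 1 - t e y)" .
  qed
  finally show ?thesis .
qed

text \<open>
  Independent randomness \<open>R\<close> may be added to the conditioning: apply the conditional Bernoulli
  property for every fixed value of \<open>R\<close>.
\<close>

lemma conditionally_bernoulli_extend:
  fixes W :: "'a::polish_space \<Rightarrow> 'a \<Rightarrow> real"
  assumes M: "prob_space M" and R: "prob_space R" and W: "connection_function W"
    and N: "N \<in> M \<rightarrow>\<^sub>M count_space UNIV" and S: "\<And>k. S k \<in> M \<rightarrow>\<^sub>M borel"
        and A: "\<And>i j. A i j \<in> M \<rightarrow>\<^sub>M count_space UNIV"
    and cb: "conditionally_bernoulli M W N S A" and F: "finite F" "F \<subseteq> {(i, j). i < j}"
    and h: "h \<in> borel_measurable (labelled_points \<Otimes>\<^sub>M R)"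
  shows "(\<integral>\<^sup>+y. h ((N (fst y), \<lambda>k. S k (fst y)), snd y) *
      indicator {\<omega>\<in>space M. \<forall>(i, j)\<in>F. A i j \<omega> = a i j} (fst y) \<partial>(M \<Otimes>\<^sub>M R)) =
    (\<integral>\<^sup>+y. h ((N (fst y), \<lambda>k. S k (fst y)), snd y) *
        ennreal (edge_weight W F a (\<lambda>k. S k (fst y))) \<partial>(M \<Otimes>\<^sub>M R))"
proof -
  interpret M: prob_space M by fact
  interpret R: prob_space R by fact
  interpret P: pair_sigma_finite M R ..
  note X = measurable_labelled_points[of N M S, OF N S]
  note ws = measurable_compose[OF measurable_snd measurable_edge_weight[OF W, of F a]]
  have "(\<lambda>\<omega>. edge_weight W F a (snd (N \<omega>, \<lambda>k. S k \<omega>))) \<in> borel_measurable M"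
    using measurable_compose[OF X ws] .
  then have w: "(\<lambda>\<omega>. ennreal (edge_weight W F a (\<lambda>k. S k \<omega>))) \<in> borel_measurable M" by simp
  have hX: "(\<lambda>y. h ((N (fst y), \<lambda>k. S k (fst y)), snd y)) \<in> borel_measurable (M \<Otimes>\<^sub>M R)"
    by (rule measurable_compose[OF measurable_Pair[OF measurable_compose[OF measurable_fst X]
        measurable_snd] h])
  have m1: "(\<lambda>y. h ((N (fst y), \<lambda>k. S k (fst y)), snd y) *
      indicator {\<omega>\<in>space M. \<forall>(i, j)\<in>F. A i j \<omega> = a i j} (fst y)) \<in> borel_measurable (M \<Otimes>\<^sub>M R)"
    by (rule borel_measurable_times_ennreal[OF hX
        measurable_compose[OF measurable_fst
        borel_measurable_indicator[OF sets_edge_event[OF A F(1)]]]])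
  have m2: "(\<lambda>y. h ((N (fst y), \<lambda>k. S k (fst y)), snd y) *
      ennreal (edge_weight W F a (\<lambda>k. S k (fst y)))) \<in> borel_measurable (M \<Otimes>\<^sub>M R)"
    by (rule borel_measurable_times_ennreal[OF hX measurable_compose[OF measurable_fst w]])
  have h': "(\<lambda>x. h (x, r)) \<in> borel_measurable labelled_points" if "r \<in> space R" for r
    using measurable_compose[OF measurable_Pair2'[OF that] h] .
  show ?thesis
    unfolding P.nn_integral_snd[OF m1[unfolded], symmetric] P.nn_integral_snd[OF m2, symmetric]
    by (rule nn_integral_cong) (simp add: conditionally_bernoulliD[OF M W N S A cb F h'])
qed

lemma nn_integral_fst_prob:
  assumes "prob_space V" "f \<in> borel_measurable Y"
  shows "(\<integral>\<^sup>+z. f (fst z) \<partial>(Y \<Otimes>\<^sub>M V)) = (\<integral>\<^sup>+y. f y \<partial>Y)"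
  by (subst (2) prob_space.distr_pair_fst[OF assms(1), of Y, symmetric], subst nn_integral_distr)
      (use assms in auto)

text \<open>
  Fix the value \<open>l\<close> of the shuffled list. The edges within \<open>l\<close> are then edges of the given graph at
  pairwise different index pairs, since \<open>l\<close> has no repetitions; all other edges are decided by
  different coins. Integrating first the coins and then the given edges yields the product of both
  weights, which is the weight of the relabelled graph.
\<close>

lemma relabelled_edges_law:
  fixes W :: "'a::polish_space \<Rightarrow> 'a \<Rightarrow> real" and \<eta> :: "'a measure"
  assumes M: "prob_space M" and W: "connection_function W"
    and N: "N \<in> M \<rightarrow>\<^sub>M count_space UNIV" and S: "\<And>k. S k \<in> M \<rightarrow>\<^sub>M borel"
        and A: "\<And>i j. A i j \<in> M \<rightarrow>\<^sub>M count_space UNIV"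
    and cb: "conditionally_bernoulli M W N S A" and D: "D \<in> sets borel"
    and \<eta>: "prob_space \<eta>" "sets \<eta> = sets borel" and F: "finite F" "F \<subseteq> {(i, j). i < j}"
        and H: "H \<in> sets labelled_points"
  defines "Q \<equiv> iid_seq \<eta>"
  defines "Y \<equiv> M \<Otimes>\<^sub>M (unif \<Otimes>\<^sub>M Q)"
  defines "sh \<equiv> \<lambda>y :: 'w \<times> real \<times> (nat \<Rightarrow> 'a). shuffled D (N (fst y), \<lambda>k. S k (fst y)) (fst (snd y))"
  defines "T \<equiv> \<lambda>y i. relocated (sh y) (\<lambda>k. S k (fst y)) (snd (snd y)) i"
  defines "A' \<equiv> \<lambda>z i j. relabelled_edge W (\<lambda>i j. A i j (fst (fst z))) (sh (fst z)) (T (fst z)) (snd z) i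
      j"
  shows "(\<integral>\<^sup>+z. indicator H (enat (length (sh (fst z))), T (fst z)) *
      indicator {z\<in>space (Y \<Otimes>\<^sub>M unifs). \<forall>(i, j)\<in>F. A' z i j = a i j} z \<partial>(Y \<Otimes>\<^sub>M unifs)) =
    (\<integral>\<^sup>+z. indicator H (enat (length (sh (fst z))), T (fst z)) *
        ennreal (edge_weight W F a (T (fst z))) \<partial>(Y \<Otimes>\<^sub>M unifs))"
    and "\<And>i j. (\<lambda>z. A' z i j) \<in> Y \<Otimes>\<^sub>M unifs \<rightarrow>\<^sub>M count_space UNIV"
    and "sh \<in> Y \<rightarrow>\<^sub>M count_space UNIV"
    and "\<And>i. (\<lambda>y. T y i) \<in> Y \<rightarrow>\<^sub>M borel"
proof -
  interpret M: prob_space M by fact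
  interpret U: prob_space unif by (rule prob_space_uniform)
  interpret Us: prob_space unifs by (rule prob_space_PiM) (rule prob_space_uniform)
  interpret Q: prob_space Q unfolding Q_def by (rule prob_space_PiM) (rule \<eta>)
  interpret R: prob_space "unif \<Otimes>\<^sub>M Q" by (rule prob_space_pair) unfold_locales
  interpret Y: prob_space Y unfolding Y_def by (rule prob_space_pair) unfold_locales
  let ?R = "unif \<Otimes>\<^sub>M Q" and ?P = "labelled_points :: (enat \<times> (nat \<Rightarrow> 'a)) measure" and ?E = "Y \<Otimes>\<^sub>M unifs"
  have Q\<eta>: "(\<lambda>s. s i) \<in> Q \<rightarrow>\<^sub>M borel" for i
    using measurable_component_singleton[of i UNIV "\<lambda>_. \<eta>"] measurable_cong_sets[OF refl \<eta>(2), of Q]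
        unfolding Q_def by simp
  have XP: "(\<lambda>y. ((N (fst y), \<lambda>k. S k (fst y)), snd y)) \<in> Y \<rightarrow>\<^sub>M ?P \<Otimes>\<^sub>M ?R"
    unfolding Y_def
        by (rule measurable_Pair[OF measurable_compose[OF measurable_fst
        measurable_labelled_points[OF N S]] measurable_snd])
  have shP: "(\<lambda>p. shuffled D (fst p) (fst (snd p))) \<in> ?P \<Otimes>\<^sub>M ?R \<rightarrow>\<^sub>M count_space UNIV"
    using measurable_compose[OF measurable_Pair[OF measurable_fst
        measurable_compose[OF measurable_snd measurable_fst]] measurable_shuffled[OF D]] by simp
  show shm: "sh \<in> Y \<rightarrow>\<^sub>M count_space UNIV"
    using measurable_compose[OF XP shP] by (simp add: sh_def[abs_def])
  have sndP: "(\<lambda>p. snd (fst p) i) \<in> ?P \<Otimes>\<^sub>M ?R \<rightarrow>\<^sub>M borel" for i by measurable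
  have tP: "(\<lambda>p. snd (snd p) i) \<in> ?P \<Otimes>\<^sub>M ?R \<rightarrow>\<^sub>M borel" for i
    by (rule measurable_compose[OF measurable_snd measurable_compose[OF measurable_snd Q\<eta>]])
  define Tl where "Tl l p i = relocated l (snd (fst p)) (snd (snd p)) i" for l
      and p :: "(enat \<times> (nat \<Rightarrow> 'a)) \<times> real \<times> (nat \<Rightarrow> 'a)" and i
  have TlP: "(\<lambda>p. Tl l p i) \<in> ?P \<Otimes>\<^sub>M ?R \<rightarrow>\<^sub>M borel" for l i
    unfolding Tl_def using measurable_relocated[of "\<lambda>_. l", OF _ sndP tP] by simp
  define X where "X y = ((N (fst y), \<lambda>k. S k (fst y)), snd y)" for y :: "'w \<times> real \<times> (nat \<Rightarrow> 'a)"
  note XP' = XP[folded X_def]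
  have TT: "T y i = Tl (sh y) (X y) i" for y i by (simp add: T_def Tl_def X_def)
  have TT': "T y = Tl (sh y) (X y)" for y by (rule ext) (rule TT)
  show Tm: "(\<lambda>y. T y i) \<in> Y \<rightarrow>\<^sub>M borel" for i
    unfolding TT by (rule measurable_compose_countable[OF _ shm]) (rule measurable_compose[OF XP' TlP])
  have TQ: "(\<lambda>y. (enat (length (sh y)), T y)) \<in> Y \<rightarrow>\<^sub>M ?P"
    using measurable_labelled_points[of "\<lambda>y. enat (length (sh y))" Y "\<lambda>k y. T y k",
        OF measurable_compose[OF shm] Tm] by simp
  have coordm: "(\<lambda>z. snd z n) \<in> ?E \<rightarrow>\<^sub>M borel" for n
    using measurable_compose[OF measurable_snd measurable_component_singleton[of n UNIV "\<lambda>_. unif"],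
        of Y] by simp
  have WT: "(\<lambda>y. W (Tl l (X y) i) (Tl l (X y) j)) \<in> borel_measurable Y" for l i j
    by (rule measurable_connection_function[OF W measurable_compose[OF XP' TlP]
        measurable_compose[OF XP' TlP]])
  show A'm: "(\<lambda>z. A' z i j) \<in> ?E \<rightarrow>\<^sub>M count_space UNIV" for i j
  proof -
    have "(\<lambda>z. (\<lambda>l z. relabelled_edge W (\<lambda>i j. A i j (fst (fst z))) l (Tl l (X (fst z))) (snd z) i j)
        (sh (fst z)) z) \<in> ?E \<rightarrow>\<^sub>M count_space UNIV"
    proof (rule measurable_compose_countable[OF _ measurable_compose[OF measurable_fst shm]])
      fix l
      have Am: "(\<lambda>z. A p q (fst (fst z))) \<in> ?E \<rightarrow>\<^sub>M count_space UNIV" for p q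
        unfolding Y_def
            by (rule measurable_compose[OF measurable_fst measurable_compose[OF measurable_fst A]])
      have "{z\<in>space ?E. snd z n < W (Tl l (X (fst z)) p) (Tl l (X (fst z)) q)} \<in> sets ?E" for n p q
        using coordm measurable_compose[OF measurable_fst WT] by (rule borel_measurable_less)
      then have Vm: "(\<lambda>z. snd z n < W (Tl l (X (fst z)) p) (Tl l (X (fst z)) q)) \<in> ?E \<rightarrow>\<^sub>M count_space
          UNIV" for n p q
        unfolding pred_def .
      show "(\<lambda>z. relabelled_edge W (\<lambda>i j. A i j (fst (fst z))) l (Tl l (X (fst z))) (snd z) i j) \<in> ?E \<rightarrow>\<^sub>M
          count_space UNIV"
        unfolding relabelled_edge_def using Am Vm by (cases "i = j"; cases "max i j < length l")
            simp_all
    qed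
    then show ?thesis by (simp add: A'_def TT')
  qed
  let ?f = "\<lambda>z. indicator H (enat (length (sh (fst z))), T (fst z)) *
      indicator {z\<in>space ?E. \<forall>(i, j)\<in>F. A' z i j = a i j} z :: ennreal"
  let ?g = "\<lambda>z. indicator H (enat (length (sh (fst z))), T (fst z)) *
      ennreal (edge_weight W F a (T (fst z)))"
  have Hm: "(\<lambda>y. indicator H (enat (length (sh y)), T y) :: ennreal) \<in> borel_measurable Y"
    by (rule measurable_compose[OF TQ borel_measurable_indicator[OF H]])
  have wm: "(\<lambda>y. ennreal (edge_weight W F a (T y))) \<in> borel_measurable Y"
    using measurable_compose[OF TQ measurable_compose[OF measurable_snd measurable_edge_weight[OF W,
        of F a]]] by simp
  have gm: "(\<lambda>y. indicator H (enat (length (sh y)), T y) * ennreal (edge_weight W F a (T y))) \<in>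
      borel_measurable Y"
    by (rule borel_measurable_times_ennreal[OF Hm wm])
  show "(\<integral>\<^sup>+z. ?f z \<partial>?E) = (\<integral>\<^sup>+z. ?g z \<partial>?E)"
  proof (rule nn_integral_eq_by_cases[OF measurable_compose[OF measurable_fst shm]])
    show "?g \<in> borel_measurable ?E" by (rule measurable_compose[OF measurable_fst gm])
    show "?f \<in> borel_measurable ?E"
      by (rule borel_measurable_times_ennreal[OF measurable_compose[OF measurable_fst Hm]
          borel_measurable_indicator[OF sets_edge_event[of "\<lambda>i j z. A' z i j", OF A'm F(1)]]])
    fix l :: "nat list"
    show "(\<integral>\<^sup>+z. ?f z * indicator {l} (sh (fst z)) \<partial>?E) = (\<integral>\<^sup>+z. ?g z * indicator {l} (sh (fst z)) \<partial>?E)"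
    proof (cases "distinct l")
      case False
      then have "indicator {l} (sh y) = (0::ennreal)" for y
        using distinct_shuffled by (auto simp: sh_def indicator_def)
      then show ?thesis by simp
    next
      case True
      define F1 where "F1 = {e\<in>F. snd e < length l}"
      define F2 where "F2 = F - F1"
      \<comment> \<open>Takes a pair of positions in l to the pair of original indices, the smaller one first.\<close>
      define \<sigma> where "\<sigma> e = (min (l ! fst e) (l ! snd e), max (l ! fst e) (l ! snd e))" for e
      define a' where "a' p q = (\<exists>e\<in>F1. \<sigma> e = (p, q) \<and> a (fst e) (snd e))" for p q
      have F1F: "finite F1" "finite F2" "F = F1 \<union> F2" "F1 \<inter> F2 = {}" using F
          by (auto simp: F1_def F2_def)
      have F1lt: "fst e < snd e" "snd e < length l" "fst e < length l" if "e \<in> F1" for e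
        using that F(2) by (auto simp: F1_def)
      have inj: "inj_on \<sigma> F1"
      proof (rule inj_onI)
        fix e e' assume e: "e \<in> F1" "e' \<in> F1" "\<sigma> e = \<sigma> e'"
        note lt = F1lt[OF e(1)] F1lt[OF e(2)]
        have "(l ! fst e = l ! fst e' \<and> l ! snd e = l ! snd e') \<or>
            (l ! fst e = l ! snd e' \<and> l ! snd e = l ! fst e')"
          using e(3) by (auto simp: \<sigma>_def min_def max_def split: if_splits)
        then have "(fst e = fst e' \<and> snd e = snd e') \<or> (fst e = snd e' \<and> snd e = fst e')"
          using lt True by (simp add: nth_eq_iff_index_eq)
        then show "e = e'" using lt by (auto simp: prod_eq_iff)
      qed
      have a'\<sigma>: "a' (fst (\<sigma> e)) (snd (\<sigma> e)) = a (fst e) (snd e)" if "e \<in> F1" for e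
        using inj that by (auto simp: a'_def inj_on_def)
      have \<sigma>lt: "\<sigma> ` F1 \<subseteq> {(i, j). i < j}"
      proof (rule image_subsetI)
        fix e assume e: "e \<in> F1"
        then have "l ! fst e \<noteq> l ! snd e" using F1lt[OF e] True by (simp add: nth_eq_iff_index_eq)
        then show "\<sigma> e \<in> {(i, j). i < j}" by (auto simp: \<sigma>_def min_def max_def)
      qed
      define hl where "hl p = (indicator H (enat (length l), Tl l p) *
          indicator {l} (shuffled D (fst p) (fst (snd p))) :: ennreal)" for p
      define thr where "thr e y = W (Tl l (X y) (fst e)) (Tl l (X y) (snd e))" for e y
      define tp where "tp e p = W (Tl l p (fst e)) (Tl l p (snd e))" for e p
      define wp where "wp p = ennreal (\<Prod>e\<in>F2. if a (fst e) (snd e) then tp e p else 1 - tp e p)" for p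
      let ?AE = "{\<omega>\<in>space M. \<forall>(i, j)\<in>\<sigma> ` F1. A i j \<omega> = a' i j}"
      have hlm: "hl \<in> borel_measurable (?P \<Otimes>\<^sub>M ?R)"
      proof -
        have "(\<lambda>p. (enat (length l), Tl l p)) \<in> ?P \<Otimes>\<^sub>M ?R \<rightarrow>\<^sub>M ?P"
          using measurable_labelled_points[of "\<lambda>_. enat (length l)" "?P \<Otimes>\<^sub>M ?R" "\<lambda>k p. Tl l p k",
              OF _ TlP] by simp
        from borel_measurable_times_ennreal[OF
            measurable_compose[OF this borel_measurable_indicator[OF H]] measurable_compose[OF shP,
            of "indicator {l}" borel]]
        show ?thesis by (simp add: hl_def[abs_def])
      qed
      have tpm: "tp e \<in> borel_measurable (?P \<Otimes>\<^sub>M ?R)" for e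
        unfolding tp_def[abs_def] by (rule measurable_connection_function[OF W TlP TlP])
      have wpm: "wp \<in> borel_measurable (?P \<Otimes>\<^sub>M ?R)"
      proof -
        have "(\<lambda>p. if a (fst e) (snd e) then tp e p else 1 - tp e p) \<in> borel_measurable (?P \<Otimes>\<^sub>M ?R)" for
            e
          using tpm[of e] by simp
        then show ?thesis unfolding wp_def[abs_def]
            by (intro measurable_compose[OF borel_measurable_prod measurable_ennreal])
      qed
      have hX: "(\<lambda>y. hl (X y)) \<in> borel_measurable Y" by (rule measurable_compose[OF XP' hlm])
      have AEm: "(\<lambda>y. indicator ?AE (fst y) :: ennreal) \<in> borel_measurable Y"
        unfolding Y_def using sets_edge_event[OF A finite_imageI[OF F1F(1)]]
        by (intro measurable_compose[OF measurable_fst borel_measurable_indicator])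
      have "(\<integral>\<^sup>+z. ?f z * indicator {l} (sh (fst z)) \<partial>?E) =
        (\<integral>\<^sup>+z. (hl (X (fst z)) * indicator ?AE (fst (fst z))) *
            indicator {z\<in>space ?E. \<forall>e\<in>F2. (snd z (prod_encode e) < thr e (fst z)) = a (fst e) (snd e)} z
            \<partial>?E)"
      proof (rule nn_integral_cong)
        fix z assume z: "z \<in> space ?E"
        show "?f z * indicator {l} (sh (fst z)) = (hl (X (fst z)) * indicator ?AE (fst (fst z))) *
            indicator {z\<in>space ?E. \<forall>e\<in>F2. (snd z (prod_encode e) < thr e (fst z)) = a (fst e) (snd e)}
            z"
        proof (cases "sh (fst z) = l")
          case False
          then have "hl (X (fst z)) = 0" by (simp add: hl_def X_def sh_def)
          then show ?thesis using False by simp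
        next
          case l: True
          have T: "T (fst z) = Tl l (X (fst z))" using TT' l by simp
          have hl: "hl (X (fst z)) = indicator H (enat (length l), T (fst z))"
            using l T by (simp add: hl_def X_def sh_def)
          have A1: "A' z (fst e) (snd e) = A (fst (\<sigma> e)) (snd (\<sigma> e)) (fst (fst z))" if "e \<in> F1" for e
            using F1lt[OF that] by (simp add: A'_def relabelled_edge_def l \<sigma>_def max_def)
          have A2: "A' z (fst e) (snd e) = (snd z (prod_encode e) < thr e (fst z))" if "e \<in> F2" for e
          proof -
            have "fst e < snd e" "\<not> snd e < length l" using that F(2) by (auto simp: F2_def F1_def)
            then show ?thesis by (simp add: A'_def relabelled_edge_def l T thr_def max_def min_def)
          qed
          have w: "fst (fst z) \<in> space M" using z by (auto simp: space_pair_measure Y_def)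
          have "(\<forall>(i, j)\<in>F. A' z i j = a i j) \<longleftrightarrow> (\<forall>e\<in>F1. A' z (fst e) (snd e) = a (fst e) (snd e)) \<and>
              (\<forall>e\<in>F2. A' z (fst e) (snd e) = a (fst e) (snd e))"
            unfolding F1F(3) by (auto simp: case_prod_beta)
          also have "\<dots> \<longleftrightarrow> fst (fst z) \<in> ?AE \<and>
              (\<forall>e\<in>F2. (snd z (prod_encode e) < thr e (fst z)) = a (fst e) (snd e))"
            using w A1 A2 a'\<sigma> by (auto simp: case_prod_beta)
          finally have "indicator {z\<in>space ?E. \<forall>(i, j)\<in>F. A' z i j = a i j} z =
             (indicator ?AE (fst (fst z)) *
                 indicator {z\<in>space ?E. \<forall>e\<in>F2. (snd z (prod_encode e) < thr e (fst z)) =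
                 a (fst e) (snd e)} z :: ennreal)"
            using z by (simp add: indicator_def)
          then show ?thesis unfolding hl l by (simp add: mult.assoc)
        qed
      qed
      also have "\<dots> = (\<integral>\<^sup>+y. (hl (X y) * indicator ?AE (fst y)) *
          ennreal (\<Prod>e\<in>F2. if a (fst e) (snd e) then thr e y else 1 - thr e y) \<partial>Y)"
        by (rule fresh_coins[OF Y.prob_space_axioms F1F(2) borel_measurable_times_ennreal[OF hX AEm]])
           (use WT connection_function_values[OF W] in \<open>auto simp: thr_def[abs_def]\<close>)
      also have "\<dots> = (\<integral>\<^sup>+y. (\<lambda>p. hl p * wp p) ((N (fst y), \<lambda>k. S k (fst y)), snd y) *
          indicator ?AE (fst y) \<partial>(M \<Otimes>\<^sub>M ?R))"
        unfolding Y_def wp_def thr_def tp_def X_def by (simp add: mult_ac)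
      also have "\<dots> = (\<integral>\<^sup>+y. (\<lambda>p. hl p * wp p) ((N (fst y), \<lambda>k. S k (fst y)), snd y) *
          ennreal (edge_weight W (\<sigma> ` F1) a' (\<lambda>k. S k (fst y))) \<partial>(M \<Otimes>\<^sub>M ?R))"
        by (rule conditionally_bernoulli_extend[OF M R.prob_space_axioms W N S A cb _ \<sigma>lt])
           (use F1F hlm wpm in \<open>auto intro!: borel_measurable_times_ennreal\<close>)
      also have "\<dots> = (\<integral>\<^sup>+y. indicator H (enat (length (sh y)), T y) * ennreal (edge_weight W F a (T y)) *
          indicator {l} (sh y) \<partial>Y)"
        unfolding Y_def
      proof (rule nn_integral_cong)
        fix y assume "y \<in> space (M \<Otimes>\<^sub>M ?R)"
        show "(\<lambda>p. hl p * wp p) ((N (fst y), \<lambda>k. S k (fst y)), snd y) *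
            ennreal (edge_weight W (\<sigma> ` F1) a' (\<lambda>k. S k (fst y))) =
           indicator H (enat (length (sh y)), T y) * ennreal (edge_weight W F a (T y)) *
               indicator {l} (sh y)"
        proof (cases "sh y = l")
          case False
          then have "hl (X y) = 0" by (simp add: hl_def X_def sh_def)
          then show ?thesis using False by (simp add: X_def)
        next
          case l: True
          have T: "T y = Tl l (X y)" using TT' l by simp
          have hl: "hl (X y) = indicator H (enat (length l), T y)"
            using l T by (simp add: hl_def X_def sh_def)
          let ?v = "\<lambda>e. if a (fst e) (snd e) then W (T y (fst e)) (T y (snd e)) else 1 - W (T y (fst e))
              (T y (snd e))"
          have "edge_weight W (\<sigma> ` F1) a' (\<lambda>k. S k (fst y)) = (\<Prod>e\<in>F1. ?v e)"
            unfolding edge_weight_def case_prod_beta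
          proof (subst prod.reindex[OF inj], unfold o_def, rule prod.cong[OF refl])
            fix e assume e: "e \<in> F1"
            have "W (S (fst (\<sigma> e)) (fst y)) (S (snd (\<sigma> e)) (fst y)) =
                W (S (l ! fst e) (fst y)) (S (l ! snd e) (fst y))"
              using connection_function_values(3)[OF W] by (auto simp: \<sigma>_def min_def max_def)
            also have "\<dots> = W (T y (fst e)) (T y (snd e))"
              using F1lt[OF e] by (simp add: T_def relocated_def l)
            finally show "(if a' (fst (\<sigma> e)) (snd (\<sigma> e)) then W (S (fst (\<sigma> e)) (fst y))
                (S (snd (\<sigma> e)) (fst y)) else 1 - W (S (fst (\<sigma> e)) (fst y)) (S (snd (\<sigma> e)) (fst y))) =
                ?v e"
              unfolding a'\<sigma>[OF e] by simp
          qed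
          moreover have "wp (X y) = ennreal (\<Prod>e\<in>F2. ?v e)" unfolding wp_def tp_def T ..
          moreover have "edge_weight W F a (T y) = (\<Prod>e\<in>F1. ?v e) * (\<Prod>e\<in>F2. ?v e)"
            unfolding edge_weight_def case_prod_beta F1F(3) by (rule prod.union_disjoint)
                (use F1F in auto)
          moreover have "0 \<le> (\<Prod>e\<in>F1. ?v e)" "0 \<le> (\<Prod>e\<in>F2. ?v e)"
            using connection_function_values[OF W] by (auto intro!: prod_nonneg)
          ultimately show ?thesis
            using hl l by (simp add: X_def[symmetric] ennreal_mult mult_ac)
        qed
      qed
      also have "\<dots> = (\<integral>\<^sup>+z. ?g z * indicator {l} (sh (fst z)) \<partial>?E)"
        by (rule nn_integral_fst_prob[symmetric, OF Us.prob_space_axioms])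
           (intro borel_measurable_times_ennreal Hm wm measurable_compose[OF shm], simp)
      finally show ?thesis .
    qed
  qed
qed

section \<open>The i.i.d. representation of the restricted process\<close>

lemma restrict_adjacency_relabelled:
  fixes \<xi> :: "(('a::polish_space \<times> 'a) \<times> bool) measure"
  assumes \<xi>: "\<xi> = sum_of_diracs edge_space {(i, j). enat i < n \<and>
      enat j < n} (\<lambda>(i, j). ((s i, s j), a i j))"
    and D: "D \<in> sets borel" and irrefl: "\<And>i. \<not> a i i" and sym: "\<And>i j. a j i = a i j"
    and l: "distinct l" "set l = visible D (n, s)"
  shows "restrict_adjacency D \<xi> = sum_of_diracs edge_space {(i, j). enat i < enat (length l) \<and>
      enat j < enat (length l)}
     (\<lambda>(i, j). ((relocated l s t i, relocated l s t j), relabelled_edge W a l t' v i j))"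
proof -
  let ?J = "visible D (n, s)" and ?f = "\<lambda>(i, j). ((s i, s j), a i j)"
  have sp: "space (edge_space :: (('a \<times> 'a) \<times> bool) measure) = UNIV" by (auto simp: space_pair_measure)
  have s: "sets \<xi> = sets edge_space" unfolding \<xi> by simp
  have 1: "restrict_adjacency D \<xi> = sum_of_diracs edge_space (?J \<times> ?J) ?f"
  proof (rule measure_eqI)
    show sets: "sets (restrict_adjacency D \<xi>) = sets (sum_of_diracs edge_space (?J \<times> ?J) ?f)"
      by (simp add: restrict_adjacency_def s)
    fix X assume "X \<in> sets (restrict_adjacency D \<xi>)"
    then have X: "X \<in> sets edge_space" by (simp add: restrict_adjacency_def s)
    have "D \<times> D \<in> sets (borel :: ('a \<times> 'a) measure)" using D by (auto simp: borel_prod[symmetric])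
    then have DD: "(D \<times> D) \<times> (UNIV::bool set) \<in> sets edge_space" by (intro pair_measureI) auto
    have "emeasure (restrict_adjacency D \<xi>) X = emeasure \<xi> (X \<inter> ((D \<times> D) \<times> UNIV))"
      by (rule emeasure_restrict_adjacency[OF s D X])
    also have "\<dots> = emeasure (count_space UNIV)
        {p \<in> {(i, j). enat i < n \<and> enat j < n}. ?f p \<in> X \<inter> ((D \<times> D) \<times> UNIV)}"
      unfolding \<xi> by (rule emeasure_sum_of_diracs) (use X DD sp in auto)
    also have "{p \<in> {(i, j). enat i < n \<and> enat j < n}. ?f p \<in> X \<inter> ((D \<times> D) \<times> UNIV)} =
        {p \<in> ?J \<times> ?J. ?f p \<in> X}"
      by (auto simp: visible_def)
    also have "emeasure (count_space UNIV) \<dots> = emeasure (sum_of_diracs edge_space (?J \<times> ?J) ?f) X"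
      by (rule emeasure_sum_of_diracs[symmetric]) (use X sp in auto)
    finally show "emeasure (restrict_adjacency D \<xi>) X =
        emeasure (sum_of_diracs edge_space (?J \<times> ?J) ?f) X" .
  qed
  let ?I = "{(i, j). enat i < enat (length l) \<and> enat j < enat (length l)}"
  have bij1: "bij_betw (\<lambda>i. l ! i) {..<length l} ?J"
    using bij_betw_nth[OF l(1) refl l(2)[symmetric]] .
  have I: "?I = {..<length l} \<times> {..<length l}" by auto
  have bij: "bij_betw (\<lambda>(i, j). (l ! i, l ! j)) ?I (?J \<times> ?J)"
    unfolding I bij_betw_def using bij1 by (auto simp: image_paired_Times bij_betw_def inj_on_def)
  have 2: "sum_of_diracs edge_space (?J \<times> ?J) ?f =
      sum_of_diracs edge_space ?I (\<lambda>p. ?f ((\<lambda>(i, j). (l ! i, l ! j)) p))"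
    by (rule sum_of_diracs_reindex[OF bij]) (simp add: sp)
  have edge: "relabelled_edge W a l t' v i j = a (l ! i) (l ! j)" if "i < length l" "j < length l" for i
      j
    using that irrefl sym by (auto simp: relabelled_edge_def min_def max_def)
  have 3: "sum_of_diracs edge_space ?I (\<lambda>p. ?f ((\<lambda>(i, j). (l ! i, l ! j)) p)) =
     sum_of_diracs edge_space ?I (\<lambda>(i, j). ((relocated l s t i, relocated l s t j),
         relabelled_edge W a l t' v i j))"
    unfolding sum_of_diracs_def by (rule distr_cong) (auto simp: relocated_def edge)
  show ?thesis using 1 2 3 by simp
qed

lemma relabelled_edge_simps [simp]:
  "\<not> relabelled_edge W a l t v i i" "relabelled_edge W a l t v j i = relabelled_edge W a l t v i j"
  by (auto simp: relabelled_edge_def max.commute min.commute)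

text \<open>
  The representation is built on \<^term>\<open>(ext M \<Otimes>\<^sub>M (unif \<Otimes>\<^sub>M (iid_seq \<eta>))) \<Otimes>\<^sub>M unifs\<close>, where
  the shuffling and the continuation take place, and pulled back along the map of \<open>ext_splitting\<close>.
  The function \<open>g\<close> serves to produce locations with law \<open>\<eta>\<close> from uniform variables.
\<close>

lemma vertex_law_exists:
  fixes \<xi> :: "'w \<Rightarrow> (('a::polish_space \<times> 'a) \<times> bool) measure" and \<eta> :: "'a measure"
  assumes M: "prob_space M" and \<xi>: "graph_process M \<xi>" "\<forall>\<omega>\<in>space M. directs (\<nu> \<omega>) (\<xi> \<omega>)"
    and \<nu>: "\<nu> \<in> M \<rightarrow>\<^sub>M measure_algebra borel"
    and D: "D \<in> sets borel" "bounded D"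
    and \<eta>: "prob_space \<eta>" "sets \<eta> = sets borel" "measure \<eta> D = 1" "\<And>x. measure \<eta> {x} = 0"
    and g: "g \<in> borel_measurable unif" "distr unif borel g = \<eta>"
    and counts: "multinomial_counts M \<nu> \<eta> D"
  shows "vertex_law M \<xi> D \<eta>"
proof -
  obtain W N S A where W: "connection_function W" and ram: "random_adjacency_measure M \<xi>"
    and rep: "representation (ext M) (\<xi> \<circ> fst) W N S A"
    using \<xi>(1) by (auto simp: graph_process_def graph_process_connected_by_def)
  have N: "N \<in> ext M \<rightarrow>\<^sub>M count_space UNIV" and S: "\<And>k. S k \<in> ext M \<rightarrow>\<^sub>M borel"
      and A: "\<And>i j. A i j \<in> ext M \<rightarrow>\<^sub>M count_space UNIV"
    and cb: "conditionally_bernoulli (ext M) W N S A"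
    using rep by (auto simp: representation_def)
  interpret E0: prob_space "ext M" by (rule prob_space.prob_space_ext[OF M])
  have rep': "representation (ext M) ((\<lambda>\<omega>. restrict_adjacency UNIV (\<xi> \<omega>)) \<circ> fst) W N S A"
    using rep by (simp add: restrict_adjacency_UNIV o_def)
  have AE\<nu>: "AE z in ext M. \<forall>E\<in>sets borel. emeasure (\<nu> (fst z)) E =
      emeasure (count_space UNIV) {i. enat i < N z \<and> S i z \<in> E}"
    using AE_directing_counts[OF ram \<xi>(2) _ rep'] by simp
  have fin: "AE z in ext M. finite (visible D (N z, \<lambda>k. S k z))"
    using AE\<nu>
  proof (rule AE_mp, intro AE_I2 impI)
    fix z assume z: "z \<in> space (ext M)"
      and a: "\<forall>E\<in>sets borel. emeasure (\<nu> (fst z)) E =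
          emeasure (count_space UNIV) {i. enat i < N z \<and> S i z \<in> E}"
    have "fst z \<in> space M" by (rule measurable_space[OF measurable_ext_fst z])
    then have "simple_measure (\<nu> (fst z))" using \<xi>(2) by (auto simp: directs_def)
    then have "emeasure (\<nu> (fst z)) D < \<infinity>" by (rule simple_measure_finite[OF _ D])
    then have "emeasure (count_space UNIV) (visible D (N z, \<lambda>k. S k z)) < \<infinity>" using a D(1)
        by (simp add: visible_def)
    then show "finite (visible D (N z, \<lambda>k. S k z))"
        by (auto simp: emeasure_count_space split: if_splits)
  qed
  obtain w :: "nat \<Rightarrow> real" where w: "\<And>(m::nat) Dj n.
     (\<forall>j<m. Dj j \<in> sets borel) \<and> disjoint_family_on Dj {..<m} \<and> (\<Union>j<m. Dj j) = D \<Longrightarrow>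
     measure M {\<omega> \<in> space M. \<forall>j<m. emeasure (\<nu> \<omega>) (Dj j) = of_nat (n j)} =
       w (\<Sum>j<m. n j) * (\<Prod>j<m. measure \<eta> (Dj j) ^ n j / fact (n j))"
    using counts unfolding multinomial_counts_def by blast
  have cnt: "measure (ext M) {z\<in>space (ext M). \<forall>j<m. emeasure (count_space UNIV)
      {i\<in>visible D (N z, \<lambda>k. S k z). S i z \<in> Dj j} = of_nat (n j)} =
      w (\<Sum>j<m. n j) * (\<Prod>j<m. measure \<eta> (Dj j) ^ n j / fact (n j))"
    if Dj: "\<forall>j<m. Dj j \<in> sets borel" "disjoint_family_on Dj {..<m}" "(\<Union>j<m. Dj j) = D" for m :: nat
        and Dj and n :: "nat \<Rightarrow> nat"
  proof -
    let ?V = "{z\<in>space (ext M). \<forall>j<m. emeasure (count_space UNIV)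
        {i\<in>visible D (N z, \<lambda>k. S k z). S i z \<in> Dj j} = of_nat (n j)}"
    let ?C = "{z \<in> space (ext M). \<forall>j<m. emeasure (\<nu> (fst z)) (Dj j) = of_nat (n j)}"
    have "measure (ext M) ?V =
      measure (ext M) ?C"
    proof (rule measure_eq_AE)
      show "AE z in ext M. (z \<in> ?V) =
        (z \<in> ?C)"
        using AE\<nu>
      proof (rule AE_mp, intro AE_I2 impI)
        fix z assume a: "\<forall>E\<in>sets borel. emeasure (\<nu> (fst z)) E =
            emeasure (count_space UNIV) {i. enat i < N z \<and> S i z \<in> E}"
        have "{i\<in>visible D (N z, \<lambda>k. S k z). S i z \<in> Dj j} = {i. enat i < N z \<and> S i z \<in> Dj j}" if
            "j < m" for j
          using Dj(3) that by (auto simp: visible_def)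
        then show "(z \<in> ?V) =
          (z \<in> ?C)"
          using a Dj(1) by simp
      qed
      show "?V \<in> sets (ext M)"
        by (rule sets_visible_counts[OF N S D(1)]) (use Dj in auto)
      show "?C \<in> sets (ext M)"
        by (rule sets_count_events[of "\<lambda>\<omega>. \<nu> (fst \<omega>)", OF measurable_compose[OF measurable_ext_fst \<nu>]])
            (use Dj in auto)
    qed
    also have "\<dots> = measure M {\<omega> \<in> space M. \<forall>j<m. emeasure (\<nu> \<omega>) (Dj j) = of_nat (n j)}"
      by (rule prob_space.measure_ext_fst[OF M sets_count_events[OF \<nu>]]) (use Dj in auto)
    also have "\<dots> = w (\<Sum>j<m. n j) * (\<Prod>j<m. measure \<eta> (Dj j) ^ n j / fact (n j))"
      by (rule w) (use Dj in auto)
    finally show ?thesis .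
  qed
  define Q where "Q = (iid_seq \<eta>)"
  define Y where "Y = ext M \<Otimes>\<^sub>M (unif \<Otimes>\<^sub>M Q)"
  let ?E = "Y \<Otimes>\<^sub>M unifs"
  have u: "prob_space unif" by (rule prob_space_uniform)
  have Us: "prob_space unifs" by (rule prob_space_PiM) (rule u)
  have Qp: "prob_space Q" unfolding Q_def by (rule prob_space_PiM) (rule \<eta>)
  have Rp: "prob_space (unif \<Otimes>\<^sub>M Q)" by (rule prob_space_pair[OF u Qp])
  obtain \<Phi> where \<Phi>: "measure_preserving (ext M) ?E \<Phi>" and \<Phi>1: "\<And>z. fst (fst (fst (\<Phi> z))) = fst z"
    using ext_splitting[OF M g] unfolding Y_def Q_def by blast
  have \<Phi>m: "\<Phi> \<in> ext M \<rightarrow>\<^sub>M ?E" and \<Phi>d: "distr (ext M) ?E \<Phi> = ?E" using \<Phi>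
      by (auto simp: measure_preserving_def)
  have \<Phi>Y: "measure_preserving (ext M) Y (\<lambda>z. fst (\<Phi> z))"
    by (rule measure_preserving_comp[OF \<Phi> measure_preserving_fst[OF Us]])
  define sh where "sh y = shuffled D (N (fst y), \<lambda>k. S k (fst y)) (fst (snd y))" for y ::
      "('w \<times> (nat \<Rightarrow> real)) \<times> real \<times> (nat \<Rightarrow> 'a)"
  define T where "T y i = relocated (sh y) (\<lambda>k. S k (fst y)) (snd (snd y)) i" for y i
  define A' where "A' z i j = relabelled_edge W (\<lambda>i j. A i j (fst (fst z))) (sh (fst z)) (T (fst z))
      (snd z) i j" for z i j
  note edges = relabelled_edges_law[OF E0.prob_space_axioms W N S A cb D(1) \<eta>(1,2), folded Q_def,
      folded Y_def, folded sh_def, folded T_def, folded A'_def]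
  have shm: "sh \<in> Y \<rightarrow>\<^sub>M count_space UNIV" using edges(3)[of "{}" "{}"] by simp
  have Tm: "(\<lambda>y. T y i) \<in> Y \<rightarrow>\<^sub>M borel" for i using edges(4)[of "{}" "{}"] by simp
  have A'm: "(\<lambda>z. A' z i j) \<in> ?E \<rightarrow>\<^sub>M count_space UNIV" for i j using edges(2)[of "{}" "{}"] by simp
  have TP: "(\<lambda>y. (enat (length (sh y)), T y)) \<in> Y \<rightarrow>\<^sub>M labelled_points"
    using measurable_labelled_points[of "\<lambda>y. enat (length (sh y))" Y "\<lambda>k y. T y k",
        OF measurable_compose[OF shm] Tm] by simp
  define N' where "N' z = enat (length (sh (fst (\<Phi> z))))" for z
  define S' where "S' k z = T (fst (\<Phi> z)) k" for k z
  define B' where "B' i j z = A' (\<Phi> z) i j" for i j z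
  have S'eq: "(\<lambda>k. S' k z) = T (fst (\<Phi> z))" for z by (simp add: S'_def)
  have N'm: "N' \<in> ext M \<rightarrow>\<^sub>M count_space UNIV"
    unfolding N'_def[abs_def]
        by (rule measurable_compose[OF
        measurable_compose[OF \<Phi>m measurable_compose[OF measurable_fst shm]]]) simp
  have S'm: "S' k \<in> ext M \<rightarrow>\<^sub>M borel" for k
    unfolding S'_def[abs_def]
        by (rule measurable_compose[OF \<Phi>m measurable_compose[OF measurable_fst Tm]])
  have B'm: "B' i j \<in> ext M \<rightarrow>\<^sub>M count_space UNIV" for i j
    unfolding B'_def[abs_def] by (rule measurable_compose[OF \<Phi>m A'm])
  have transfer: "emeasure (ext M) {z\<in>space (ext M). P (fst (\<Phi> z))} = emeasure Y {y\<in>space Y. P y}"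
    if P: "{y\<in>space Y. P y} \<in> sets Y" for P
  proof -
    have m: "(\<lambda>z. fst (\<Phi> z)) \<in> ext M \<rightarrow>\<^sub>M Y" and d: "distr (ext M) Y (\<lambda>z. fst (\<Phi> z)) = Y"
      using \<Phi>Y by (auto simp: measure_preserving_def)
    have "emeasure Y {y\<in>space Y. P y} = emeasure (distr (ext M) Y (\<lambda>z. fst (\<Phi> z))) {y\<in>space Y. P y}"
        unfolding d ..
    also have "\<dots> = emeasure (ext M) ((\<lambda>z. fst (\<Phi> z)) -` {y\<in>space Y. P y} \<inter> space (ext M))"
      by (rule emeasure_distr[OF m P])
    also have "(\<lambda>z. fst (\<Phi> z)) -` {y\<in>space Y. P y} \<inter> space (ext M) = {z\<in>space (ext M). P (fst (\<Phi> z))}"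
      using measurable_space[OF m] by auto
    finally show ?thesis by simp
  qed
  have "iid_representation (ext M) ((\<lambda>\<omega>. restrict_adjacency D (\<xi> \<omega>)) \<circ> fst) W N' S' B' \<eta>"
  proof (rule iid_representationI[OF E0.prob_space_axioms W N'm S'm B'm \<eta>(1,2,4)])
    fix n :: enat and H :: "(nat \<Rightarrow> 'a) set" assume "H \<in> sets (iid_seq \<eta>)"
    then have H: "H \<in> sets Q" by (simp add: Q_def)
    show "emeasure (ext M) {\<omega>\<in>space (ext M). N' \<omega> = n \<and> (\<lambda>k. S' k \<omega>) \<in> H} =
      emeasure (ext M) {\<omega>\<in>space (ext M). N' \<omega> = n} * emeasure (iid_seq \<eta>) H"
    proof (cases n)
      case (enat k)
      have "sets Q = sets (iid_seq (borel :: 'a measure))"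
        unfolding Q_def by (rule sets_PiM_cong[OF refl]) (rule \<eta>)
      then have "UNIV \<times> H \<in> sets (labelled_points :: (enat \<times> (nat \<Rightarrow> 'a)) measure)"
         "{enat k} \<times> H \<in> sets (labelled_points :: (enat \<times> (nat \<Rightarrow> 'a)) measure)" using H by auto
      from measurable_sets[OF TP this(2)]
      have m1: "{y\<in>space Y. length (sh y) = k \<and> T y \<in> H} \<in> sets Y"
        by (simp add: vimage_def Int_def conj_commute)
      have m2: "{y\<in>space Y. length (sh y) = k} \<in> sets Y"
        using measurable_sets[OF shm, of "{l. length l = k}"]
            by (simp add: vimage_def Int_def conj_commute)
      have law: "emeasure Y {y\<in>space Y. length (sh y) = k \<and> T y \<in> H} =
          emeasure Y {y\<in>space Y. length (sh y) = k} * emeasure Q H"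
      proof -
        have "emeasure Y {y\<in>space Y. length (sh y) = k \<and> (\<lambda>i. T y i) \<in> H} =
            emeasure Y {y\<in>space Y. length (sh y) = k} * emeasure Q H"
          unfolding T_def sh_def Y_def Q_def
        proof (rule relocated_law[where w=w])
          show "H \<in> sets (\<Pi>\<^sub>M k\<in>UNIV. \<eta>)" using H by (simp only: Q_def)
        qed (fact E0.prob_space_axioms N S D(1) fin \<eta>(1-3) | erule (2) cnt)+
        then show ?thesis .
      qed
      show ?thesis
        using transfer[OF m1] transfer[OF m2] law unfolding N'_def S'eq enat Q_def by simp
    next
      case infinity
      then show ?thesis by (simp add: N'_def)
    qed
  next
    show "\<not> B' i i \<omega>" for i \<omega> by (simp add: B'_def A'_def)
    show "B' j i \<omega> = B' i j \<omega>" for i j \<omega> by (simp add: B'_def A'_def)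
  next
    fix F a and H :: "(enat \<times> (nat \<Rightarrow> 'a)) set"
    assume F: "finite F" "F \<subseteq> {(i::nat, j). i < j}" and H: "H \<in> sets labelled_points"
    have HT: "(\<lambda>z. indicator H (enat (length (sh (fst z))), T (fst z)) :: ennreal) \<in> borel_measurable
        ?E"
      by (rule measurable_compose[OF measurable_fst
          measurable_compose[OF TP borel_measurable_indicator[OF H]]])
    have "(\<lambda>z. edge_weight W F a (snd (enat (length (sh (fst z))), T (fst z)))) \<in> borel_measurable ?E"
      by (rule measurable_compose[OF measurable_fst
          measurable_compose[OF TP measurable_compose[OF measurable_snd measurable_edge_weight[OF W]]]])
    then have "(\<lambda>z. edge_weight W F a (T (fst z))) \<in> borel_measurable ?E" by simp
    then have wm: "(\<lambda>z. ennreal (edge_weight W F a (T (fst z)))) \<in> borel_measurable ?E"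
      by (rule measurable_compose[OF _ measurable_ennreal])
    have Am: "{z\<in>space ?E. \<forall>(i, j)\<in>F. A' z i j = a i j} \<in> sets ?E"
      by (rule sets_edge_event[of "\<lambda>i j z. A' z i j", OF A'm F(1)])
    have "(\<integral>\<^sup>+z. indicator H (N' z, \<lambda>k. S' k z) *
        indicator {z\<in>space (ext M). \<forall>(i, j)\<in>F. B' i j z = a i j} z \<partial>ext M) =
      (\<integral>\<^sup>+z. (\<lambda>z. indicator H (enat (length (sh (fst z))), T (fst z)) *
          indicator {z\<in>space ?E. \<forall>(i, j)\<in>F. A' z i j = a i j} z) (\<Phi> z) \<partial>ext M)"
      by (rule nn_integral_cong) (auto simp: N'_def S'eq B'_def indicator_def measurable_space[OF \<Phi>m])
    also have "\<dots> = (\<integral>\<^sup>+z. indicator H (enat (length (sh (fst z))), T (fst z)) *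
        indicator {z\<in>space ?E. \<forall>(i, j)\<in>F. A' z i j = a i j} z \<partial>distr (ext M) ?E \<Phi>)"
      by (rule nn_integral_distr[OF \<Phi>m, symmetric]) (unfold \<Phi>d,
          rule borel_measurable_times_ennreal[OF HT borel_measurable_indicator[OF Am]])
    also have "\<dots> = (\<integral>\<^sup>+z. indicator H (enat (length (sh (fst z))), T (fst z)) *
        ennreal (edge_weight W F a (T (fst z))) \<partial>distr (ext M) ?E \<Phi>)"
      unfolding \<Phi>d by (rule edges(1)[OF F H])
    also have "\<dots> = (\<integral>\<^sup>+z. (\<lambda>z. indicator H (enat (length (sh (fst z))), T (fst z)) *
        ennreal (edge_weight W F a (T (fst z)))) (\<Phi> z) \<partial>ext M)"
      by (rule nn_integral_distr[OF \<Phi>m]) (unfold \<Phi>d, rule borel_measurable_times_ennreal[OF HT wm])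
    also have "\<dots> = (\<integral>\<^sup>+z. indicator H (N' z, \<lambda>k. S' k z) *
        ennreal (edge_weight W F a (\<lambda>k. S' k z)) \<partial>ext M)"
      by (rule nn_integral_cong) (simp add: N'_def S'eq)
    finally show "(\<integral>\<^sup>+z. indicator H (N' z, \<lambda>k. S' k z) *
        indicator {z\<in>space (ext M). \<forall>(i, j)\<in>F. B' i j z = a i j} z \<partial>ext M) =
      (\<integral>\<^sup>+z. indicator H (N' z, \<lambda>k. S' k z) * ennreal (edge_weight W F a (\<lambda>k. S' k z)) \<partial>ext M)" .
  next
    \<comment> \<open>These properties hold almost surely on the space of the given representation, hence also almost
      surely at the image of z in that space.\<close>
    define ok where "ok x \<longleftrightarrow> \<xi> (fst x) =
        sum_of_diracs edge_space {(i, j). enat i < N x \<and>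
        enat j < N x} (\<lambda>(i, j). ((S i x, S j x), A i j x))
      \<and> (\<forall>i. \<not> A i i x) \<and> (\<forall>i j. A j i x = A i j x) \<and> finite (visible D (N x, \<lambda>k. S k x))" for x
    have "AE x in ext M. ok x"
      using rep fin unfolding representation_def ok_def by (auto simp: o_def)
    moreover have "measure_preserving (ext M) (ext M) (\<lambda>z. fst (fst (\<Phi> z)))"
      by (rule measure_preserving_comp[OF \<Phi>Y]) (unfold Y_def, rule measure_preserving_fst[OF Rp])
    ultimately have "AE z in ext M. ok (fst (fst (\<Phi> z)))"
      unfolding measure_preserving_def by (metis AE_distrD)
    then show "AE z in ext M. ((\<lambda>\<omega>. restrict_adjacency D (\<xi> \<omega>)) \<circ> fst) z =
        sum_of_diracs edge_space {(i, j). enat i < N' z \<and>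
            enat j < N' z} (\<lambda>(i, j). ((S' i z, S' j z), B' i j z))"
    proof (rule AE_mp, intro AE_I2 impI)
      fix z assume "ok (fst (fst (\<Phi> z)))"
      then have ok: "\<xi> (fst z) = sum_of_diracs edge_space {(i, j). enat i < N (fst (fst (\<Phi> z))) \<and>
          enat j < N (fst (fst (\<Phi> z)))}
           (\<lambda>(i, j). ((S i (fst (fst (\<Phi> z))), S j (fst (fst (\<Phi> z)))), A i j (fst (fst (\<Phi> z)))))"
        "\<And>i. \<not> A i i (fst (fst (\<Phi> z)))" "\<And>i j. A j i (fst (fst (\<Phi> z))) = A i j (fst (fst (\<Phi> z)))"
        "finite (visible D (N (fst (fst (\<Phi> z))), \<lambda>k. S k (fst (fst (\<Phi> z)))))"
        unfolding ok_def \<Phi>1 by blast+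
      have sh: "distinct (sh (fst (\<Phi> z)))"
          "set (sh (fst (\<Phi> z))) = visible D (N (fst (fst (\<Phi> z))), \<lambda>k. S k (fst (fst (\<Phi> z))))"
        unfolding sh_def by (rule distinct_shuffled, rule set_shuffled[OF ok(4)])
      show "((\<lambda>\<omega>. restrict_adjacency D (\<xi> \<omega>)) \<circ> fst) z =
        sum_of_diracs edge_space {(i, j). enat i < N' z \<and>
            enat j < N' z} (\<lambda>(i, j). ((S' i z, S' j z), B' i j z))"
        using restrict_adjacency_relabelled[OF ok(1) D(1) ok(2,3) sh, of "snd (snd (fst (\<Phi> z)))" W
            "T (fst (\<Phi> z))" "snd (\<Phi> z)"]
        by (simp add: N'_def S'_def B'_def A'_def T_def[symmetric])
    qed
  qed
  then show ?thesis unfolding vertex_law_def using W by blast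
qed

section \<open>Gluing sampling functions\<close>

text \<open>
  Sampling functions are only measurable on the unit interval. Composed with this retraction they are
  Borel functions on the whole line, to which substitution in integrals applies.
\<close>

definition clamp01 :: "real \<Rightarrow> real" where "clamp01 x = max 0 (min 1 x)"

lemma clamp01_simps: "0 \<le> x \<Longrightarrow> x \<le> 1 \<Longrightarrow> clamp01 x = x" "clamp01 x \<in> {0..1}"
  by (auto simp: clamp01_def)

lemma measurable_clamp01:
  assumes "f \<in> restrict_space borel {0..1} \<rightarrow>\<^sub>M N" shows "(\<lambda>x. f (clamp01 x)) \<in> borel \<rightarrow>\<^sub>M N"
  by (rule measurable_compose[OF _ assms])
     (auto intro!: measurable_restrict_space2 simp: clamp01_def)

lemma emeasure_distr_restrict_unit:
  fixes f :: "real \<Rightarrow> 'a::polish_space"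
  assumes f: "f \<in> restrict_space borel {0..1} \<rightarrow>\<^sub>M borel"
  shows "\<And>E. E \<in> sets borel \<Longrightarrow> emeasure (distr (restrict_space lborel {0..1}) borel f) E =
      (\<integral>\<^sup>+x. indicator {0..1} x * indicator E (f (clamp01 x)) \<partial>lborel)"
    and "distr unif borel (\<lambda>x. f (clamp01 x)) = distr (restrict_space lborel {0..1}) borel f"
proof -
  have f': "f \<in> restrict_space lborel {0..1} \<rightarrow>\<^sub>M borel"
    using f by (simp cong: measurable_cong_sets sets_restrict_space_cong)
  note fc = measurable_clamp01[OF f]
  have A: "(\<lambda>x. f (clamp01 x)) -` G \<in> sets borel" if "G \<in> sets borel" for G
    using measurable_sets[OF fc that] by simp
  have 1: "emeasure (distr (restrict_space lborel {0..1}) borel f) G =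
      emeasure lborel ({0..1} \<inter> (\<lambda>x. f (clamp01 x)) -` G)"
    if G: "G \<in> sets borel" for G
  proof -
    have "emeasure (distr (restrict_space lborel {0..1}) borel f) G =
        emeasure (restrict_space lborel {0..1}) (f -` G \<inter> {0..1})"
      by (subst emeasure_distr[OF f' G]) (simp add: space_restrict_space)
    also have "\<dots> = emeasure lborel (f -` G \<inter> {0..1})"
      by (rule emeasure_restrict_space) auto
    also have "f -` G \<inter> {0..1} = {0..1} \<inter> (\<lambda>x. f (clamp01 x)) -` G" by (auto simp: clamp01_simps)
    finally show ?thesis .
  qed
  show "distr unif borel (\<lambda>x. f (clamp01 x)) = distr (restrict_space lborel {0..1}) borel f"
  proof (rule measure_eqI)
    fix G assume "G \<in> sets (distr unif borel (\<lambda>x. f (clamp01 x)))"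
    then have G: "G \<in> sets borel" by simp
    have fu: "(\<lambda>x. f (clamp01 x)) \<in> unif \<rightarrow>\<^sub>M borel" using fc by simp
    show "emeasure (distr unif borel (\<lambda>x. f (clamp01 x))) G =
        emeasure (distr (restrict_space lborel {0..1}) borel f) G"
      unfolding 1[OF G] by (subst emeasure_distr[OF fu G], subst emeasure_uniform_measure)
          (use A[OF G] ennreal_div_one in auto)
  qed simp
  fix E :: "'a set" assume E: "E \<in> sets borel"
  have "emeasure (distr (restrict_space lborel {0..1}) borel f) E =
      (\<integral>\<^sup>+x. indicator ({0..1} \<inter> (\<lambda>x. f (clamp01 x)) -` E) x \<partial>lborel)"
    unfolding 1[OF E] using A[OF E] by (intro nn_integral_indicator[symmetric]) auto
  also have "\<dots> = (\<integral>\<^sup>+x. indicator {0..1} x * indicator E (f (clamp01 x)) \<partial>lborel)"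
    by (rule nn_integral_cong) (auto simp: indicator_def)
  finally show "emeasure (distr (restrict_space lborel {0..1}) borel f) E =
      (\<integral>\<^sup>+x. indicator {0..1} x * indicator E (f (clamp01 x)) \<partial>lborel)" .
qed

definition glued :: "real \<Rightarrow> (real \<Rightarrow> 'a) \<Rightarrow> (real \<Rightarrow> 'a) \<Rightarrow> real \<Rightarrow> 'a" where
  "glued p f h x = (if x < p then f (x / p) else h ((x - p) / (1 - p)))"

lemma measurable_glued:
  fixes f h :: "real \<Rightarrow> 'a::polish_space"
  assumes p: "0 < p" "p < 1"
    and f: "f \<in> restrict_space borel {0..1} \<rightarrow>\<^sub>M borel" and h: "h \<in> restrict_space borel {0..1} \<rightarrow>\<^sub>M borel"
  shows "glued p f h \<in> restrict_space borel {0..1} \<rightarrow>\<^sub>M borel"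
proof -
  have fm: "(\<lambda>x. f (clamp01 (x / p))) \<in> borel \<rightarrow>\<^sub>M borel"
    by (rule measurable_compose[OF _ measurable_clamp01[OF f]]) simp
  have hm: "(\<lambda>x. h (clamp01 ((x - p) / (1 - p)))) \<in> borel \<rightarrow>\<^sub>M borel"
    by (rule measurable_compose[OF _ measurable_clamp01[OF h]]) simp
  have "(\<lambda>x. if x < p then f (clamp01 (x / p)) else h (clamp01 ((x - p) / (1 - p)))) \<in> borel \<rightarrow>\<^sub>M borel"
    by (rule measurable_If[OF fm hm]) simp
  then have "(\<lambda>x. if x < p then f (clamp01 (x / p)) else h (clamp01 ((x - p) / (1 - p)))) \<in>
      restrict_space borel {0..1} \<rightarrow>\<^sub>M borel"
    by (rule measurable_restrict_space1)
  then show ?thesis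
    by (rule measurable_cong[THEN iffD1, rotated])
        (use p in \<open>auto simp: glued_def clamp01_simps field_simps space_restrict_space\<close>)
qed

text \<open>
  Substitute \<open>x = p y\<close> on \<open>[0, p)\<close> and \<open>x = p + (1 - p) y\<close> on \<open>[p, 1]\<close>.
\<close>

lemma law_glued:
  fixes f h :: "real \<Rightarrow> 'a::polish_space"
  assumes p: "0 < p" "p < 1"
    and f: "f \<in> restrict_space borel {0..1} \<rightarrow>\<^sub>M borel" and h: "h \<in> restrict_space borel {0..1} \<rightarrow>\<^sub>M borel"
    and E: "E \<in> sets borel"
  shows "emeasure (distr (restrict_space lborel {0..1}) borel (glued p f h)) E =
    ennreal p * emeasure (distr (restrict_space lborel {0..1}) borel f) E + ennreal (1 - p) *
        emeasure (distr (restrict_space lborel {0..1}) borel h) E"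
proof -
  have fm: "(\<lambda>x. indicator E (f (clamp01 (x / p))) :: ennreal) \<in> borel_measurable borel"
    by (rule measurable_compose[OF measurable_compose[OF _ measurable_clamp01[OF f]]
        borel_measurable_indicator[OF E]]) simp
  have hm: "(\<lambda>x. indicator E (h (clamp01 ((x - p) / (1 - p)))) :: ennreal) \<in> borel_measurable borel"
    by (rule measurable_compose[OF measurable_compose[OF _ measurable_clamp01[OF h]]
        borel_measurable_indicator[OF E]]) simp
  have m1: "(\<lambda>x. indicator {0..<p} x * indicator E (f (clamp01 (x / p))) :: ennreal) \<in> borel_measurable
      borel"
    by (rule borel_measurable_times_ennreal[OF _ fm]) simp
  have m2: "(\<lambda>x. indicator {p..1} x * indicator E (h (clamp01 ((x - p) / (1 - p)))) :: ennreal) \<in>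
      borel_measurable borel"
    by (rule borel_measurable_times_ennreal[OF _ hm]) simp
  have "emeasure (distr (restrict_space lborel {0..1}) borel (glued p f h)) E =
     (\<integral>\<^sup>+x. indicator {0..1} x * indicator E (glued p f h (clamp01 x)) \<partial>lborel)"
    by (rule emeasure_distr_restrict_unit(1)[OF measurable_glued[OF p f h] E])
  also have "\<dots> = (\<integral>\<^sup>+x. indicator {0..<p} x * indicator E (f (clamp01 (x / p))) + indicator {p..1} x *
      indicator E (h (clamp01 ((x - p) / (1 - p)))) \<partial>lborel)"
  proof (rule nn_integral_cong)
    fix x :: real
    show "indicator {0..1} x * indicator E (glued p f h (clamp01 x)) =
      (indicator {0..<p} x * indicator E (f (clamp01 (x / p))) + indicator {p..1} x *
          indicator E (h (clamp01 ((x - p) / (1 - p)))) :: ennreal)"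
    proof (cases "x \<in> {0..1}")
      case True
      then have c: "clamp01 x = x" by (simp add: clamp01_simps)
      show ?thesis
      proof (cases "x < p")
        case lt: True
        then have "clamp01 (x / p) = x / p" using True p by (intro clamp01_simps) auto
        then show ?thesis using True lt c by (simp add: glued_def)
      next
        case ge: False
        then have "clamp01 ((x - p) / (1 - p)) = (x - p) / (1 - p)" using True p
            by (intro clamp01_simps) auto
        then show ?thesis using True ge c by (simp add: glued_def)
      qed
    next
      case False
      then show ?thesis using p by auto
    qed
  qed
  also have "\<dots> = (\<integral>\<^sup>+x. indicator {0..<p} x * indicator E (f (clamp01 (x / p))) \<partial>lborel) +
      (\<integral>\<^sup>+x. indicator {p..1} x * indicator E (h (clamp01 ((x - p) / (1 - p)))) \<partial>lborel)"
    by (rule nn_integral_add) (use m1 m2 in simp_all)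
  also have "(\<integral>\<^sup>+x. indicator {0..<p} x * indicator E (f (clamp01 (x / p))) \<partial>lborel) = ennreal p *
      (\<integral>\<^sup>+x. indicator {0..1} x * indicator E (f (clamp01 x)) \<partial>lborel)"
  proof -
    have "(\<integral>\<^sup>+x. indicator {0..<p} x * indicator E (f (clamp01 (x / p))) \<partial>lborel) =
      ennreal \<bar>p\<bar> * (\<integral>\<^sup>+x. indicator {0..<p} (0 + p * x) *
          indicator E (f (clamp01 ((0 + p * x) / p))) \<partial>lborel)"
      by (rule nn_integral_real_affine[OF m1]) (use p in simp)
    also have "(\<integral>\<^sup>+x. indicator {0..<p} (0 + p * x) *
        indicator E (f (clamp01 ((0 + p * x) / p))) \<partial>lborel) =
      (\<integral>\<^sup>+x. indicator {0..1} x * indicator E (f (clamp01 x)) \<partial>lborel)"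
      by (rule nn_integral_cong_AE, rule AE_mp[OF AE_lborel_singleton[of 1]], rule AE_I2)
         (use p in \<open>auto simp: indicator_def zero_le_mult_iff\<close>)
    finally show ?thesis using p by simp
  qed
  also have "(\<integral>\<^sup>+x. indicator {p..1} x * indicator E (h (clamp01 ((x - p) / (1 - p)))) \<partial>lborel) =
      ennreal (1 - p) * (\<integral>\<^sup>+x. indicator {0..1} x * indicator E (h (clamp01 x)) \<partial>lborel)"
  proof -
    have "(\<integral>\<^sup>+x. indicator {p..1} x * indicator E (h (clamp01 ((x - p) / (1 - p)))) \<partial>lborel) =
      ennreal \<bar>1 - p\<bar> * (\<integral>\<^sup>+x. indicator {p..1} (p + (1 - p) * x) *
          indicator E (h (clamp01 ((p + (1 - p) * x - p) / (1 - p)))) \<partial>lborel)"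
      by (rule nn_integral_real_affine[OF m2]) (use p in simp)
    also have "(\<integral>\<^sup>+x. indicator {p..1} (p + (1 - p) * x) *
        indicator E (h (clamp01 ((p + (1 - p) * x - p) / (1 - p)))) \<partial>lborel) =
      (\<integral>\<^sup>+x. indicator {0..1} x * indicator E (h (clamp01 x)) \<partial>lborel)"
    proof (rule nn_integral_cong)
      fix x :: real
      have "p + (1 - p) * x \<le> 1 \<longleftrightarrow> (1 - p) * x \<le> (1 - p) * 1" by auto
      also have "\<dots> \<longleftrightarrow> x \<le> 1" using p by (subst mult_le_cancel_left_pos) auto
      finally have "p + (1 - p) * x \<in> {p..1} \<longleftrightarrow> x \<in> {0..1}" using p by (auto simp: zero_le_mult_iff)
      then show "indicator {p..1} (p + (1 - p) * x) *
          indicator E (h (clamp01 ((p + (1 - p) * x - p) / (1 - p)))) =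
          (indicator {0..1} x * indicator E (h (clamp01 x)) :: ennreal)"
        using p by (simp add: indicator_def)
    qed
    finally show ?thesis using p by simp
  qed
  finally show ?thesis
    by (simp only: emeasure_distr_restrict_unit(1)[OF f E] emeasure_distr_restrict_unit(1)[OF h E])
qed

lemma multinomial_counts_scale:
  assumes "multinomial_counts M \<nu> \<mu> D" and c: "c \<noteq> 0"
    and \<eta>: "\<And>E. E \<in> sets borel \<Longrightarrow> E \<subseteq> D \<Longrightarrow> measure \<eta> E = measure \<mu> E / c"
  shows "multinomial_counts M \<nu> \<eta> D"
proof -
  obtain w :: "nat \<Rightarrow> real" where w: "\<And>(m::nat) Dj n.
     (\<forall>j<m. Dj j \<in> sets borel) \<and> disjoint_family_on Dj {..<m} \<and> (\<Union>j<m. Dj j) = D \<Longrightarrow>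
     measure M {\<omega> \<in> space M. \<forall>j<m. emeasure (\<nu> \<omega>) (Dj j) = of_nat (n j)} =
       w (\<Sum>j<m. n j) * (\<Prod>j<m. measure \<mu> (Dj j) ^ n j / fact (n j))"
    using assms(1) unfolding multinomial_counts_def by blast
  show ?thesis
    unfolding multinomial_counts_def
  proof (rule exI[of _ "\<lambda>k. w k * c ^ k"], intro allI impI)
    fix m :: nat and Dj n
    assume A: "(\<forall>j<m. Dj j \<in> sets borel) \<and> disjoint_family_on Dj {..<m} \<and> (\<Union>j<m. Dj j) = D"
    have "(\<Prod>j<m. measure \<mu> (Dj j) ^ n j / fact (n j)) =
        (\<Prod>j<m. c ^ n j * (measure \<eta> (Dj j) ^ n j / fact (n j)))"
    proof (rule prod.cong[OF refl])
      fix j assume "j \<in> {..<m}"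
      then have "measure \<eta> (Dj j) = measure \<mu> (Dj j) / c" using A by (intro \<eta>) auto
      then show "measure \<mu> (Dj j) ^ n j / fact (n j) = c ^ n j * (measure \<eta> (Dj j) ^ n j / fact (n j))"
        using c by (simp add: power_divide)
    qed
    also have "\<dots> = c ^ (\<Sum>j<m. n j) * (\<Prod>j<m. measure \<eta> (Dj j) ^ n j / fact (n j))"
      by (simp only: prod.distrib power_sum)
    finally show "measure M {\<omega> \<in> space M. \<forall>j<m. emeasure (\<nu> \<omega>) (Dj j) = of_nat (n j)} =
       w (\<Sum>j<m. n j) * c ^ (\<Sum>j<m. n j) * (\<Prod>j<m. measure \<eta> (Dj j) ^ n j / fact (n j))"
      unfolding w[OF A] by simp
  qed
qed

text \<open>
  If \<open>x\<close> were an atom of \<open>\<mu>\<close>, both points would be at \<open>x\<close> with positive probability, which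
  contradicts simplicity.
\<close>

lemma multinomial_counts_diffuse:
  fixes \<nu> :: "'w \<Rightarrow> 'a::polish_space measure"
  assumes simple: "\<And>\<omega>. \<omega> \<in> space M \<Longrightarrow> simple_measure (\<nu> \<omega>)" and D: "D \<in> sets borel"
    and mult: "multinomial_counts M \<nu> \<mu> D"
    and pos: "measure M {\<omega>\<in>space M. emeasure (\<nu> \<omega>) D = 2} > 0" and x: "x \<in> D"
  shows "measure \<mu> {x} = 0"
proof -
  obtain w :: "nat \<Rightarrow> real" where w: "\<And>(m::nat) Dj n.
     (\<forall>j<m. Dj j \<in> sets borel) \<and> disjoint_family_on Dj {..<m} \<and> (\<Union>j<m. Dj j) = D \<Longrightarrow>
     measure M {\<omega> \<in> space M. \<forall>j<m. emeasure (\<nu> \<omega>) (Dj j) = of_nat (n j)} =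
       w (\<Sum>j<m. n j) * (\<Prod>j<m. measure \<mu> (Dj j) ^ n j / fact (n j))"
    using mult unfolding multinomial_counts_def by blast
  have "measure M {\<omega>\<in>space M. emeasure (\<nu> \<omega>) D = 2} = w 2 * (measure \<mu> D ^ 2 / 2)"
    using w[of 1 "\<lambda>_. D" "\<lambda>_. 2"] D by (simp add: disjoint_family_on_def lessThan_Suc)
  with pos have w2: "w 2 \<noteq> 0" by auto
  define Dj where "Dj = (\<lambda>j::nat. if j = 0 then {x} else D - {x})"
  define n where "n = (\<lambda>j::nat. if j = 0 then 2 else 0 :: nat)"
  have "{\<omega> \<in> space M. \<forall>j<2. emeasure (\<nu> \<omega>) (Dj j) = of_nat (n j)} = {}"
  proof -
    have "emeasure (\<nu> \<omega>) {x} \<noteq> 2" if "\<omega> \<in> space M" for \<omega>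
      using simple_measure_singleton_le[OF simple[OF that], of x] by auto
    then show ?thesis by (auto simp: Dj_def n_def)
  qed
  then have "0 = measure M {\<omega> \<in> space M. \<forall>j<2. emeasure (\<nu> \<omega>) (Dj j) = of_nat (n j)}"
    by (simp only: measure_empty)
  also have "\<dots> = w (\<Sum>j<2. n j) * (\<Prod>j<2. measure \<mu> (Dj j) ^ n j / fact (n j))"
    by (rule w) (use D x in \<open>auto simp: Dj_def disjoint_family_on_def numeral_2_eq_2 less_Suc_eq
        lessThan_Suc\<close>)
  also have "\<dots> = w 2 * (measure \<mu> {x} ^ 2 / 2)"
    by (simp add: n_def Dj_def numeral_2_eq_2)
  finally show ?thesis using w2 by simp
qed

lemma boundedly_exchangeable_multinomial:
  fixes \<nu> :: "'w \<Rightarrow> 'a::polish_space measure"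
  assumes "prob_space M" "boundedly_exchangeable M \<xi> \<nu>"
  shows "\<exists>\<mu>::'a measure. sets \<mu> = sets borel \<and> (\<forall>D\<in>sets borel. bounded D \<longrightarrow> emeasure \<mu> D < \<infinity>) \<and>
     (\<forall>D\<in>sets borel. bounded D \<longrightarrow> multinomial_counts M \<nu> \<mu> D)"
  using assms(2) mixed_poisson_multinomial[OF assms(1)] mixed_binomial_multinomial[OF assms(1)]
  unfolding boundedly_exchangeable_def by (elim conjE disjE) simp_all

text \<open>
  By \<open>vertex_law_unique\<close> a sampling function on \<open>B\<close> has the law \<open>\<mu>(\<cdot> | B)\<close>.
\<close>

lemma sampling_function_law:
  fixes \<xi> :: "'w \<Rightarrow> (('a::polish_space \<times> 'a) \<times> bool) measure" and \<mu> :: "'a measure"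
  assumes M: "prob_space M" and \<xi>: "random_adjacency_measure M \<xi>" "\<forall>\<omega>\<in>space M. directs (\<nu> \<omega>) (\<xi> \<omega>)"
    and \<nu>: "\<nu> \<in> M \<rightarrow>\<^sub>M measure_algebra borel"
    and B: "B \<in> sets borel" and mult: "multinomial_counts M \<nu> \<mu> B"
    and pos: "measure M {\<omega>\<in>space M. emeasure (\<nu> \<omega>) B = 1} > 0"
    and f: "sampling_function M \<xi> B f"
  shows "f \<in> restrict_space borel {0..1} \<rightarrow>\<^sub>M borel" "\<And>x. x \<in> {0..1} \<Longrightarrow> f x \<in> B" "measure \<mu> B > 0"
    "E \<in> sets borel \<Longrightarrow> emeasure (distr (restrict_space lborel {0..1}) borel f) E =
        ennreal (measure \<mu> (E \<inter> B) / measure \<mu> B)"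
proof -
  have fB: "f \<in> restrict_space borel {0..1} \<rightarrow>\<^sub>M restrict_space borel B"
    and law: "vertex_law M \<xi> B (distr (restrict_space lborel {0..1}) borel f)"
    using f by (auto simp: sampling_function_def)
  show "f \<in> restrict_space borel {0..1} \<rightarrow>\<^sub>M borel" using fB by (simp add: measurable_restrict_space2_iff)
  show "f x \<in> B" if "x \<in> {0..1}" for x
    using measurable_space[OF fB, of x] that by (simp add: space_restrict_space)
  note u = vertex_law_unique[OF M \<xi> \<nu> B mult pos law]
  show "measure \<mu> B > 0" by (rule u(1))
  interpret prob_space "distr (restrict_space lborel {0..1}) borel f" by (rule u(2))
  show "emeasure (distr (restrict_space lborel {0..1}) borel f) E =
      ennreal (measure \<mu> (E \<inter> B) / measure \<mu> B)" if "E \<in> sets borel"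
    unfolding emeasure_eq_measure u(4)[OF that] ..
qed

theorem proposition25:
  fixes M :: "'w measure"
    and \<xi> :: "'w \<Rightarrow> (('a::polish_space \<times> 'a) \<times> bool) measure"
    and \<nu> :: "'w \<Rightarrow> 'a measure"
    and B C :: "'a set"
    and f\<^sub>B f\<^sub>C :: "real \<Rightarrow> 'a"
  assumes "prob_space M"
    and "graph_process M \<xi>"
    and "boundedly_exchangeable M \<xi> \<nu>"
    and "B \<in> sets borel" and "bounded B"
    and "C \<in> sets borel" and "bounded C"
    and "B \<inter> C = {}"
    and "measure M {\<omega> \<in> space M. emeasure (\<nu> \<omega>) B = 0} < 1"
    and "measure M {\<omega> \<in> space M. emeasure (\<nu> \<omega>) C = 0} < 1"
    and "sampling_function M \<xi> B f\<^sub>B"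
    and "sampling_function M \<xi> C f\<^sub>C"
  shows "\<exists>p :: real. 0 < p \<and> p < 1 \<and>
    sampling_function M \<xi> (B \<union> C)
      (\<lambda>x. if x < p then f\<^sub>B (x / p) else f\<^sub>C ((x - p) / (1 - p)))"
proof -
  note M = assms(1) and B = assms(4,5) and C = assms(6,7)
  interpret prob_space M by fact
  let ?D = "B \<union> C"
  have D: "?D \<in> sets borel" "bounded ?D" using B C by auto
  obtain \<mu> :: "'a measure" where \<mu>: "sets \<mu> = sets borel" "\<forall>D\<in>sets borel. bounded D \<longrightarrow> emeasure \<mu> D < \<infinity>"
     and "\<forall>D\<in>sets borel. bounded D \<longrightarrow> multinomial_counts M \<nu> \<mu> D"
    using boundedly_exchangeable_multinomial[OF M assms(3)] by (elim exE conjE)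
  then have mult: "D \<in> sets borel \<Longrightarrow> bounded D \<Longrightarrow> multinomial_counts M \<nu> \<mu> D" for D by simp
  have dir: "\<forall>\<omega>\<in>space M. directs (\<nu> \<omega>) (\<xi> \<omega>)" and \<nu>: "\<nu> \<in> M \<rightarrow>\<^sub>M measure_algebra borel"
    using assms(3) by (auto simp: boundedly_exchangeable_def mixed_poisson_process_def
        mixed_binomial_process_def point_process_def)
  have ram: "random_adjacency_measure M \<xi>"
    using assms(2) by (auto simp: graph_process_def graph_process_connected_by_def)
  have simple: "simple_measure (\<nu> \<omega>)" if "\<omega> \<in> space M" for \<omega> using dir that by (auto simp: directs_def)
  have be: "measure M {\<omega>\<in>space M. emeasure (\<nu> \<omega>) F = of_nat n} > 0"
    if "F \<in> sets borel" "bounded F" "measure M {\<omega>\<in>space M. emeasure (\<nu> \<omega>) F = 0} < 1" "n \<ge> 1" for F n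
    using assms(3) that by (auto simp: boundedly_exchangeable_def)
  have B1: "measure M {\<omega>\<in>space M. emeasure (\<nu> \<omega>) B = 1} > 0" using be[OF B assms(9), of 1] by simp
  have C1: "measure M {\<omega>\<in>space M. emeasure (\<nu> \<omega>) C = 1} > 0" using be[OF C assms(10), of 1] by simp
  have "measure M {\<omega>\<in>space M. emeasure (\<nu> \<omega>) ?D = 0} \<le> measure M {\<omega>\<in>space M. emeasure (\<nu> \<omega>) B = 0}"
  proof (rule finite_measure_mono)
    show "{\<omega>\<in>space M. emeasure (\<nu> \<omega>) ?D = 0} \<subseteq> {\<omega>\<in>space M. emeasure (\<nu> \<omega>) B = 0}"
    proof safe
      fix \<omega> assume \<omega>: "\<omega> \<in> space M" "emeasure (\<nu> \<omega>) ?D = 0"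
      have "emeasure (\<nu> \<omega>) B \<le> emeasure (\<nu> \<omega>) ?D"
        by (rule emeasure_mono) (use D simple_measure_sets[OF simple[OF \<omega>(1)]] in auto)
      then show "emeasure (\<nu> \<omega>) B = 0" using \<omega> by simp
    qed
    show "{\<omega>\<in>space M. emeasure (\<nu> \<omega>) B = 0} \<in> sets M"
      using sets_count_events[OF \<nu>, of 1 "\<lambda>_. B" "\<lambda>_. 0"] B by simp
  qed
  also note assms(9)
  finally have D2: "measure M {\<omega>\<in>space M. emeasure (\<nu> \<omega>) ?D = 2} > 0" using be[OF D, of 2] by simp
  note fB = sampling_function_law[OF M ram dir \<nu> B(1) mult[OF B] B1 assms(11)]
  note fC = sampling_function_law[OF M ram dir \<nu> C(1) mult[OF C] C1 assms(12)]
  define b c where "b = measure \<mu> B" and "c = measure \<mu> C"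
  have bc: "b > 0" "c > 0" using fB(3) fC(3) by (auto simp: b_def c_def)
  \<comment> \<open>The mass of B under \<mu> conditioned on the union.\<close>
  define p where "p = b / (b + c)"
  have p: "0 < p" "p < 1" using bc by (auto simp: p_def field_simps)
  have p': "1 - p = c / (b + c)" using bc by (auto simp: p_def field_simps)
  define f where "f = glued p f\<^sub>B f\<^sub>C"
  have fm: "f \<in> restrict_space borel {0..1} \<rightarrow>\<^sub>M borel" unfolding f_def
      by (rule measurable_glued[OF p fB(1) fC(1)])
  define \<eta> where "\<eta> = distr (restrict_space lborel {0..1}) borel f"
  have \<eta>u: "distr unif borel (\<lambda>x. f (clamp01 x)) = \<eta>" unfolding \<eta>_def
      by (rule emeasure_distr_restrict_unit(2)[OF fm])
  have gm: "(\<lambda>x. f (clamp01 x)) \<in> borel_measurable unif" using measurable_clamp01[OF fm] by simp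
  have \<eta>p: "prob_space \<eta>" unfolding \<eta>u[symmetric]
      by (rule prob_space.prob_space_distr[OF prob_space_uniform gm])
  have \<eta>s: "sets \<eta> = sets borel" by (simp add: \<eta>_def)
  have fin: "emeasure \<mu> (F \<inter> G) \<noteq> \<infinity>" if "F \<in> sets borel" "G \<in> sets borel" "bounded G" for F G
    using \<mu>(2)[rule_format, of "F \<inter> G"] that bounded_subset[of G "F \<inter> G"] by auto
  have \<eta>E: "measure \<eta> E = measure \<mu> (E \<inter> ?D) / (b + c)" if E: "E \<in> sets borel" for E
  proof -
    have "emeasure \<eta> E = ennreal p * ennreal (measure \<mu> (E \<inter> B) / b) + ennreal (1 - p) *
        ennreal (measure \<mu> (E \<inter> C) / c)"
      unfolding \<eta>_def f_def law_glued[OF p fB(1) fC(1) E] fB(4)[OF E] fC(4)[OF E] b_def c_def ..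
    also have "\<dots> = ennreal (p * (measure \<mu> (E \<inter> B) / b) + (1 - p) * (measure \<mu> (E \<inter> C) / c))"
    proof -
      have "ennreal x * ennreal y + ennreal z * ennreal v = ennreal (x * y + z * v)"
        if "0 \<le> x" "0 \<le> y" "0 \<le> z" "0 \<le> v" for x y z v using that by (simp add: ennreal_mult)
      then show ?thesis using p bc by simp
    qed
    also have "p * (measure \<mu> (E \<inter> B) / b) + (1 - p) * (measure \<mu> (E \<inter> C) / c) =
        (measure \<mu> (E \<inter> B) + measure \<mu> (E \<inter> C)) / (b + c)"
      unfolding p' unfolding p_def using bc by (simp add: add_divide_distrib)
    also have "measure \<mu> (E \<inter> B) + measure \<mu> (E \<inter> C) = measure \<mu> ((E \<inter> B) \<union> (E \<inter> C))"
      by (rule measure_Union[symmetric]) (use fin E B C \<mu>(1) assms(8) in auto)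
    also have "(E \<inter> B) \<union> (E \<inter> C) = E \<inter> ?D" by auto
    finally show ?thesis by (rule measure_eq_emeasure_eq_ennreal[rotated]) (use bc in simp)
  qed
  have "b + c = measure \<mu> ?D"
    unfolding b_def c_def
    by (rule measure_Union[symmetric]) (use fin[of UNIV] B C \<mu>(1) assms(8) in auto)
  then have \<eta>D: "measure \<eta> ?D = 1" using \<eta>E[OF D(1)] bc by simp
  have diffuse: "measure \<eta> {x} = 0" for x
  proof (cases "x \<in> ?D")
    case True
    have "measure \<mu> {x} = 0" by (rule multinomial_counts_diffuse[OF _ D(1) mult[OF D] D2 True])
        (rule simple)
    then show ?thesis using \<eta>E[of "{x}"] True by simp
  next
    case False
    then show ?thesis using \<eta>E[of "{x}"] by simp
  qed
  have mult\<eta>: "multinomial_counts M \<nu> \<eta> ?D"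
    by (rule multinomial_counts_scale[OF mult[OF D], of "b + c"])
        (use bc \<eta>E in \<open>auto simp: Int_absorb2\<close>)
  have "vertex_law M \<xi> ?D \<eta>"
    by (rule vertex_law_exists[OF M assms(2) dir \<nu> D \<eta>p \<eta>s \<eta>D diffuse gm \<eta>u mult\<eta>])
  moreover have "f \<in> restrict_space borel {0..1} \<rightarrow>\<^sub>M restrict_space borel ?D"
  proof (rule measurable_restrict_space2[OF _ fm])
    show "f \<in> space (restrict_space borel {0..1}) \<rightarrow> ?D"
    proof
      fix x :: real assume "x \<in> space (restrict_space borel {0..1})"
      then have x: "x \<in> {0..1}" by (simp add: space_restrict_space)
      show "f x \<in> ?D"
      proof (cases "x < p")
        case True
        then have "x / p \<in> {0..1}" using x p by auto
        then show ?thesis using fB(2) True by (simp add: f_def glued_def)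
      next
        case False
        then have "(x - p) / (1 - p) \<in> {0..1}" using x p by auto
        then show ?thesis using fC(2) False by (simp add: f_def glued_def)
      qed
    qed
  qed
  ultimately have "sampling_function M \<xi> ?D f" unfolding sampling_function_def \<eta>_def by blast
  moreover have "f = (\<lambda>x. if x < p then f\<^sub>B (x / p) else f\<^sub>C ((x - p) / (1 - p)))"
      by (auto simp: f_def glued_def)
  ultimately show ?thesis using p by blast
qed

end
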